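(* Let $n\in\mathbb{N}$, $n\ge1$, let $$p(t,x,y)=\frac{c(n)\,t}{\left(t^2+|x-y|^2\right)^{(n+1)/2}},\quad t>0,\ x,y\in\mathbb{R}^n,\qquad c(n):=\pi^{-(n+1)/2}\Gamma\left(\tfrac{n+1}{2}\right),$$ be the Cauchy (Poisson) kernel, and let $(S_t)_{t\ge0}$ be a $\beta$-stable subordinator for some $\beta\in(0,1)$, with inverse $(S_t^{-1})_{t\ge0}$. Let $$p^S(t,x,y)=\int_0^\infty p(s,x,y)\,\mathrm{d}_s\mathbb{P}(S_t\le s),\qquad p^{S^{-1}}(t,x,y)=\int_0^\infty p(s,x,y)\,\mathrm{d}_s\mathbb{P}(S_t^{-1}\le s).$$ (a) As $|x-y|t^{-1/\beta}\to\infty$, $$p^S(t,x,y)\sim\frac{\beta2^{\beta-1}\Gamma\left(\frac{n+\beta}{2}\right)}{\pi^{n/2}\Gamma\left(1-\frac\beta2\right)}\,|x-y|^{-n-\beta}t.$$ (b) As $|x-y|t^{-1/\beta}\to0$, $$p^S(t,x,y)\sim\frac{\Gamma\left(\frac{n+1}{2}\right)\Gamma\left(\frac n\beta\right)}{\beta\pi^{(n+1)/2}\Gamma(n)}\,t^{-n/\beta}.$$ (c) As $|x-y|^{-1/\beta}t\to\infty$, $$p^{S^{-1}}(t,x,y)\sim\begin{cases}\displaystyle\frac{\beta}{\pi\Gamma(1-\beta)}\,t^{-\beta}\log\left[|x-y|^{-1/\beta}t\right],&\text{if } n=1,\\[12pt]\displaystyle\frac{\Gamma\left(\frac{n-1}{2}\right)}{2\pi^{(n+1)/2}\Gamma(1-\beta)}\,|x-y|^{1-n}t^{-\beta},&\text{if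 } n\ge2.\end{cases}$$ (d) As $|x-y|^{-1/\beta}t\to0$, $$p^{S^{-1}}(t,x,y)\sim\frac{\Gamma\left(\frac{n+1}{2}\right)}{\pi^{(n+1)/2}\beta\Gamma(\beta)}\,|x-y|^{-n-1}t^\beta.$$
   Context: A $\beta$-stable subordinator ($0<\beta<1$) is a non-decreasing Lévy process $S=(S_t)_{t\ge0}$ on $[0,\infty)$ with $\mathbb{E}\,e^{-rS_t}=e^{-tr^\beta}$ for $r>0$, $t\ge0$. Its generalized right-continuous inverse is $S_t^{-1}=\inf\{s\ge0: S_s>t\}$, $t\ge0$. The notation $\mathrm{d}_s\mathbb{P}(Y\le s)$ means integration with respect to the law of $Y$. The functions $p^S$ and $p^{S^{-1}}$ are the transition densities of $X_{S_t}$ and $X_{S_t^{-1}}$, where $X$ is a symmetric Cauchy process in $\mathbb{R}^n$ with transition density $p$, independent of $S$. Asymptotics: "$f(t,x,y)\sim g(t,x,y)$ as $A(t,x,y)\to\ell$" means that the ratio $f/g$ tends to $1$ as the quantity $A(t,x,y)$, with $t>0$ and $x,y\in\mathbb{R}^n$ ($x\ne y$ where a negative power of $|x-y|$ appears), tends to $\ell$ (so the convergence depends on $(t,x,y)$ only through $A$). *)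

theory Defs
  imports "HOL-Probability.Probability" "HOL-Library.Landau_Symbols"
begin

text \<open>The path properties are required almost surely; processes are only considered at
  times \<open>t \<ge> 0\<close>, so values of \<open>S\<close> at negative times are irrelevant.\<close>

locale levy_process = prob_space M for M :: "'a measure" +
  fixes S :: "real \<Rightarrow> 'a \<Rightarrow> real"
  assumes random_variable: "\<And>t. 0 \<le> t \<Longrightarrow> random_variable borel (S t)"
    and start: "AE \<omega> in M. S 0 \<omega> = 0"
    and indep_increments:
      "\<And>\<tau> k. 0 \<le> \<tau> 0 \<Longrightarrow> strict_mono_on {..k} \<tau> \<Longrightarrow>
         indep_vars (\<lambda>_. borel) (\<lambda>i \<omega>. S (\<tau> (Suc i)) \<omega> - S (\<tau> i) \<omega>) {..<k::nat}"
    and stationary_increments: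
      "\<And>t h. 0 \<le> t \<Longrightarrow> 0 \<le> h \<Longrightarrow>
         distr M borel (\<lambda>\<omega>. S (t + h) \<omega> - S t \<omega>) = distr M borel (S h)"
    and cadlag:
      "AE \<omega> in M. (\<forall>t\<ge>0. continuous (at_right t) (\<lambda>s. S s \<omega>)) \<and>
                  (\<forall>t>0. \<exists>l. ((\<lambda>s. S s \<omega>) \<longlongrightarrow> l) (at_left t))"

locale stable_subordinator = levy_process M S
  for M :: "'a measure" and S :: "real \<Rightarrow> 'a \<Rightarrow> real" +
  fixes \<beta> :: real
  assumes beta: "0 < \<beta>" "\<beta> < 1"
    and nondecreasing: "AE \<omega> in M. mono_on {0..} (\<lambda>t. S t \<omega>)"
    and laplace: "\<And>t r. 0 \<le> t \<Longrightarrow> 0 < r \<Longrightarrow>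
      expectation (\<lambda>\<omega>. exp (- r * S t \<omega>)) = exp (- t * r powr \<beta>)"

text \<open>For a stable subordinator the set below is almost surely nonempty, so the value of
  \<open>Inf {}\<close> has no influence on the law.\<close>

definition inverse_process :: "(real \<Rightarrow> 'a \<Rightarrow> real) \<Rightarrow> real \<Rightarrow> 'a \<Rightarrow> real" where
  "inverse_process S t \<omega> = Inf {s. 0 \<le> s \<and> t < S s \<omega>}"

definition cauchy_kernel :: "real \<Rightarrow> real ^ 'n \<Rightarrow> real ^ 'n \<Rightarrow> real" where
  "cauchy_kernel t x y =
     pi powr (- (real CARD('n) + 1) / 2) * Gamma ((real CARD('n) + 1) / 2) * t /
     (t\<^sup>2 + (norm (x - y))\<^sup>2) powr ((real CARD('n) + 1) / 2)"

text \<open>\<open>Y t\<close> is a random time. Its law is taken on the completion of \<open>M\<close>: since paths are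
  monotone and right-continuous only almost surely, the inverse of a subordinator need only be
  measurable there. For \<open>M\<close>-measurable \<open>Y t\<close> this is the law on \<open>M\<close>, by \<open>distr_completion\<close>.\<close>

definition subordinate_density ::
    "'a measure \<Rightarrow> (real \<Rightarrow> 'a \<Rightarrow> real) \<Rightarrow> real \<Rightarrow> real ^ 'n \<Rightarrow> real ^ 'n \<Rightarrow> real" where
  "subordinate_density M Y t x y =
     (LINT s:{0<..}|distr (completion M) borel (Y t). cauchy_kernel s x y)"

text \<open>The filter on triples \<open>(t, x, y) \<in> D\<close> along which \<open>A t x y\<close> tends to the limit
  described by \<open>F\<close>; being a \<^const>\<open>filtercomap\<close>, it yields convergence that is uniform in
  \<open>(t, x, y)\<close> given the value of \<open>A\<close>.\<close>

definition along ::
    "(real \<Rightarrow> 'b \<Rightarrow> 'b \<Rightarrow> real) \<Rightarrow> real filter \<Rightarrow> (real \<times> 'b \<times> 'b) set \<Rightarrow> (real \<times> 'b \<times> 'b) filter"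
  where "along A F D = inf (filtercomap (\<lambda>(t, x, y). A t x y) F) (principal D)"

end

theory Submission
  imports Defs "HOL-Real_Asymp.Real_Asymp"
begin

text \<open>All four asymptotics are statements about the law of \<open>S 1\<close>. The Laplace transform determines
  this law, so \<open>S t\<close> is distributed as \<open>t powr (1 / \<beta>) * S 1\<close>; by monotonicity of the paths the
  inverse process at time \<open>t\<close> is then distributed as \<open>(t / S 1) powr \<beta>\<close>, and both densities become
  functions of the single scaling variable. The transform also controls the rescaled laws
  \<open>R powr \<beta> * P (S 1 / R \<in> du)\<close>: weighted with \<open>1 - exp (- u)\<close> they converge to the stable Levy
  density, which gives (a) and the tail asymptotics of \<open>S 1\<close>, i.e. the linear behaviour at the
  origin of the distribution function of the inverse. Integrating the kernel against that
  distribution function yields (c). Parts (b) and (d) are dominated convergence together with the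
  negative moments of \<open>S 1\<close>.\<close>

section \<open>Convergence of integrals from Laplace transforms\<close>

text \<open>Working with transforms avoids any series or density of the stable law and takes the
  place of Karamata's Tauberian theorem. The obstacle is that the Levy density
  \<open>b / Gamma (1 - b) * u powr (- b - 1)\<close> is not integrable at 0, so the unweighted
  rescaled laws, of mass \<open>R powr b\<close>, have no finite limit. The factor
  \<open>1 - exp (- u)\<close> cures this: it is of order \<open>u\<close> at 0, tends to 1 at
  infinity, and turns the transform at \<open>q\<close> into a difference of transforms at
  \<open>q\<close> and \<open>q + 1\<close>, with limit \<open>(q + 1) powr b - q powr b\<close>.
  Test functions are divided by the factor again, which does no harm when they are of order
  \<open>u\<close> at 0; the kernel is. In (c) the linear approximation of the distribution function
  may be inserted under the integral only if the kernel, as a function of time, is integrable at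
  infinity. It decays like \<open>u powr (- n)\<close>, so this succeeds for
  \<open>n \<ge> 2\<close>, whereas \<open>n = 1\<close> is the borderline case of logarithmic
  divergence and needs an argument in the logarithmic variable.\<close>

definition half_line_measure :: "real measure \<Rightarrow> bool" where
  "half_line_measure N \<longleftrightarrow> finite_measure N \<and> sets N = sets borel \<and> (AE x in N. 0 < x)"

lemma half_line_measure_integrable:
  assumes N: "half_line_measure N" and f: "f \<in> borel_measurable borel"
    and bound: "\<And>x. 0 < x \<Longrightarrow> \<bar>f x\<bar> \<le> C"
  shows "integrable N (f :: real \<Rightarrow> real)"
proof -
  have [measurable_cong]: "sets N = sets borel" using N by (simp add: half_line_measure_def)
  interpret finite_measure N using N by (simp add: half_line_measure_def)
  have "AE x in N. 0 < x" using N by (simp add: half_line_measure_def)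
  then have "AE x in N. norm (f x) \<le> C" by eventually_elim (use bound in auto)
  then show ?thesis
    using f by (intro integrable_const_bound[where B = C]) auto
qed

lemma half_line_measure_integral_diff_le:
  fixes f h :: "real \<Rightarrow> real"
  assumes N: "half_line_measure N"
    and f: "f \<in> borel_measurable borel" and h: "h \<in> borel_measurable borel"
    and bf: "\<And>x. 0 < x \<Longrightarrow> \<bar>f x\<bar> \<le> C" and bh: "\<And>x. 0 < x \<Longrightarrow> \<bar>h x\<bar> \<le> D"
    and diff: "\<And>x. 0 < x \<Longrightarrow> \<bar>f x - h x\<bar> \<le> d"
  shows "\<bar>(\<integral>x. f x \<partial>N) - (\<integral>x. h x \<partial>N)\<bar> \<le> d * (\<integral>x. 1 \<partial>N)"
proof -
  have [measurable_cong]: "sets N = sets borel" using N by (simp add: half_line_measure_def)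
  interpret finite_measure N using N by (simp add: half_line_measure_def)
  note [simp] = half_line_measure_integrable[OF N f bf] half_line_measure_integrable[OF N h bh]
  have pos: "AE x in N. 0 < x" using N by (simp add: half_line_measure_def)
  have "\<bar>(\<integral>x. f x \<partial>N) - (\<integral>x. h x \<partial>N)\<bar> = \<bar>\<integral>x. f x - h x \<partial>N\<bar>" by simp
  also have "\<dots> \<le> (\<integral>x. \<bar>f x - h x\<bar> \<partial>N)" by (rule integral_abs_bound)
  also have "\<dots> \<le> (\<integral>x. d \<partial>N)"
    by (intro integral_mono_AE) (use pos in \<open>auto elim!: eventually_mono intro: diff\<close>)
  finally show ?thesis by (simp add: mult.commute)
qed

text \<open>The substitution \<open>v = exp (- x)\<close> turns \<open>g\<close> into a continuous function on \<open>{0..1}\<close> and the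
  Laplace transform at the naturals into moments, so Weierstrass approximation applies.\<close>

lemma tendsto_integral_of_laplace:
  fixes N :: "'i \<Rightarrow> real measure" and g :: "real \<Rightarrow> real"
  assumes N: "\<forall>\<^sub>F i in F. half_line_measure (N i)" and N0: "half_line_measure N0"
    and conv: "\<And>k::nat. ((\<lambda>i. \<integral>x. exp (- (real k * x)) \<partial>N i) \<longlongrightarrow>
                 (\<integral>x. exp (- (real k * x)) \<partial>N0)) F"
    and g: "g \<in> borel_measurable borel" "continuous_on {0<..} g"
      "(g \<longlongrightarrow> a) (at_right 0)" "(g \<longlongrightarrow> b) at_top"
  shows "((\<lambda>i. \<integral>x. g x \<partial>N i) \<longlongrightarrow> (\<integral>x. g x \<partial>N0)) F"
proof -
  \<comment> \<open>Small \<open>v\<close> means large \<open>x\<close> and \<open>v\<close> near 1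
    means \<open>x\<close> near 0, so \<open>b\<close>, the limit of \<open>g\<close> at infinity,
    sits at 0 and \<open>a\<close> sits at 1.\<close>
  define G where "G = (\<lambda>v::real. if v \<le> 0 then b else if 1 \<le> v then a else g (- ln v))"
  have Gx: "G (exp (- x)) = g x" if "0 < x" for x
    using that by (simp add: G_def)
  have "continuous_on {0..1} G"
    unfolding continuous_on_eq_continuous_within
  proof
    fix v :: real assume v: "v \<in> {0..1}"
    consider "v = 0" | "v = 1" | "0 < v" "v < 1" using v by force
    then show "continuous (at v within {0..1}) G"
    proof cases
      case 1
      have "filterlim (\<lambda>v::real. - ln v) at_top (at_right 0)" by real_asymp
      then have "((\<lambda>v. g (- ln v)) \<longlongrightarrow> b) (at_right 0)"
        by (rule filterlim_compose[OF g(4)])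
      moreover have "\<forall>\<^sub>F v in at_right 0. g (- ln v) = G v"
        using eventually_at_right_less[of 0] eventually_at_right_real[of 0 1] 
        by (auto simp: G_def elim!: eventually_mono)
      ultimately have "(G \<longlongrightarrow> b) (at_right 0)"
        by (rule Lim_transform_eventually)
      then have "(G \<longlongrightarrow> b) (at 0 within {0..1})"
        using at_within_Icc_at_right[of 0 "1::real"] by simp
      then show ?thesis by (simp add: continuous_within 1 G_def)
    next
      case 2
      have "filterlim (\<lambda>v::real. - ln v) (at_right 0) (at_left 1)" by real_asymp
      then have "((\<lambda>v. g (- ln v)) \<longlongrightarrow> a) (at_left 1)"
        by (rule filterlim_compose[OF g(3)])
      moreover have "\<forall>\<^sub>F v in at_left 1. g (- ln v) = G v"
        using eventually_at_left_real[of 0 1] by (auto simp: G_def elim!: eventually_mono)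
      ultimately have "(G \<longlongrightarrow> a) (at_left 1)"
        by (rule Lim_transform_eventually)
      then have "(G \<longlongrightarrow> a) (at 1 within {0..1})"
        using at_within_Icc_at_left[of "0::real" 1] by simp
      then show ?thesis by (simp add: continuous_within 2 G_def)
    next
      case 3
      have "continuous_on {0<..<1} (\<lambda>v. g (- ln v))"
        by (rule continuous_on_compose2[OF g(2)]) (auto intro!: continuous_intros)
      then have "continuous_on {0<..<1} G"
        by (rule continuous_on_eq) (auto simp: G_def)
      then have "isCont G v" using 3 by (auto simp: continuous_on_eq_continuous_at)
      then show ?thesis by (rule continuous_at_imp_continuous_at_within)
    qed
  qed
  note G_cont = this
  obtain Cg where Cg: "\<And>v. v \<in> {0..1} \<Longrightarrow> \<bar>G v\<bar> \<le> Cg"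
    using compact_imp_bounded[OF compact_continuous_image[OF G_cont compact_Icc]]
    unfolding bounded_iff by (metis imageI real_norm_def)
  have bg: "\<bar>g x\<bar> \<le> Cg" if "0 < x" for x
    using Cg[of "exp (- x)"] Gx[OF that] that by simp
  show ?thesis
  proof (rule tendstoI)
    fix e :: real assume e: "0 < e"
    \<comment> \<open>\<open>C\<close> eventually bounds the total mass of \<open>N i\<close>,
      because the transform at \<open>k = 0\<close> is the mass and converges. With
      \<open>d = e / (4 * C)\<close> the two approximation errors and the convergence of the
      polynomial integrals cost at most \<open>e / 4\<close> each.\<close>
    define C :: real where "C = (\<integral>x. 1 \<partial>N0) + 1"
    have "C > 0" unfolding C_def by (rule add_nonneg_pos) (auto intro: integral_nonneg)
    define d where "d = e / (4 * C)"
    have "d > 0" using e \<open>C > 0\<close> by (simp add: d_def)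
    obtain p where p: "real_polynomial_function p" "\<And>v. v \<in> {0..1} \<Longrightarrow> \<bar>G v - p v\<bar> < d"
      using Stone_Weierstrass_real_polynomial_function[OF _ G_cont \<open>d > 0\<close>] by auto
    obtain c m where pc: "p = (\<lambda>v. \<Sum>k\<le>m. c k * v ^ k)"
      using p(1) by (auto simp: real_polynomial_function_iff_sum)
    define q where "q x = (\<Sum>k\<le>m. c k * exp (- (real k * x)))" for x
    have q: "q x = p (exp (- x))" for x
      by (simp add: q_def pc exp_of_nat_mult[symmetric])
    have q_meas: "q \<in> borel_measurable borel" unfolding q_def by measurable
    have bq: "\<bar>q x\<bar> \<le> Cg + d" if "0 < x" for x
      using p(2)[of "exp (- x)"] Cg[of "exp (- x)"] that by (simp add: q)
    have gq: "\<bar>g x - q x\<bar> \<le> d" if "0 < x" for x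
      using p(2)[of "exp (- x)"] Gx[OF that] that by (simp add: q)
    have close: "\<bar>(\<integral>x. g x \<partial>L) - (\<integral>x. q x \<partial>L)\<bar> \<le> d * (\<integral>x. 1 \<partial>L)" if "half_line_measure L" for L
      by (rule half_line_measure_integral_diff_le[OF that g(1) q_meas bg bq gq])
    have q_int: "(\<integral>x. q x \<partial>L) = (\<Sum>k\<le>m. c k * (\<integral>x. exp (- (real k * x)) \<partial>L))"
      if L: "half_line_measure L" for L
      unfolding q_def
      by (subst Bochner_Integration.integral_sum)
         (auto intro!: integrable_mult_right half_line_measure_integrable[OF L, where C = 1])
    have "((\<lambda>i. \<Sum>k\<le>m. c k * (\<integral>x. exp (- (real k * x)) \<partial>N i)) \<longlongrightarrow> (\<integral>x. q x \<partial>N0)) F"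
      unfolding q_int[OF N0] by (intro tendsto_intros conv)
    then have 1: "\<forall>\<^sub>F i in F. dist (\<Sum>k\<le>m. c k * (\<integral>x. exp (- (real k * x)) \<partial>N i)) (\<integral>x. q x \<partial>N0) < e / 4"
      by (rule tendstoD) (use e in simp)
    have "((\<lambda>i. \<integral>x. (1::real) \<partial>N i) \<longlongrightarrow> (\<integral>x. 1 \<partial>N0)) F"
      using conv[of 0] by simp
    then have 2: "\<forall>\<^sub>F i in F. (\<integral>x. 1 \<partial>N i) < C"
      by (rule order_tendstoD) (simp add: C_def)
    show "\<forall>\<^sub>F i in F. dist (\<integral>x. g x \<partial>N i) (\<integral>x. g x \<partial>N0) < e"
      using N 1 2
    proof eventually_elim
      case (elim i)
      have "d * (\<integral>x. 1 \<partial>N i) \<le> d * C" "d * (\<integral>x. 1 \<partial>N0) \<le> d * C"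
        using elim \<open>d > 0\<close> by (auto simp: C_def)
      moreover have "d * C = e / 4" using \<open>C > 0\<close> by (simp add: d_def)
      ultimately show ?case
        using elim(2) close[OF elim(1)] close[OF N0] q_int[OF elim(1)]
        unfolding dist_real_def by linarith
    qed
  qed
qed

text \<open>Applied to the constant family \<open>L1\<close> with limit \<open>L2\<close>, the
  convergence lemma becomes an equality of integrals. The ramps \<open>cts_step a b\<close> lie
  between the indicators of \<open>{..a}\<close> and \<open>{..b}\<close>, so they compare the
  distribution functions at \<open>a\<close> and \<open>b > a\<close>; right-continuity closes the
  gap.\<close>

lemma real_distribution_eqI_laplace:
  assumes "real_distribution L1" "real_distribution L2"
    and pos: "AE x in L1. 0 < x" "AE x in L2. 0 < x"
    and eq: "\<And>r. 0 < r \<Longrightarrow> (\<integral>x. exp (- (r * x)) \<partial>L1) = (\<integral>x. exp (- (r * x)) \<partial>L2)"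
  shows "L1 = L2"
proof (rule cdf_unique)
  interpret L1: real_distribution L1 by fact
  interpret L2: real_distribution L2 by fact
  have hl: "half_line_measure L1" "half_line_measure L2"
    using pos L1.finite_measure_axioms L2.finite_measure_axioms by (auto simp: half_line_measure_def)
  have steps: "(\<integral>x. cts_step a b x \<partial>L1) = (\<integral>x. cts_step a b x \<partial>L2)" if ab: "a < b" for a b
  proof -
    have cont: "continuous_on UNIV (cts_step a b)"
      by (rule uniformly_continuous_imp_continuous[OF cts_step_uniformly_continuous[OF ab]])
    have "((\<lambda>i::nat. \<integral>x. cts_step a b x \<partial>L1) \<longlongrightarrow> (\<integral>x. cts_step a b x \<partial>L2)) sequentially"
    proof (rule tendsto_integral_of_laplace)
      fix k :: nat
      \<comment> \<open>The hypothesis covers \<open>r > 0\<close> only; at \<open>k = 0\<close>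
        both sides are the total mass 1.\<close>
      have "(\<integral>x. exp (- (real k * x)) \<partial>L1) = (\<integral>x. exp (- (real k * x)) \<partial>L2)"
        by (cases "k = 0") (auto simp: eq L1.prob_space[simplified] L2.prob_space[simplified])
      then show "((\<lambda>i::nat. \<integral>x. exp (- (real k * x)) \<partial>L1) \<longlongrightarrow> (\<integral>x. exp (- (real k * x)) \<partial>L2)) sequentially"
        by simp
    next
      show "cts_step a b \<in> borel_measurable borel"
        by (rule borel_measurable_continuous_onI[OF cont])
      show "continuous_on {0<..} (cts_step a b)"
        using cont by (rule continuous_on_subset) simp
      show "(cts_step a b \<longlongrightarrow> cts_step a b 0) (at_right 0)"
        using cont by (auto simp: continuous_on_eq_continuous_at isCont_def intro: filterlim_at_split[THEN iffD1, THEN conjunct2])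
      show "(cts_step a b \<longlongrightarrow> 0) at_top"
        by (rule tendsto_eventually) 
           (use ab in \<open>auto simp: cts_step_def intro!: eventually_at_top_linorderI[of b]\<close>)
    qed (use hl in auto)
    then show ?thesis by (simp add: tendsto_const_iff)
  qed
  have le: "cdf K1 a \<le> cdf K2 a"
    if "real_distribution K1" "real_distribution K2"
      "\<And>a b. a < b \<Longrightarrow> (\<integral>x. cts_step a b x \<partial>K1) = (\<integral>x. cts_step a b x \<partial>K2)" for K1 K2 a
  proof -
    interpret K1: real_distribution K1 by fact
    interpret K2: real_distribution K2 by fact
    have "(cdf K2 \<longlongrightarrow> cdf K2 a) (at_right a)"
      using K2.cdf_is_right_cont by (simp add: continuous_within)
    moreover have "\<forall>\<^sub>F b in at_right a. cdf K1 a \<le> cdf K2 b"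
      using eventually_at_right_less[of a]
    proof eventually_elim
      case (elim b)
      show ?case
        using K1.cdf_cts_step(1)[OF elim] K2.cdf_cts_step(2)[OF elim] that(3)[OF elim] by simp
    qed
    ultimately show ?thesis
      by (rule tendsto_lowerbound) simp
  qed
  show "cdf L1 = cdf L2"
  proof (rule ext, rule antisym)
    fix a
    show "cdf L1 a \<le> cdf L2 a" by (rule le[OF assms(1,2) steps])
    show "cdf L2 a \<le> cdf L1 a" by (rule le[OF assms(2,1) steps[symmetric]])
  qed
qed (use assms in auto)

section \<open>Gamma and Beta integrals\<close>

lemma has_bochner_integral_of_has_integral_nonneg:
  fixes f :: "real \<Rightarrow> real"
  assumes f: "f \<in> borel_measurable borel" and S: "S \<in> sets borel"
    and nonneg: "\<And>x. x \<in> S \<Longrightarrow> 0 \<le> f x" and I: "(f has_integral I) S"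
  shows "has_bochner_integral lborel (\<lambda>x. indicator S x * f x) I"
proof (rule has_bochner_integral_nn_integral)
  show "0 \<le> I" by (rule has_integral_nonneg[OF I nonneg])
  show "(\<integral>\<^sup>+ x. ennreal (indicator S x * f x) \<partial>lborel) = ennreal I"
    by (rule nn_integral_has_integral_lebesgue[OF nonneg I])
  show "(\<lambda>x. indicator S x * f x) \<in> borel_measurable lborel"
    using f S by simp
qed (use nonneg in \<open>auto simp: indicator_def\<close>)

text \<open>Nonnegativity upgrades the gauge integral to an absolute one, as the general
  substitution theorem requires.\<close>

lemma has_integral_change_of_variables_nonneg:
  fixes f g g' :: "real \<Rightarrow> real"
  assumes S: "S \<in> sets lebesgue"
    and der: "\<And>x. x \<in> S \<Longrightarrow> (g has_field_derivative g' x) (at x within S)"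
    and inj: "inj_on g S"
    and nonneg: "\<And>x. x \<in> g ` S \<Longrightarrow> 0 \<le> f x" and I: "(f has_integral I) (g ` S)"
  shows "((\<lambda>x. \<bar>g' x\<bar> * f (g x)) has_integral I) S"
proof -
  have "f absolutely_integrable_on g ` S"
    using I nonneg by (intro nonnegative_absolutely_integrable_1) auto
  moreover have "integral (g ` S) f = I" using I by (rule integral_unique)
  ultimately have "(\<lambda>x. \<bar>g' x\<bar> * f (g x)) absolutely_integrable_on S \<and>
      integral S (\<lambda>x. \<bar>g' x\<bar> * f (g x)) = I"
    by (subst has_absolute_integral_change_of_variables_1'[OF S der inj]) auto
  then show ?thesis
    using set_lebesgue_integral_eq_integral(1) by (metis has_integral_integral)
qed

lemma Gamma_integral_Ioi:
  assumes "0 < (s::real)"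
  shows "((\<lambda>t. t powr (s - 1) * exp (- t)) has_integral Gamma s) {0<..}"
proof -
  have "((\<lambda>t. t powr (s - 1) / exp t) has_integral Gamma s) {0<..}"
    using Gamma_integral_real[OF assms]
    by (subst (asm) has_integral_spike_set_eq[where T = "{0<..}"])
       (auto intro: negligible_subset[of "{0::real}"])
  then show ?thesis by (simp add: exp_minus field_simps)
qed

lemma Gamma_integral_scaled:
  assumes s: "0 < (s::real)" and x: "0 < x"
  shows "((\<lambda>t. t powr (s - 1) * exp (- (x * t))) has_integral Gamma s * x powr (- s)) {0<..}"
proof -
  have img: "(\<lambda>t. x * t) ` {0<..} = {0<..}"
    using x by (auto simp: image_iff intro!: bexI[of _ "_ / x"])
  have "((\<lambda>t. \<bar>x\<bar> * ((x * t) powr (s - 1) * exp (- (x * t)))) has_integral Gamma s) {0<..}"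
    by (rule has_integral_change_of_variables_nonneg[where g = "\<lambda>t. x * t"])
       (use x Gamma_integral_Ioi[OF s] in \<open>auto simp: img inj_on_def intro!: derivative_eq_intros\<close>)
  from has_integral_mult_right[OF this, of "x powr (- s)"]
  have A: "((\<lambda>t. x powr (- s) * (\<bar>x\<bar> * ((x * t) powr (s - 1) * exp (- (x * t))))) has_integral
          x powr (- s) * Gamma s) {0<..}" .
  have B: "x powr (- s) * (\<bar>x\<bar> * ((x * t) powr (s - 1) * exp (- (x * t)))) =
      t powr (s - 1) * exp (- (x * t))" if "t \<in> {0<..}" for t
    using x that by (simp add: powr_mult powr_diff powr_minus field_simps)
  show ?thesis
    using has_integral_eq[OF B A] by (simp only: mult.commute)
qed

text \<open>Substitution \<open>v = t powr b\<close> in the Gamma integral. The factor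
  \<open>exp (- (t powr b))\<close> is the stable Laplace transform, which makes this the numerator
  of the negative moments.\<close>

lemma Gamma_integral_powr:
  assumes s: "0 < (s::real)" and b: "0 < b"
  shows "((\<lambda>t. t powr (s - 1) * exp (- (t powr b))) has_integral Gamma (s / b) / b) {0<..}"
proof -
  have inv: "(t powr (1 / b)) powr b = t" "(t powr b) powr (1 / b) = t" if "0 < t" for t
    using b that by (simp_all add: powr_powr)
  have img: "(\<lambda>t. t powr b) ` {0<..} = {0<..}"
  proof (intro equalityI subsetI)
    fix t :: real assume t: "t \<in> {0<..}"
    show "t \<in> (\<lambda>t. t powr b) ` {0<..}"
      by (rule image_eqI[of _ _ "t powr (1 / b)"]) (use t inv(1)[of t] in simp_all)
  next
    fix t assume "t \<in> (\<lambda>t. t powr b) ` {0<..}"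
    then show "t \<in> {0<..}" by (elim imageE) simp
  qed
  have "((\<lambda>t. \<bar>b * t powr (b - 1)\<bar> * ((t powr b) powr (s / b - 1) * exp (- (t powr b))))
      has_integral Gamma (s / b)) {0<..}"
  proof (rule has_integral_change_of_variables_nonneg[where g = "\<lambda>t. t powr b"])
    show "inj_on (\<lambda>t. t powr b) {0<..}"
      by (rule inj_on_inverseI[where g = "\<lambda>t. t powr (1 / b)"]) (simp add: inv(2))
    show "((\<lambda>t. t powr b) has_real_derivative b * t powr (b - 1)) (at t within {0<..})"
      if "t \<in> {0<..}" for t
      using that has_real_derivative_powr[of t b] has_field_derivative_at_within by auto
  qed (use b Gamma_integral_Ioi[of "s / b"] s in \<open>auto simp: img\<close>)
  from has_integral_mult_right[OF this, of "1 / b"]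
  have A: "((\<lambda>t. 1 / b * (\<bar>b * t powr (b - 1)\<bar> * ((t powr b) powr (s / b - 1) * exp (- (t powr b)))))
      has_integral 1 / b * Gamma (s / b)) {0<..}" .
  have B: "1 / b * (\<bar>b * t powr (b - 1)\<bar> * ((t powr b) powr (s / b - 1) * exp (- (t powr b)))) =
      t powr (s - 1) * exp (- (t powr b))" if "t \<in> {0<..}" for t
  proof -
    have "(t powr b) powr (s / b - 1) = t powr (s - b)"
    proof -
      have "b * (s / b - 1) = s - b" using b by (simp add: right_diff_distrib)
      then show ?thesis by (simp only: powr_powr)
    qed
    moreover have "t powr (b - 1) * t powr (s - b) = t powr (s - 1)"
      by (simp add: powr_add[symmetric])
    ultimately show ?thesis using b by (simp add: abs_mult)
  qed
  show ?thesis
    using has_integral_eq[OF B A] by simp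
qed

text \<open>Substitution \<open>v = u\<^sup>2 / (1 + u\<^sup>2)\<close>, a bijection onto the unit
  interval with \<open>1 - v = 1 / (1 + u\<^sup>2)\<close>. Powers of \<open>1 + u\<^sup>2\<close>
  times powers of \<open>u\<close> are what remains of the Cauchy kernel in each limit, so several
  constants come from here.\<close>

lemma Beta_integral_Ioi:
  assumes p: "0 < (p::real)" and q: "0 < q"
  shows "((\<lambda>u. u powr (2 * p - 1) * (1 + u\<^sup>2) powr (- (p + q))) has_integral Beta p q / 2) {0<..}"
proof -
  define g :: "real \<Rightarrow> real" where "g u = u\<^sup>2 / (1 + u\<^sup>2)" for u
  have ne: "1 + u\<^sup>2 \<noteq> 0" "0 < 1 + u\<^sup>2" for u :: real
    by (auto simp: add_nonneg_eq_0_iff intro: add_pos_nonneg)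
  have g1: "1 - g u = 1 / (1 + u\<^sup>2)" for u
    using ne[of u] by (simp add: g_def field_simps)
  have img: "g ` {0<..} = {0<..<1}"
  proof (intro equalityI subsetI)
    fix v :: real assume v: "v \<in> {0<..<1}"
    define u where "u = sqrt (v / (1 - v))"
    have u: "u\<^sup>2 = v / (1 - v)" "0 < u" using v by (auto simp: u_def)
    have "g u = v" unfolding g_def u(1) using v by (simp add: field_simps)
    then show "v \<in> g ` {0<..}" using u(2) by auto
  next
    fix v assume "v \<in> g ` {0<..}"
    then obtain u where u: "0 < u" "v = g u" by auto
    have "0 < g u" using u ne[of u] by (simp add: g_def)
    moreover have "0 < 1 - g u" using ne[of u] by (simp add: g1)
    ultimately show "v \<in> {0<..<1}" using u by simp
  qed
  have "((\<lambda>t. t powr (p - 1) * (1 - t) powr (q - 1)) has_integral Beta p q) {0<..<1}"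
    using has_integral_Beta_real[OF p q] by (simp add: has_integral_Icc_iff_Ioo)
  then have "((\<lambda>u. \<bar>2 * u / (1 + u\<^sup>2)\<^sup>2\<bar> * (g u powr (p - 1) * (1 - g u) powr (q - 1)))
      has_integral Beta p q) {0<..}"
  proof (intro has_integral_change_of_variables_nonneg[where g = g], goal_cases)
    case (2 u)
    show ?case unfolding g_def
      by (rule derivative_eq_intros refl ne)+ (simp add: power2_eq_square field_simps)
  next
    case 3
    show ?case
    proof (rule inj_onI)
      fix u v :: real assume uv: "u \<in> {0<..}" "v \<in> {0<..}" "g u = g v"
      then have "1 / (1 + u\<^sup>2) = 1 / (1 + v\<^sup>2)" using g1 by metis
      then have "u\<^sup>2 = v\<^sup>2" using ne by (simp add: field_simps)
      then show "u = v" using uv by (simp add: power2_eq_iff_nonneg)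
    qed
  qed (auto simp: img)
  from has_integral_mult_right[OF this, of "1 / 2"]
  have A: "((\<lambda>u. 1 / 2 * (\<bar>2 * u / (1 + u\<^sup>2)\<^sup>2\<bar> * (g u powr (p - 1) * (1 - g u) powr (q - 1))))
      has_integral 1 / 2 * Beta p q) {0<..}" .
  \<comment> \<open>Exponent count: \<open>1 + 2 * (p - 1) = 2 * p - 1\<close> for \<open>u\<close>,
    and \<open>- 2 - (p - 1) - (q - 1) = - (p + q)\<close> for \<open>1 + u\<^sup>2\<close>, where
    \<open>1\<close> and \<open>- 2\<close> come from the derivative of \<open>g\<close>.\<close>
  have B: "1 / 2 * (\<bar>2 * u / (1 + u\<^sup>2)\<^sup>2\<bar> * (g u powr (p - 1) * (1 - g u) powr (q - 1))) =
      u powr (2 * p - 1) * (1 + u\<^sup>2) powr (- (p + q))" if "u \<in> {0<..}" for u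
  proof -
    have u: "0 < u" using that by simp
    have sq: "u\<^sup>2 = u powr 2" using u by (simp add: powr_numeral)
    have w: "(1 + u\<^sup>2)\<^sup>2 = (1 + u\<^sup>2) powr 2" using ne[of u] by (simp add: powr_numeral)
    have "g u powr (p - 1) = u powr (2 * (p - 1)) * (1 + u\<^sup>2) powr (- (p - 1))"
    proof -
      have "u\<^sup>2 powr (p - 1) = u powr (2 * (p - 1))" by (simp only: sq powr_powr)
      moreover have "g u powr (p - 1) = u\<^sup>2 powr (p - 1) / (1 + u\<^sup>2) powr (p - 1)"
        unfolding g_def by (rule powr_divide)
      ultimately show ?thesis by (simp only: powr_minus divide_inverse)
    qed
    moreover have "(1 - g u) powr (q - 1) = (1 + u\<^sup>2) powr (- (q - 1))"
    proof -
      have "(1 - g u) powr (q - 1) = 1 powr (q - 1) / (1 + u\<^sup>2) powr (q - 1)"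
        unfolding g1 by (rule powr_divide)
      then show ?thesis by (simp only: powr_minus divide_inverse powr_one_eq_one mult_1)
    qed
    moreover have "1 / 2 * \<bar>2 * u / (1 + u\<^sup>2)\<^sup>2\<bar> = u powr 1 * (1 + u\<^sup>2) powr (- 2)"
    proof -
      have "(1 + u\<^sup>2) powr (- 2) = inverse ((1 + u\<^sup>2)\<^sup>2)"
        by (simp only: powr_minus w[symmetric])
      moreover have "\<bar>2 * u / (1 + u\<^sup>2)\<^sup>2\<bar> = 2 * u * inverse ((1 + u\<^sup>2)\<^sup>2)"
        using u by (simp add: divide_inverse abs_mult)
      ultimately show ?thesis using u by simp
    qed
    moreover have "u powr 1 * (1 + u\<^sup>2) powr (- 2) *
       (u powr (2 * (p - 1)) * (1 + u\<^sup>2) powr (- (p - 1)) * (1 + u\<^sup>2) powr (- (q - 1))) =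
       (u powr 1 * u powr (2 * (p - 1))) *
       ((1 + u\<^sup>2) powr (- 2) * ((1 + u\<^sup>2) powr (- (p - 1)) * (1 + u\<^sup>2) powr (- (q - 1))))"
      by (simp only: mult_ac)
    moreover have "u powr 1 * u powr (2 * (p - 1)) = u powr (2 * p - 1)"
      by (simp only: powr_add[symmetric]) (simp add: algebra_simps)
    moreover have "(1 + u\<^sup>2) powr (- 2) * ((1 + u\<^sup>2) powr (- (p - 1)) * (1 + u\<^sup>2) powr (- (q - 1))) =
       (1 + u\<^sup>2) powr (- (p + q))"
      by (simp only: powr_add[symmetric]) (simp add: algebra_simps)
    ultimately show ?thesis by (metis mult.assoc)
  qed
  show ?thesis
    using has_integral_eq[OF B A] by simp
qed

text \<open>The integrand is \<open>u powr (- b - 1)\<close> times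
  \<open>exp (- (q * u)) - exp (- ((q + 1) * u))\<close>, hence the integral of
  \<open>u powr (- b) * exp (- (x * u))\<close> over \<open>x\<close> in \<open>{q..q + 1}\<close>.
  Exchanging the integrals leaves a Gamma integral in \<open>u\<close> and a power of
  \<open>x\<close>.\<close>

lemma stable_Levy_density_laplace:
  assumes b: "0 < (b::real)" "b < 1" and q: "0 \<le> q"
  shows "has_bochner_integral lborel
    (\<lambda>u. indicator {0<..} u * ((1 - exp (- u)) * u powr (- b - 1)) * exp (- (q * u)))
    (Gamma (1 - b) / b * ((q + 1) powr b - q powr b))"
proof (rule has_bochner_integral_nn_integral)
  have G: "0 < Gamma (1 - b)" using b by simp
  define f where "f u x = indicator {0<..} u * (indicator {q..q + 1} x * (u powr (- b) * exp (- (x * u))))"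
    for u x :: real
  have f_nonneg: "0 \<le> f u x" for u x by (simp add: f_def)
  have f_meas [measurable]: "(\<lambda>(u, x). f u x) \<in> borel_measurable (borel \<Otimes>\<^sub>M borel)"
    unfolding f_def by measurable
  have inner1: "(\<integral>\<^sup>+ x. ennreal (f u x) \<partial>lborel) =
      ennreal (indicator {0<..} u * ((1 - exp (- u)) * u powr (- b - 1)) * exp (- (q * u)))" for u
  proof (cases "0 < u")
    case True
    have "(\<integral>\<^sup>+ x. ennreal (f u x) \<partial>lborel) =
        (\<integral>\<^sup>+ x. ennreal (u powr (- b) * exp (- (x * u))) * indicator {q..q + 1} x \<partial>lborel)"
      using True by (intro nn_integral_cong) (auto simp: f_def indicator_def)
    also have "\<dots> = ennreal (- (u powr (- b - 1) * exp (- ((q + 1) * u))) - - (u powr (- b - 1) * exp (- (q * u))))"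
    proof (rule nn_integral_has_integral_lebesgue'[OF _ fundamental_theorem_of_calculus])
      fix x :: real
      have "u powr (- b) = u powr (- b - 1) * u" using True by (simp add: powr_diff)
      then show "((\<lambda>x. - (u powr (- b - 1) * exp (- (x * u)))) has_vector_derivative
          u powr (- b) * exp (- (x * u))) (at x within {q..q + 1})"
        unfolding has_real_derivative_iff_has_vector_derivative[symmetric]
        by (auto intro!: derivative_eq_intros)
    qed simp_all
    also have "- (u powr (- b - 1) * exp (- ((q + 1) * u))) - - (u powr (- b - 1) * exp (- (q * u))) =
        indicator {0<..} u * ((1 - exp (- u)) * u powr (- b - 1)) * exp (- (q * u))"
    proof -
      have "- ((q + 1) * u) = - (q * u) + - u" by (simp add: algebra_simps)
      then have "exp (- ((q + 1) * u)) = exp (- (q * u)) * exp (- u)" by (simp only: exp_add)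
      then show ?thesis using True by (simp add: algebra_simps)
    qed
    finally show ?thesis .
  qed (simp add: f_def)
  \<comment> \<open>For \<open>q = 0\<close> the point \<open>x = 0\<close> belongs to the interval
    and the inner integral diverges there; being a null set, it can be left out.\<close>
  have inner2: "(\<integral>\<^sup>+ u. ennreal (f u x) \<partial>lborel) =
      ennreal (indicator {q..q + 1} x * (Gamma (1 - b) * x powr (b - 1)))" if "x \<noteq> 0" for x
  proof (cases "x \<in> {q..q + 1}")
    case True
    then have x: "0 < x" using q that by auto
    have "(\<integral>\<^sup>+ u. ennreal (f u x) \<partial>lborel) =
        (\<integral>\<^sup>+ u. ennreal (indicator {0<..} u * (u powr ((1 - b) - 1) * exp (- (x * u)))) \<partial>lborel)"
      using True by (intro nn_integral_cong) (auto simp: f_def)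
    also have "\<dots> = ennreal (Gamma (1 - b) * x powr (- (1 - b)))"
      by (rule nn_integral_has_integral_lebesgue[OF _ Gamma_integral_scaled]) (use b x in auto)
    finally show ?thesis using True by simp
  qed (simp add: f_def)
  have "(\<integral>\<^sup>+ u. \<integral>\<^sup>+ x. ennreal (f u x) \<partial>lborel \<partial>lborel) = (\<integral>\<^sup>+ x. \<integral>\<^sup>+ u. ennreal (f u x) \<partial>lborel \<partial>lborel)"
    by (rule lborel_pair.Fubini'[symmetric]) simp
  also have "\<dots> = (\<integral>\<^sup>+ x. ennreal (indicator {q..q + 1} x * (Gamma (1 - b) * x powr (b - 1))) \<partial>lborel)"
    by (rule nn_integral_cong_AE) (use AE_lborel_singleton[of 0] in eventually_elim, simp add: inner2)
  also have "\<dots> = ennreal (Gamma (1 - b) * ((q + 1) powr b / b - q powr b / b))"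
  proof (rule nn_integral_has_integral_lebesgue)
    \<comment> \<open>The derivative is needed in the interior only, since for \<open>q = 0\<close>
      the integrand is singular at the left end while the primitive stays continuous.\<close>
    have "((\<lambda>x. x powr (b - 1)) has_integral (q + 1) powr b / b - q powr b / b) {q..q + 1}"
    proof (rule fundamental_theorem_of_calculus_interior)
      show "continuous_on {q..q + 1} (\<lambda>x. x powr b / b)"
        using b q by (intro continuous_intros continuous_on_powr') auto
      show "((\<lambda>x. x powr b / b) has_vector_derivative x powr (b - 1)) (at x)"
        if "x \<in> {q<..<q + 1}" for x
        unfolding has_real_derivative_iff_has_vector_derivative[symmetric]
        using that q b by (auto intro!: derivative_eq_intros)
    qed simp
    then show "((\<lambda>x. Gamma (1 - b) * x powr (b - 1)) has_integral
        Gamma (1 - b) * ((q + 1) powr b / b - q powr b / b)) {q..q + 1}"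
      by (rule has_integral_mult_right)
  qed (use G in auto)
  also have eq: "Gamma (1 - b) * ((q + 1) powr b / b - q powr b / b) =
      Gamma (1 - b) / b * ((q + 1) powr b - q powr b)"
    by (simp only: diff_divide_distrib right_diff_distrib times_divide_eq_left times_divide_eq_right)
  finally show "(\<integral>\<^sup>+ u. ennreal (indicator {0<..} u * ((1 - exp (- u)) * u powr (- b - 1)) *
      exp (- (q * u))) \<partial>lborel) = ennreal (Gamma (1 - b) / b * ((q + 1) powr b - q powr b))"
    unfolding inner1 .
  show "0 \<le> Gamma (1 - b) / b * ((q + 1) powr b - q powr b)"
    using b q G powr_mono2[of b q "q + 1"] by (intro mult_nonneg_nonneg) simp_all
  show "AE u in lborel. 0 \<le> indicator {0<..} u * ((1 - exp (- u)) * u powr (- b - 1)) * exp (- (q * u))"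
    by (rule AE_I2) (simp add: indicator_def)
  show "(\<lambda>u. indicator {0<..} u * ((1 - exp (- u)) * u powr (- b - 1)) * exp (- (q * u)))
      \<in> borel_measurable lborel"
    by measurable
qed

section \<open>Stable laws on the half line\<close>

text \<open>The Cauchy kernel without its normalising constant, with distance \<open>r\<close>, time
  \<open>z\<close> and a real dimension \<open>n\<close>. It is jointly homogeneous of degree
  \<open>- n\<close> in \<open>(r, z)\<close>, which is why self-similarity of the random time
  leaves a function of one variable.\<close>

definition profile :: "real \<Rightarrow> real \<Rightarrow> real \<Rightarrow> real" where
  "profile n r z = z / (z\<^sup>2 + r\<^sup>2) powr ((n + 1) / 2)"

lemma profile_measurable [measurable]: "profile n r \<in> borel_measurable borel"
  unfolding profile_def by measurable

lemma profile_nonneg: "0 \<le> z \<Longrightarrow> 0 \<le> profile n r z"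
  by (simp add: profile_def)

lemma profile_scale:
  assumes c: "0 < c"
  shows "profile n (c * r) (c * z) = c powr (- n) * profile n r z"
proof -
  have "(c * z)\<^sup>2 + (c * r)\<^sup>2 = c\<^sup>2 * (z\<^sup>2 + r\<^sup>2)" by (simp add: power_mult_distrib algebra_simps)
  moreover have "c\<^sup>2 powr ((n + 1) / 2) = c powr (n + 1)"
  proof -
    have "c\<^sup>2 = c powr 2" using c by (simp add: powr_numeral)
    then have "c\<^sup>2 powr ((n + 1) / 2) = c powr (2 * ((n + 1) / 2))" by (simp only: powr_powr)
    also have "2 * ((n + 1) / 2) = n + 1" by (simp add: field_simps)
    finally show ?thesis .
  qed
  ultimately have "profile n (c * r) (c * z) = c * z / (c powr (n + 1) * (z\<^sup>2 + r\<^sup>2) powr ((n + 1) / 2))"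
    by (simp add: profile_def powr_mult)
  also have "\<dots> = c powr (- n) * profile n r z"
  proof -
    have "c powr (n + 1) = c powr n * c" using c by (simp add: powr_add)
    moreover have "c * z / (P * c * X) = inverse P * (z / X)" for P X
      using c by (simp add: field_simps)
    ultimately show ?thesis by (simp only: profile_def powr_minus)
  qed
  finally show ?thesis .
qed

lemma profile_eq_unit:
  assumes "0 < r"
  shows "profile n r z = r powr (- n) * profile n 1 (z / r)"
  using profile_scale[OF assms, of n 1 "z / r"] assms by simp

lemma profile_1_le:
  assumes n: "1 \<le> n" and u: "0 \<le> u"
  shows "profile n 1 u \<le> u / (1 + u\<^sup>2)"
proof -
  have "(u\<^sup>2 + 1) powr 1 \<le> (u\<^sup>2 + 1) powr ((n + 1) / 2)"
    using n by (intro powr_mono) auto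
  moreover have pos: "0 < u\<^sup>2 + 1" by (simp add: add_nonneg_pos)
  ultimately have "u / (u\<^sup>2 + 1) powr ((n + 1) / 2) \<le> u / (u\<^sup>2 + 1)"
    using u by (intro divide_left_mono mult_pos_pos) (auto simp: powr_one[OF less_imp_le[OF pos]])
  then show ?thesis by (simp add: profile_def add.commute)
qed

lemma profile_1_at_top:
  assumes n: "1 \<le> n"
  shows "(profile n 1 \<longlongrightarrow> 0) at_top"
proof (rule tendsto_sandwich[of "\<lambda>_. 0" _ _ "\<lambda>u::real. u / (1 + u\<^sup>2)"])
  show "\<forall>\<^sub>F u in at_top. 0 \<le> profile n 1 u"
    using eventually_ge_at_top[of 0] by eventually_elim (rule profile_nonneg)
  show "\<forall>\<^sub>F u in at_top. profile n 1 u \<le> u / (1 + u\<^sup>2)"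
    using eventually_ge_at_top[of 0] by eventually_elim (rule profile_1_le[OF n])
  show "((\<lambda>u::real. u / (1 + u\<^sup>2)) \<longlongrightarrow> 0) at_top" by real_asymp
qed simp

text \<open>A majorant free of \<open>r\<close>, attained at \<open>r = 0\<close>; its integrability
  is a negative moment.\<close>

lemma profile_le_powr:
  assumes n: "0 \<le> n" and z: "0 < z"
  shows "profile n r z \<le> z powr (- n)"
proof -
  have sq: "z\<^sup>2 = z powr 2" using z by (simp add: powr_numeral)
  have "2 * ((n + 1) / 2) = n + 1" by (simp add: field_simps)
  then have "z powr (n + 1) = (z\<^sup>2) powr ((n + 1) / 2)"
    unfolding sq powr_powr by (simp only:)
  also have "\<dots> \<le> (z\<^sup>2 + r\<^sup>2) powr ((n + 1) / 2)"
    using n by (intro powr_mono2) auto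
  finally have "profile n r z \<le> z / z powr (n + 1)"
    unfolding profile_def using z by (intro divide_left_mono mult_pos_pos) auto
  also have "\<dots> = z powr (- n)"
  proof -
    have "z powr (n + 1) = z powr n * z" using z by (simp add: powr_add)
    moreover have "z / (P * z) = inverse P" for P
      using z by (simp add: field_simps)
    ultimately show ?thesis by (simp only: powr_minus)
  qed
  finally show ?thesis .
qed

text \<open>First-order expansion of \<open>exp\<close> at 0. With \<open>y = R powr b\<close> it
  gives the limit of the rescaled differences of stable transforms.\<close>

lemma tendsto_exp_difference:
  fixes c d :: real
  shows "((\<lambda>y. y * (exp (- (c / y)) - exp (- (d / y)))) \<longlongrightarrow> d - c) at_top"
proof -
  have *: "((\<lambda>y. y * (exp (- (c / y)) - 1)) \<longlongrightarrow> - c) at_top" for c :: real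
  proof -
    have "((\<lambda>h. (exp (- c * h) - 1) / h) \<longlongrightarrow> - c) (at 0)"
    proof -
      have "((\<lambda>h. exp (- c * h)) has_real_derivative - c) (at 0)"
        by (auto intro!: derivative_eq_intros)
      then show ?thesis by (simp add: DERIV_def)
    qed
    then have "((\<lambda>h. (exp (- c * h) - 1) / h) \<longlongrightarrow> - c) (at_right 0)"
      by (rule filterlim_at_split[THEN iffD1, THEN conjunct2])
    from filterlim_compose[OF this filterlim_inverse_at_right_top]
    show ?thesis by (simp add: field_simps)
  qed
  from tendsto_diff[OF *[of c] *[of d]] show ?thesis by (simp add: algebra_simps)
qed

section \<open>One-sided stable laws, known only through their Laplace transform\<close>

locale stable_law = real_distribution \<mu> for \<mu> :: "real measure" +
  fixes b :: real
  assumes b: "0 < b" "b < 1"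
    and pos: "AE x in \<mu>. 0 < x"
    and laplace: "\<And>r. 0 < r \<Longrightarrow> (\<integral>x. exp (- (r * x)) \<partial>\<mu>) = exp (- (r powr b))"
begin

lemma laplace_nonneg: "0 \<le> r \<Longrightarrow> (\<integral>x. exp (- (r * x)) \<partial>\<mu>) = exp (- (r powr b))"
  using laplace[of r] prob_space by (cases "r = 0") auto

lemma integrable_exp: "0 \<le> r \<Longrightarrow> integrable \<mu> (\<lambda>x. exp (- (r * x)))"
  by (rule integrable_const_bound[of _ 1]) (use pos in \<open>auto elim!: eventually_mono\<close>)

text \<open>\<open>Gamma s * x powr (- s)\<close> is the integral of
  \<open>t powr (s - 1) * exp (- (x * t))\<close> over \<open>t > 0\<close>. Taking the expectation
  inside replaces \<open>exp (- (x * t))\<close> by \<open>exp (- (t powr b))\<close>. The case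
  \<open>s = n\<close> is needed for (b), the case \<open>s = b\<close> for (d).\<close>

lemma neg_moment:
  assumes s: "0 < s"
  shows "has_bochner_integral \<mu> (\<lambda>x. x powr (- s)) (Gamma (s / b) / (b * Gamma s))"
proof -
  interpret P: pair_sigma_finite \<mu> lborel ..
  have G: "0 < Gamma s" "0 < Gamma (s / b)" using s b by simp_all
  define f where "f x t = indicator {0<..} t * (t powr (s - 1) * exp (- (x * t)))" for x t :: real
  have [measurable]: "(\<lambda>(x, t). f x t) \<in> borel_measurable (borel \<Otimes>\<^sub>M borel)"
    unfolding f_def by measurable
  have "(\<integral>\<^sup>+ x. ennreal (Gamma s * x powr (- s)) \<partial>\<mu>) = (\<integral>\<^sup>+ x. \<integral>\<^sup>+ t. ennreal (f x t) \<partial>lborel \<partial>\<mu>)"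
  proof (rule nn_integral_cong_AE)
    show "AE x in \<mu>. ennreal (Gamma s * x powr (- s)) = (\<integral>\<^sup>+ t. ennreal (f x t) \<partial>lborel)"
      using pos
    proof eventually_elim
      case (elim x)
      show ?case unfolding f_def
        by (rule nn_integral_has_integral_lebesgue[OF _ Gamma_integral_scaled[OF s elim], symmetric]) simp
    qed
  qed
  also have "\<dots> = (\<integral>\<^sup>+ t. \<integral>\<^sup>+ x. ennreal (f x t) \<partial>\<mu> \<partial>lborel)"
    by (rule P.Fubini'[symmetric]) measurable
  also have "\<dots> = (\<integral>\<^sup>+ t. ennreal (indicator {0<..} t * (t powr (s - 1) * exp (- (t powr b)))) \<partial>lborel)"
  proof (rule nn_integral_cong)
    fix t :: real
    show "(\<integral>\<^sup>+ x. ennreal (f x t) \<partial>\<mu>) =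
        ennreal (indicator {0<..} t * (t powr (s - 1) * exp (- (t powr b))))"
    proof (cases "0 < t")
      case True
      have "(\<integral>\<^sup>+ x. ennreal (f x t) \<partial>\<mu>) = (\<integral>\<^sup>+ x. ennreal (t powr (s - 1) * exp (- (t * x))) \<partial>\<mu>)"
        using True by (simp add: f_def mult.commute)
      also have "\<dots> = ennreal (\<integral>x. t powr (s - 1) * exp (- (t * x)) \<partial>\<mu>)"
        using True integrable_exp[of t] by (intro nn_integral_eq_integral) auto
      finally show ?thesis using True by (simp add: laplace)
    qed (simp add: f_def)
  qed
  also have "\<dots> = ennreal (Gamma (s / b) / b)"
    by (rule nn_integral_has_integral_lebesgue[OF _ Gamma_integral_powr]) (use s b in auto)
  finally have "has_bochner_integral \<mu> (\<lambda>x. Gamma s * x powr (- s)) (Gamma (s / b) / b)"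
    by (intro has_bochner_integral_nn_integral) (use G b in auto)
  from has_bochner_integral_mult_right[OF this, of "1 / Gamma s"] show ?thesis
    using G by (simp add: mult.commute)
qed

text \<open>The weight sits on the variable \<open>u = x / R\<close>. Near 0 it lowers the
  singularity \<open>u powr (- b - 1)\<close> of the limit to \<open>u powr (- b)\<close>, which is
  integrable because \<open>b < 1\<close>.\<close>

definition rescaled :: "real \<Rightarrow> real measure" where
  "rescaled R = density (distr \<mu> borel (\<lambda>x. x / R)) (\<lambda>u. ennreal (R powr b * (1 - exp (- u))))"

text \<open>Up to the weight this is the Levy measure of the subordinator with Laplace exponent
  \<open>r powr b\<close>.\<close>

definition levy_limit :: "real measure" where
  "levy_limit = density lborel
     (\<lambda>u. ennreal (indicator {0<..} u * (b / Gamma (1 - b) * ((1 - exp (- u)) * u powr (- b - 1)))))"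

lemma half_line_rescaled:
  assumes R: "0 < R"
  shows "half_line_measure (rescaled R)"
  unfolding half_line_measure_def
proof (intro conjI)
  have "emeasure (rescaled R) (space (rescaled R)) =
      (\<integral>\<^sup>+ x. ennreal (R powr b * (1 - exp (- (x / R)))) \<partial>\<mu>)"
    by (simp add: rescaled_def emeasure_density nn_integral_distr)
  also have "\<dots> \<le> (\<integral>\<^sup>+ x. ennreal (R powr b) \<partial>\<mu>)"
    by (intro nn_integral_mono ennreal_leI) (simp add: mult_left_le)
  also have "\<dots> < \<infinity>" by (simp add: ennreal_mult_less_top emeasure_eq_measure)
  finally show "finite_measure (rescaled R)" by (intro finite_measureI) auto
  have "AE x in distr \<mu> borel (\<lambda>x. x / R). 0 < x"
    using pos R by (subst AE_distr_iff) (auto elim!: eventually_mono)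
  then show "AE x in rescaled R. 0 < x"
    unfolding rescaled_def by (subst AE_density) (auto elim: eventually_mono)
qed (simp add: rescaled_def)

lemma integral_rescaled:
  assumes R: "0 < R" and g: "g \<in> borel_measurable borel"
  shows "(\<integral>u. g u \<partial>rescaled R) = (\<integral>x. R powr b * (1 - exp (- (x / R))) * g (x / R) \<partial>\<mu>)"
proof -
  have "AE x in distr \<mu> borel (\<lambda>x. x / R). 0 \<le> R powr b * (1 - exp (- x))"
    using pos R by (subst AE_distr_iff) (auto elim!: eventually_mono)
  then have "(\<integral>u. g u \<partial>rescaled R) =
      (\<integral>u. R powr b * (1 - exp (- u)) * g u \<partial>distr \<mu> borel (\<lambda>x. x / R))"
    unfolding rescaled_def using g by (intro integral_real_density) auto
  also have "\<dots> = (\<integral>x. R powr b * (1 - exp (- (x / R))) * g (x / R) \<partial>\<mu>)"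
    using g by (intro integral_distr) auto
  finally show ?thesis .
qed

lemma Gamma_pos: "0 < Gamma (1 - b)"
  using b by simp

lemma levy_limit_density:
  assumes "0 \<le> q"
  shows "has_bochner_integral lborel
    (\<lambda>u. indicator {0<..} u * (b / Gamma (1 - b) * ((1 - exp (- u)) * u powr (- b - 1))) * exp (- (q * u)))
    ((q + 1) powr b - q powr b)"
  using has_bochner_integral_mult_right[OF stable_Levy_density_laplace[OF b assms], of "b / Gamma (1 - b)"]
    Gamma_pos b by (simp add: mult_ac)

lemma integral_levy_limit:
  assumes g: "g \<in> borel_measurable borel"
  shows "(\<integral>u. g u \<partial>levy_limit) =
    (\<integral>u. indicator {0<..} u * (b / Gamma (1 - b) * ((1 - exp (- u)) * u powr (- b - 1))) * g u \<partial>lborel)"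
  unfolding levy_limit_def using g b Gamma_pos
  by (intro integral_real_density) (auto simp: indicator_def)

lemma half_line_levy_limit: "half_line_measure levy_limit"
  unfolding half_line_measure_def
proof (intro conjI)
  have "emeasure levy_limit (space levy_limit) =
    (\<integral>\<^sup>+ u. ennreal (indicator {0<..} u * (b / Gamma (1 - b) * ((1 - exp (- u)) * u powr (- b - 1)))) \<partial>lborel)"
    by (simp add: levy_limit_def emeasure_density)
  also have "\<dots> = ennreal (\<integral>u. indicator {0<..} u * (b / Gamma (1 - b) * ((1 - exp (- u)) * u powr (- b - 1))) \<partial>lborel)"
    using levy_limit_density[of 0] b Gamma_pos
    by (intro nn_integral_eq_integral) (auto simp: has_bochner_integral_iff indicator_def)
  finally show "finite_measure levy_limit" by (intro finite_measureI) auto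
  show "AE x in levy_limit. 0 < x"
    unfolding levy_limit_def by (subst AE_density) (auto simp: indicator_def)
qed (simp add: levy_limit_def)

text \<open>The weight \<open>1 - exp (- x / R)\<close> makes the rescaled laws finite measures whose Laplace
  transforms are differences of the given one.\<close>

lemma tendsto_rescaled_integral:
  assumes g: "g \<in> borel_measurable borel" "continuous_on {0<..} g"
    "(g \<longlongrightarrow> l0) (at_right 0)" "(g \<longlongrightarrow> l1) at_top"
  shows "((\<lambda>R. \<integral>x. R powr b * (1 - exp (- (x / R))) * g (x / R) \<partial>\<mu>) \<longlongrightarrow>
    (\<integral>u. indicator {0<..} u * (b / Gamma (1 - b) * ((1 - exp (- u)) * u powr (- b - 1))) * g u \<partial>lborel)) at_top"
proof -
  have "((\<lambda>R. \<integral>u. g u \<partial>rescaled R) \<longlongrightarrow> (\<integral>u. g u \<partial>levy_limit)) at_top"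
  proof (rule tendsto_integral_of_laplace[OF _ half_line_levy_limit _ g])
    show "\<forall>\<^sub>F R in at_top. half_line_measure (rescaled R)"
      using eventually_gt_at_top[of 0] by eventually_elim (rule half_line_rescaled)
    fix k :: nat
    have lim: "((\<lambda>R. R powr b * (exp (- (real k powr b / R powr b)) - exp (- ((real k + 1) powr b / R powr b))))
        \<longlongrightarrow> (real k + 1) powr b - real k powr b) at_top"
      by (rule filterlim_compose[OF tendsto_exp_difference]) (use b in real_asymp)
    have "\<forall>\<^sub>F R in at_top. R powr b * (exp (- (real k powr b / R powr b)) - exp (- ((real k + 1) powr b / R powr b)))
        = (\<integral>x. exp (- (real k * x)) \<partial>rescaled R)"
      using eventually_gt_at_top[of 0]
    proof eventually_elim
      case (elim R)
      \<comment> \<open>The weight times \<open>exp (- k * u)\<close> equals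
        \<open>exp (- k * u) - exp (- (k + 1) * u)\<close>, so only the transform of
        \<open>\<mu>\<close> at \<open>k / R\<close> and \<open>(k + 1) / R\<close> is
        involved.\<close>
      have "(\<integral>x. exp (- (real k * x)) \<partial>rescaled R) =
          (\<integral>x. R powr b * (exp (- (real k / R * x)) - exp (- ((real k + 1) / R * x))) \<partial>\<mu>)"
        by (subst integral_rescaled[OF elim])
          (auto intro!: Bochner_Integration.integral_cong simp: algebra_simps exp_add[symmetric] add_divide_distrib)
      also have "\<dots> = R powr b * (exp (- ((real k / R) powr b)) - exp (- (((real k + 1) / R) powr b)))"
        using elim integrable_exp[of "real k / R"] integrable_exp[of "(real k + 1) / R"]
          laplace_nonneg[of "real k / R"] laplace_nonneg[of "(real k + 1) / R"] by simp
      finally show ?case using elim by (simp add: powr_divide)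
    qed
    with lim have "((\<lambda>R. \<integral>x. exp (- (real k * x)) \<partial>rescaled R) \<longlongrightarrow> (real k + 1) powr b - real k powr b) at_top"
      by (rule Lim_transform_eventually)
    also have "(real k + 1) powr b - real k powr b = (\<integral>x. exp (- (real k * x)) \<partial>levy_limit)"
      using levy_limit_density[of "real k"] by (simp add: integral_levy_limit has_bochner_integral_iff)
    finally show "((\<lambda>R. \<integral>x. exp (- (real k * x)) \<partial>rescaled R) \<longlongrightarrow>
        (\<integral>x. exp (- (real k * x)) \<partial>levy_limit)) at_top" .
  qed
  moreover have "\<forall>\<^sub>F R in at_top. (\<integral>u. g u \<partial>rescaled R) =
      (\<integral>x. R powr b * (1 - exp (- (x / R))) * g (x / R) \<partial>\<mu>)"
    using eventually_gt_at_top[of 0] by eventually_elim (rule integral_rescaled[OF _ g(1)])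
  ultimately show ?thesis
    unfolding integral_levy_limit[OF g(1)] by (rule Lim_transform_eventually)
qed

text \<open>By homogeneity the left side is \<open>R powr b\<close> times the expectation of
  \<open>profile n 1 (x / R)\<close>, that is, the integral of \<open>g\<close>, the profile divided
  by the weight, under the rescaled law. Both numerator and denominator of \<open>g\<close> behave
  like \<open>u\<close> at 0, so \<open>g\<close> is an admissible test function.\<close>

theorem profile_expectation_at_top:
  assumes n: "1 \<le> n"
  shows "((\<lambda>R. R powr (n + b) * (\<integral>x. profile n R x \<partial>\<mu>)) \<longlongrightarrow>
    b / Gamma (1 - b) * (Beta ((1 - b) / 2) ((n + b) / 2) / 2)) at_top"
proof -
  define g where "g = (\<lambda>u. profile n 1 u / (1 - exp (- u)))"
  have g_meas: "g \<in> borel_measurable borel" unfolding g_def by measurable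
  have ne: "u\<^sup>2 + 1 \<noteq> 0" for u :: real by (metis add_nonneg_eq_0_iff zero_le_power2 zero_le_one zero_neq_one)
  have lim0: "(g \<longlongrightarrow> 1) (at_right 0)"
  proof -
    have "((\<lambda>u::real. u / (u\<^sup>2 + 1) powr ((n + 1) / 2) / (1 - exp (- u))) \<longlongrightarrow> 1) (at_right 0)"
      by real_asymp
    then show ?thesis by (simp add: g_def profile_def)
  qed
  have lim1: "(g \<longlongrightarrow> 0) at_top"
  proof -
    have "((\<lambda>u::real. 1 / (1 - exp (- u))) \<longlongrightarrow> 1) at_top" by real_asymp
    from tendsto_mult[OF profile_1_at_top[OF n] this] show ?thesis by (simp add: g_def)
  qed
  have cont: "continuous_on {0<..} g"
    unfolding g_def profile_def by (intro continuous_intros) (auto simp: ne)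
  have lim: "((\<lambda>R. \<integral>x. R powr b * (1 - exp (- (x / R))) * g (x / R) \<partial>\<mu>) \<longlongrightarrow>
    (\<integral>u. indicator {0<..} u * (b / Gamma (1 - b) * ((1 - exp (- u)) * u powr (- b - 1))) * g u \<partial>lborel)) at_top"
    by (rule tendsto_rescaled_integral[OF g_meas cont lim0 lim1])
  have "\<forall>\<^sub>F R in at_top. (\<integral>x. R powr b * (1 - exp (- (x / R))) * g (x / R) \<partial>\<mu>) =
      R powr (n + b) * (\<integral>x. profile n R x \<partial>\<mu>)"
    using eventually_gt_at_top[of 0]
  proof eventually_elim
    case (elim R)
    have "(\<integral>x. R powr b * (1 - exp (- (x / R))) * g (x / R) \<partial>\<mu>) =
        (\<integral>x. R powr (n + b) * profile n R x \<partial>\<mu>)"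
    proof (rule integral_cong_AE)
      show "AE x in \<mu>. R powr b * (1 - exp (- (x / R))) * g (x / R) = R powr (n + b) * profile n R x"
        using pos
      proof eventually_elim
        case x: (elim x)
        have "R powr (n + b) * profile n R x = (R powr (n + b) * R powr (- n)) * profile n 1 (x / R)"
          by (simp only: profile_eq_unit[OF elim] mult.assoc)
        also have "R powr (n + b) * R powr (- n) = R powr b"
          by (simp add: powr_add[symmetric])
        finally show ?case using x elim by (simp add: g_def)
      qed
    qed (use g_meas in measurable)
    then show ?case by simp
  qed
  with lim have "((\<lambda>R. R powr (n + b) * (\<integral>x. profile n R x \<partial>\<mu>)) \<longlongrightarrow>
    (\<integral>u. indicator {0<..} u * (b / Gamma (1 - b) * ((1 - exp (- u)) * u powr (- b - 1))) * g u \<partial>lborel)) at_top"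
    by (rule Lim_transform_eventually)
  also have "(\<integral>u. indicator {0<..} u * (b / Gamma (1 - b) * ((1 - exp (- u)) * u powr (- b - 1))) * g u \<partial>lborel) =
    (\<integral>u. b / Gamma (1 - b) * (indicator {0<..} u *
        (u powr (2 * ((1 - b) / 2) - 1) * (1 + u\<^sup>2) powr (- ((1 - b) / 2 + (n + b) / 2)))) \<partial>lborel)"
  proof (intro Bochner_Integration.integral_cong refl)
    fix u :: real
    \<comment> \<open>The weight cancels, and \<open>u powr (- b - 1) * u\<close> against
      \<open>(1 + u\<^sup>2) powr (- (n + 1) / 2)\<close> is the Beta integrand with
      \<open>p = (1 - b) / 2\<close> and \<open>q = (n + b) / 2\<close>.\<close>
    have e: "2 * ((1 - b) / 2) - 1 = - b" "(1 - b) / 2 + (n + b) / 2 = (n + 1) / 2"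
      by (simp_all add: field_simps)
    have "u powr (- b) = u powr (- b - 1) * u" if "0 < u" using that by (simp add: powr_diff)
    moreover have "(1 - exp (- u)) * Q * (U / X / (1 - exp (- u))) = Q * U * inverse X"
      if "0 < u" for Q U X
    proof -
      have "E * Q * (U / X / E) = Q * U * inverse X" if "E \<noteq> 0" for E
        using that by (simp add: divide_inverse)
      from this[of "1 - exp (- u)"] that show ?thesis by fastforce
    qed
    ultimately show "indicator {0<..} u * (b / Gamma (1 - b) * ((1 - exp (- u)) * u powr (- b - 1))) * g u =
      b / Gamma (1 - b) * (indicator {0<..} u *
        (u powr (2 * ((1 - b) / 2) - 1) * (1 + u\<^sup>2) powr (- ((1 - b) / 2 + (n + b) / 2))))"
      unfolding e g_def profile_def powr_minus[of "1 + u\<^sup>2"]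
      by (cases "0 < u") (simp_all add: mult.assoc add.commute)
  qed
  also have "\<dots> = b / Gamma (1 - b) * (Beta ((1 - b) / 2) ((n + b) / 2) / 2)"
    by (rule has_bochner_integral_integral_eq, rule has_bochner_integral_mult_right,
        rule has_bochner_integral_of_has_integral_nonneg[OF _ _ _ Beta_integral_Ioi])
       (use b n in auto)
  finally show ?thesis .
qed

text \<open>Continuity at \<open>r = 0\<close> by dominated convergence, the value there being the
  negative moment of order \<open>n\<close>. The filter \<open>nhds 0\<close> includes the point 0,
  as (b) allows \<open>x = y\<close>.\<close>

theorem profile_expectation_at_0:
  assumes n: "1 \<le> n"
  shows "((\<lambda>r. \<integral>x. profile n r x \<partial>\<mu>) \<longlongrightarrow> Gamma (n / b) / (b * Gamma n)) (nhds 0)"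
proof -
  have m: "has_bochner_integral \<mu> (\<lambda>x. x powr (- n)) (Gamma (n / b) / (b * Gamma n))"
    using n by (intro neg_moment) simp
  have zero: "(\<integral>x. profile n 0 x \<partial>\<mu>) = Gamma (n / b) / (b * Gamma n)"
  proof -
    have "(\<integral>x. profile n 0 x \<partial>\<mu>) = (\<integral>x. x powr (- n) \<partial>\<mu>)"
    proof (rule integral_cong_AE)
      show "AE x in \<mu>. profile n 0 x = x powr (- n)"
        using pos
      proof eventually_elim
        case (elim x)
        have "profile n 0 x = x powr (- n) * profile n 0 1"
          using profile_scale[OF elim, of n 0 1] by simp
        then show ?case by (simp add: profile_def)
      qed
    qed measurable
    then show ?thesis using m by (simp add: has_bochner_integral_iff)
  qed
  have "isCont (\<lambda>r. \<integral>x. profile n r x \<partial>\<mu>) 0"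
  proof (rule continuous_at_sequentiallyI)
    fix u :: "nat \<Rightarrow> real" assume u: "u \<longlonglongrightarrow> 0"
    show "(\<lambda>i. \<integral>x. profile n (u i) x \<partial>\<mu>) \<longlonglongrightarrow> (\<integral>x. profile n 0 x \<partial>\<mu>)"
    proof (rule integral_dominated_convergence)
      show "integrable \<mu> (\<lambda>x. x powr (- n))" using m by (simp add: has_bochner_integral_iff)
      show "AE x in \<mu>. (\<lambda>i. profile n (u i) x) \<longlonglongrightarrow> profile n 0 x"
        using pos by eventually_elim (auto simp: profile_def intro!: tendsto_eq_intros u)
      show "AE x in \<mu>. norm (profile n (u i) x) \<le> x powr (- n)" for i
        using pos by eventually_elim (use profile_le_powr profile_nonneg n in simp)
    qed measurable
  qed
  then have "((\<lambda>r. \<integral>x. profile n r x \<partial>\<mu>) \<longlongrightarrow> (\<integral>x. profile n 0 x \<partial>\<mu>)) (nhds 0)"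
    by (simp add: isCont_def tendsto_nhds_iff)
  then show ?thesis by (simp only: zero)
qed

text \<open>Markov's inequality for \<open>1 - exp (- y / x)\<close>, which is at least
  \<open>1 - exp (- 1)\<close> when \<open>y > x\<close> and whose expectation is at most
  \<open>x powr (- b)\<close>. Unlike the asymptotics it holds at every scale, so it serves as a
  majorant later.\<close>

lemma tail_le:
  assumes x: "0 < x"
  shows "measure \<mu> {x<..} \<le> 1 / (1 - exp (- 1)) * x powr (- b)"
proof -
  have "(1 - exp (- 1)) * measure \<mu> {x<..} = (\<integral>y. (1 - exp (- 1)) * indicator {x<..} y \<partial>\<mu>)"
    by simp
  also have "\<dots> \<le> (\<integral>y. 1 - exp (- (1 / x * y)) \<partial>\<mu>)"
  proof (rule integral_mono_AE)
    show "AE y in \<mu>. (1 - exp (- 1)) * indicator {x<..} y \<le> 1 - exp (- (1 / x * y))"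
      using pos by eventually_elim (use x in \<open>auto simp: indicator_def field_simps\<close>)
    show "integrable \<mu> (\<lambda>y. 1 - exp (- (1 / x * y)))"
      using integrable_exp[of "1 / x"] x by simp
  qed (intro integrable_mult_right integrable_real_indicator, auto simp: less_top[symmetric])
  also have "\<dots> = 1 - exp (- ((1 / x) powr b))"
    using integrable_exp[of "1 / x"] laplace[of "1 / x"] x prob_space by simp
  also have "\<dots> \<le> x powr (- b)"
    using exp_ge_add_one_self[of "- (x powr (- b))"] x by (simp add: powr_divide powr_minus field_simps)
  finally show ?thesis by (simp add: field_simps)
qed

lemma integral_powr_Ici:
  assumes "0 < s"
  shows "has_bochner_integral lborel (\<lambda>u. indicator {s..} u * (b * u powr (- b - 1))) (s powr (- b))"
proof -
  have "((\<lambda>u. u powr (- b - 1)) has_integral s powr (- b) / b) {s..}"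
    using has_integral_powr_to_inf[of "- b - 1" s] b assms by simp
  then have "((\<lambda>u. b * u powr (- b - 1)) has_integral b * (s powr (- b) / b)) {s..}"
    by (rule has_integral_mult_right)
  then show ?thesis
    using b by (intro has_bochner_integral_of_has_integral_nonneg) auto
qed

text \<open>An indicator is not a continuous test function, hence the ramp, which is 0 up to
  \<open>s\<close> and 1 from \<open>t\<close> on. Vanishing near 0, it may be divided by the
  weight. Its limit lies between the Levy masses of \<open>{t..}\<close> and
  \<open>{s..}\<close>.\<close>

lemma tendsto_smoothed_tail:
  assumes st: "0 < s" "s < t"
  defines "L \<equiv> (\<integral>u. indicator {0<..} u * (b * u powr (- b - 1)) * (1 - cts_step s t u) \<partial>lborel) / Gamma (1 - b)"
  shows "((\<lambda>R. \<integral>x. R powr b * (1 - cts_step s t (x / R)) \<partial>\<mu>) \<longlongrightarrow> L) at_top"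
    and "t powr (- b) / Gamma (1 - b) \<le> L" and "L \<le> s powr (- b) / Gamma (1 - b)"
proof -
  have cont: "continuous_on UNIV (cts_step s t)"
    by (rule uniformly_continuous_imp_continuous[OF cts_step_uniformly_continuous[OF st(2)]])
  have step_meas [measurable]: "cts_step s t \<in> borel_measurable borel"
    by (rule borel_measurable_continuous_onI[OF cont])
  define g where "g = (\<lambda>u. (1 - cts_step s t u) / (1 - exp (- u)))"
  have g_meas: "g \<in> borel_measurable borel" unfolding g_def by measurable
  have lim0: "(g \<longlongrightarrow> 0) (at_right 0)"
  proof (rule tendsto_eventually)
    show "\<forall>\<^sub>F u in at_right 0. g u = 0"
      using eventually_at_right_real[OF st(1)] by eventually_elim (simp add: g_def cts_step_def)
  qed
  have lim1: "(g \<longlongrightarrow> 1) at_top"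
  proof -
    have "\<forall>\<^sub>F u in at_top. 1 / (1 - exp (- u)) = g u"
      using eventually_ge_at_top[of t] by eventually_elim (use st in \<open>simp add: g_def cts_step_def\<close>)
    moreover have "((\<lambda>u::real. 1 / (1 - exp (- u))) \<longlongrightarrow> 1) at_top" by real_asymp
    ultimately show ?thesis by (rule Lim_transform_eventually[rotated])
  qed
  have cont_g: "continuous_on {0<..} g"
    unfolding g_def by (intro continuous_intros continuous_on_subset[OF cont]) auto
  have A: "((\<lambda>R. \<integral>x. R powr b * (1 - exp (- (x / R))) * g (x / R) \<partial>\<mu>) \<longlongrightarrow>
    (\<integral>u. indicator {0<..} u * (b / Gamma (1 - b) * ((1 - exp (- u)) * u powr (- b - 1))) * g u \<partial>lborel)) at_top"
    by (rule tendsto_rescaled_integral[OF g_meas cont_g lim0 lim1])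
  have E: "\<forall>\<^sub>F R in at_top. (\<integral>x. R powr b * (1 - exp (- (x / R))) * g (x / R) \<partial>\<mu>) =
      (\<integral>x. R powr b * (1 - cts_step s t (x / R)) \<partial>\<mu>)"
    using eventually_gt_at_top[of 0]
  proof eventually_elim
    case (elim R)
    show ?case
    proof (rule integral_cong_AE)
      show "AE x in \<mu>. R powr b * (1 - exp (- (x / R))) * g (x / R) = R powr b * (1 - cts_step s t (x / R))"
        using pos by eventually_elim (use elim in \<open>simp add: g_def\<close>)
    qed (use g_meas in measurable)
  qed
  have V: "(\<integral>u. indicator {0<..} u * (b / Gamma (1 - b) * ((1 - exp (- u)) * u powr (- b - 1))) * g u \<partial>lborel) = L"
    unfolding L_def integral_divide_zero[symmetric]
    by (intro Bochner_Integration.integral_cong refl) (auto simp: g_def indicator_def)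
  show "((\<lambda>R. \<integral>x. R powr b * (1 - cts_step s t (x / R)) \<partial>\<mu>) \<longlongrightarrow> L) at_top"
    using Lim_transform_eventually[OF A E] unfolding V .
  define w where "w u = indicator {0<..} u * (b * u powr (- b - 1)) * (1 - cts_step s t u)" for u
  have w_bounds: "indicator {t..} u * (b * u powr (- b - 1)) \<le> w u" "w u \<le> indicator {s..} u * (b * u powr (- b - 1))"
    "0 \<le> w u" for u
    using st b by (auto simp: w_def indicator_def cts_step_def field_simps)
  have w_int: "integrable lborel w"
  proof (rule Bochner_Integration.integrable_bound)
    show "integrable lborel (\<lambda>u. indicator {s..} u * (b * u powr (- b - 1)))"
      using integral_powr_Ici[OF st(1)] by (simp add: has_bochner_integral_iff)
    show "w \<in> borel_measurable lborel" unfolding w_def by measurable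
    have "norm (w u) \<le> norm (indicator {s..} u * (b * u powr (- b - 1)))" for u
      using w_bounds(2,3)[of u] unfolding real_norm_def by linarith
    then show "AE u in lborel. norm (w u) \<le> norm (indicator {s..} u * (b * u powr (- b - 1)))" by simp
  qed
  have dom: "has_bochner_integral lborel (\<lambda>u. indicator {t..} u * (b * u powr (- b - 1))) (t powr (- b))"
    "has_bochner_integral lborel (\<lambda>u. indicator {s..} u * (b * u powr (- b - 1))) (s powr (- b))"
    using st by (simp_all add: integral_powr_Ici)
  have "t powr (- b) \<le> integral\<^sup>L lborel w"
    unfolding has_bochner_integral_integral_eq[OF dom(1), symmetric]
    by (rule integral_mono[OF integrable.intros[OF dom(1)] w_int w_bounds(1)])
  then show "t powr (- b) / Gamma (1 - b) \<le> L"
    unfolding L_def w_def[symmetric] using Gamma_pos by (simp add: divide_right_mono)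
  have "integral\<^sup>L lborel w \<le> s powr (- b)"
    unfolding has_bochner_integral_integral_eq[OF dom(2), symmetric]
    by (rule integral_mono[OF w_int integrable.intros[OF dom(2)] w_bounds(2)])
  then show "L \<le> s powr (- b) / Gamma (1 - b)"
    unfolding L_def w_def[symmetric] using Gamma_pos by (simp add: divide_right_mono)
qed

lemma integrable_smoothed_tail:
  assumes st: "s < t"
  shows "integrable \<mu> (\<lambda>x. R powr b * (1 - cts_step s t (x / R)))"
proof (rule integrable_const_bound[of _ "R powr b"])
  have [measurable]: "cts_step s t \<in> borel_measurable borel"
    by (rule borel_measurable_continuous_onI[OF
          uniformly_continuous_imp_continuous[OF cts_step_uniformly_continuous[OF st]]])
  show "(\<lambda>x. R powr b * (1 - cts_step s t (x / R))) \<in> borel_measurable \<mu>" by measurable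
  show "AE x in \<mu>. norm (R powr b * (1 - cts_step s t (x / R))) \<le> R powr b"
    using st by (intro AE_I2) (auto simp: abs_mult cts_step_def intro!: mult_left_le)
qed

lemma integrable_tail:
  fixes c R :: real
  shows "integrable \<mu> (\<lambda>x. c * indicator {R<..} x)"
  by (intro integrable_mult_right integrable_real_indicator) (auto simp: less_top[symmetric])

lemma tendsto_powr_div_Gamma:
  "((\<lambda>c. c powr (- b) / Gamma (1 - b)) \<longlongrightarrow> 1 / Gamma (1 - b)) (at 1)"
  using Gamma_pos by (auto intro!: tendsto_eq_intros)

text \<open>The tail indicator is bounded below by a ramp on \<open>1..c\<close> with
  \<open>c > 1\<close> and above by a ramp on \<open>c..1\<close> with \<open>c < 1\<close>. In both
  cases the limit is controlled by \<open>c powr (- b) / Gamma (1 - b)\<close>, and \<open>c\<close>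
  is chosen near enough to 1 for the given \<open>y\<close>.\<close>

theorem tail_asymptotics:
  "((\<lambda>R. R powr b * measure \<mu> {R<..}) \<longlongrightarrow> 1 / Gamma (1 - b)) at_top"
proof (rule order_tendstoI)
  fix y assume y: "y < 1 / Gamma (1 - b)"
  have "\<forall>\<^sub>F c in at_right 1. y < c powr (- b) / Gamma (1 - b) \<and> 1 < c"
    using order_tendstoD(1)[OF filterlim_at_split[THEN iffD1, THEN conjunct2, OF tendsto_powr_div_Gamma] y]
      eventually_at_right_less[of 1] by eventually_elim auto
  then obtain c where c: "y < c powr (- b) / Gamma (1 - b)" "1 < c"
    using eventually_happens by force
  have "\<forall>\<^sub>F R in at_top. y < (\<integral>x. R powr b * (1 - cts_step 1 c (x / R)) \<partial>\<mu>)"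
    using c tendsto_smoothed_tail(2)[of 1 c]
    by (intro order_tendstoD(1)[OF tendsto_smoothed_tail(1)[of 1 c]]) auto
  then show "\<forall>\<^sub>F R in at_top. y < R powr b * measure \<mu> {R<..}"
    using eventually_gt_at_top[of 0]
  proof eventually_elim
    case (elim R)
    have "(\<integral>x. R powr b * (1 - cts_step 1 c (x / R)) \<partial>\<mu>) \<le> (\<integral>x. R powr b * indicator {R<..} x \<partial>\<mu>)"
      by (rule integral_mono[OF integrable_smoothed_tail[OF c(2)] integrable_tail])
         (use c(2) elim(2) in \<open>auto simp: indicator_def cts_step_def field_simps\<close>)
    with elim(1) show ?case by simp
  qed
next
  fix y assume y: "1 / Gamma (1 - b) < y"
  have "\<forall>\<^sub>F c in at_left 1. c powr (- b) / Gamma (1 - b) < y \<and> c \<in> {0<..<1}"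
    using order_tendstoD(2)[OF filterlim_at_split[THEN iffD1, THEN conjunct1, OF tendsto_powr_div_Gamma] y]
      eventually_at_left_real[of 0 1] by (simp add: eventually_conj_iff)
  then obtain c where c: "c powr (- b) / Gamma (1 - b) < y" "0 < c" "c < 1"
    using eventually_happens by force
  have "\<forall>\<^sub>F R in at_top. (\<integral>x. R powr b * (1 - cts_step c 1 (x / R)) \<partial>\<mu>) < y"
    using c tendsto_smoothed_tail(3)[of c 1]
    by (intro order_tendstoD(2)[OF tendsto_smoothed_tail(1)[of c 1]]) auto
  then show "\<forall>\<^sub>F R in at_top. R powr b * measure \<mu> {R<..} < y"
    using eventually_gt_at_top[of 0]
  proof eventually_elim
    case (elim R)
    have le: "indicator {R<..} x \<le> 1 - cts_step c 1 (x / R)" for x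
    proof (cases "R < x")
      case True
      then have "1 \<le> x / R" using elim(2) by simp
      then show ?thesis using c by (simp add: cts_step_def)
    qed (use c in \<open>auto simp: cts_step_def field_simps\<close>)
    have "(\<integral>x. R powr b * indicator {R<..} x \<partial>\<mu>) \<le> (\<integral>x. R powr b * (1 - cts_step c 1 (x / R)) \<partial>\<mu>)"
      by (rule integral_mono[OF integrable_tail integrable_smoothed_tail[OF c(3)]])
         (use c elim(2) le in \<open>auto intro!: mult_left_mono\<close>)
    with elim(1) show ?case by simp
  qed
qed

end

section \<open>Laws with linear distribution function at the origin\<close>

lemma FTC_Ioi:
  fixes f F :: "real \<Rightarrow> real"
  assumes F: "\<And>x. a < x \<Longrightarrow> (F has_real_derivative f x) (at x)"
    and f: "\<And>x. a < x \<Longrightarrow> isCont f x"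
    and int: "integrable lborel (\<lambda>x. indicator {a<..} x * f x)"
    and A: "isCont F a" and B: "(F \<longlongrightarrow> B) at_top"
  shows "(\<integral>x. indicator {a<..} x * f x \<partial>lborel) = B - F a"
proof -
  have "(LBINT x=ereal a..\<infinity>. f x) = B - F a"
  proof (rule interval_integral_FTC_integrable)
    show "(F has_vector_derivative f x) (at x)" if "ereal a < ereal x" for x
      using F[of x] that by (simp add: has_real_derivative_iff_has_vector_derivative)
    show "set_integrable lborel (einterval (ereal a) \<infinity>) f"
      using int by (simp add: set_integrable_def einterval_eq)
    show "((F \<circ> real_of_ereal) \<longlongrightarrow> F a) (at_right (ereal a))"
      using A by (simp add: ereal_tendsto_simps isCont_def filterlim_at_split)
    show "((F \<circ> real_of_ereal) \<longlongrightarrow> B) (at_left \<infinity>)"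
      using B by (simp add: ereal_tendsto_simps)
  qed (use f in auto)
  then show ?thesis
    by (simp add: interval_lebesgue_integral_def set_lebesgue_integral_def einterval_eq)
qed

lemma integrable_exp_neg_abs: "integrable lborel (\<lambda>x::real. exp (- \<bar>x\<bar>))"
proof -
  define f where "f x = indicator {0<..} x * (x powr (1 - 1) * exp (- x))" for x :: real
  have "has_bochner_integral lborel f (Gamma 1)"
    unfolding f_def
    by (rule has_bochner_integral_of_has_integral_nonneg[OF _ _ _ Gamma_integral_Ioi]) auto
  then have f: "integrable lborel f" by (rule integrable.intros)
  have "integrable lborel (\<lambda>x. f (0 + (- 1) * x))"
    by (rule lborel_integrable_real_affine[OF f]) simp
  then have "integrable lborel (\<lambda>x. f x + f (- x))" using f by simp
  moreover have "AE x in lborel. f x + f (- x) = exp (- \<bar>x\<bar>)"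
    using AE_lborel_singleton[of 0] by eventually_elim (auto simp: f_def indicator_def)
  ultimately show ?thesis
    by (subst integrable_cong_AE[where g = "\<lambda>x. f x + f (- x)"]) (auto simp: f_def elim: eventually_mono)
qed

text \<open>Fubini in the form needed to trade a kernel for its derivative: if the inner integral
  reproduces the kernel at \<open>w\<close>, its expectation only sees the distribution function.
  \<open>\<phi>\<close> is kept general to serve both a linear and an exponential parametrisation of
  the levels.\<close>

lemma (in real_distribution) layer_cake:
  fixes g :: "real \<Rightarrow> real"
  assumes g: "integrable lborel g" and \<phi> [measurable]: "\<phi> \<in> borel_measurable borel"
  shows "(\<integral>w. (\<integral>t. (if w < \<phi> t then g t else 0) \<partial>lborel) \<partial>M) = (\<integral>t. g t * measure M {..<\<phi> t} \<partial>lborel)"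
proof -
  interpret P: pair_sigma_finite M lborel ..
  have [measurable]: "g \<in> borel_measurable borel" using g by simp
  define f where "f w t = (if w < \<phi> t then g t else 0)" for w t
  have f_meas [measurable]: "(\<lambda>(w, t). f w t) \<in> borel_measurable (M \<Otimes>\<^sub>M lborel)"
    unfolding f_def by measurable
  have int: "integrable lborel (\<lambda>t. f w t)" for w
    by (rule Bochner_Integration.integrable_bound[OF g]) (auto simp: f_def)
  have "integrable (M \<Otimes>\<^sub>M lborel) (\<lambda>(w, t). f w t)"
  proof (rule P.Fubini_integrable)
    show "integrable M (\<lambda>w. \<integral>t. norm ((\<lambda>(w, t). f w t) (w, t)) \<partial>lborel)"
    proof (rule integrable_const_bound)
      show "AE w in M. norm (\<integral>t. norm ((\<lambda>(w, t). f w t) (w, t)) \<partial>lborel) \<le> (\<integral>t. norm (g t) \<partial>lborel)"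
        using int g by (intro AE_I2) (auto intro!: integral_mono simp: f_def integral_nonneg)
    qed measurable
  qed (use int in auto)
  then have "(\<integral>t. (\<integral>w. f w t \<partial>M) \<partial>lborel) = (\<integral>w. (\<integral>t. f w t \<partial>lborel) \<partial>M)"
    by (rule P.Fubini_integral)
  moreover have "(\<integral>w. f w t \<partial>M) = g t * measure M {..<\<phi> t}" for t
  proof -
    have "(\<integral>w. f w t \<partial>M) = (\<integral>w. g t * indicator {..<\<phi> t} w \<partial>M)"
      by (intro Bochner_Integration.integral_cong) (auto simp: f_def)
    then show ?thesis by simp
  qed
  ultimately show ?thesis by (simp add: f_def)
qed

text \<open>For the inverse subordinator at time 1 the slope \<open>f0\<close> is \<open>1 / Gamma (1 - b)\<close>.\<close>

locale linear_at_0 = real_distribution \<nu> for \<nu> :: "real measure" +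
  fixes C f0 :: real
  assumes pos: "AE w in \<nu>. 0 < w"
    and F_le: "\<And>y. 0 < y \<Longrightarrow> measure \<nu> {..<y} \<le> C * y"
    and F_slope: "((\<lambda>y. measure \<nu> {..<y} / y) \<longlongrightarrow> f0) (at_right 0)"
begin

lemma C_nonneg: "0 \<le> C"
  using F_le[of 1] measure_nonneg[of \<nu> "{..<1}"] by linarith

lemma F_measurable [measurable]: "(\<lambda>y. measure \<nu> {..<y}) \<in> borel_measurable borel"
  by (rule borel_measurable_mono) (auto intro!: monoI finite_measure_mono)

text \<open>With \<open>h = profile n 1\<close> and \<open>F y\<close> the mass of
  \<open>{..<y}\<close>, the left side is the integral of \<open>- h' u * u\<close> against
  \<open>F (u / R) / (u / R)\<close>, which tends to \<open>f0\<close> and is at most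
  \<open>C\<close>. Integrating by parts back, \<open>- u * h' u\<close> has the same integral as
  \<open>h\<close>, namely \<open>1 / (n - 1)\<close>; this is finite exactly because
  \<open>n > 1\<close>.\<close>

theorem profile_expectation_small_scale:
  assumes n: "1 < n"
  shows "((\<lambda>R. R powr (1 - n) * (\<integral>w. profile n (inverse R) w \<partial>\<nu>)) \<longlongrightarrow> f0 / (n - 1)) at_top"
proof -
  define h where "h = profile n 1"
  define a where "a = (n + 1) / 2"
  have na: "n = 2 * a - 1" by (simp add: a_def field_simps)
  define h' where "h' u = (1 - n * u\<^sup>2) * (u\<^sup>2 + 1) powr (- a - 1)" for u
  have pos1: "0 < u\<^sup>2 + 1" for u :: real by (simp add: add_nonneg_pos)
  have h_eq: "h u = u * (u\<^sup>2 + 1) powr (- a)" for u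
    unfolding h_def profile_def a_def[symmetric] by (simp only: powr_minus divide_inverse power_one)
  have pw: "(u\<^sup>2 + 1) powr (- a) = (u\<^sup>2 + 1) * (u\<^sup>2 + 1) powr (- a - 1)" for u
  proof -
    have "(u\<^sup>2 + 1) powr (1 + (- a - 1)) = (u\<^sup>2 + 1) * (u\<^sup>2 + 1) powr (- a - 1)"
      using pos1[of u] by (simp only: powr_add powr_one less_imp_le)
    then show ?thesis by simp
  qed
  have h_deriv: "(h has_real_derivative h' u) (at u)" for u
  proof -
    have "((\<lambda>u. u\<^sup>2 + 1) has_real_derivative 2 * u) (at u)"
      by (auto intro!: derivative_eq_intros)
    from DERIV_mult[OF DERIV_ident DERIV_fun_powr[OF this pos1, of "- a"]]
    have "((\<lambda>u. u * (u\<^sup>2 + 1) powr (- a)) has_real_derivative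
        1 * (u\<^sup>2 + 1) powr (- a) + (- a) * (u\<^sup>2 + 1) powr (- a - 1) * (2 * u) * u) (at u)"
      by simp
    moreover have "1 * (u\<^sup>2 + 1) powr (- a) + (- a) * (u\<^sup>2 + 1) powr (- a - 1) * (2 * u) * u = h' u"
      unfolding h'_def pw[of u] na by (simp add: algebra_simps power2_eq_square)
    ultimately show ?thesis unfolding h_eq[abs_def] by simp
  qed
  have h'_cont: "isCont h' u" for u
    unfolding h'_def[abs_def] using pos1[of u] by (intro continuous_intros) auto
  \<comment> \<open>Chosen so that multiplication by \<open>u\<close> gives
    \<open>\<bar>u * h' u\<bar> \<le> n * h u\<close> for \<open>u > 0\<close>: integrability of
    \<open>h\<close> then carries over.\<close>
  have h'_le: "\<bar>h' u\<bar> \<le> n * (u\<^sup>2 + 1) powr (- a)" for u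
  proof -
    have "\<bar>1 - n * u\<^sup>2\<bar> \<le> n * (u\<^sup>2 + 1)"
    proof -
      have "0 \<le> n * u\<^sup>2" using n by simp
      then show ?thesis using n unfolding abs_le_iff distrib_left by linarith
    qed
    then have "\<bar>1 - n * u\<^sup>2\<bar> * (u\<^sup>2 + 1) powr (- a - 1)
        \<le> n * (u\<^sup>2 + 1) * (u\<^sup>2 + 1) powr (- a - 1)"
      by (rule mult_right_mono) simp
    then show ?thesis by (simp add: h'_def abs_mult pw mult.assoc)
  qed
  have h'_meas [measurable]: "h' \<in> borel_measurable borel" unfolding h'_def by measurable
  have h_meas [measurable]: "h \<in> borel_measurable borel" unfolding h_def by measurable
  \<comment> \<open>Beta integral with \<open>p = 1 / 2\<close> and \<open>q = n / 2\<close>; it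
    makes \<open>h'\<close> itself integrable, as the layer-cake formula requires.\<close>
  have int0: "integrable lborel (\<lambda>u. indicator {0<..} u * (u\<^sup>2 + 1) powr (- a))"
  proof -
    have "has_bochner_integral lborel
       (\<lambda>u. indicator {0<..} u * (u powr (2 * (1 / 2) - 1) * (1 + u\<^sup>2) powr (- (1 / 2 + n / 2))))
       (Beta (1 / 2) (n / 2) / 2)"
      by (rule has_bochner_integral_of_has_integral_nonneg[OF _ _ _ Beta_integral_Ioi]) (use n in auto)
    then have "integrable lborel
       (\<lambda>u. indicator {0<..} u * (u powr (2 * (1 / 2) - 1) * (1 + u\<^sup>2) powr (- (1 / 2 + n / 2))))"
      by (rule integrable.intros)
    moreover have "indicator {0<..} u * (u powr (2 * (1 / 2) - 1) * (1 + u\<^sup>2) powr (- (1 / 2 + n / 2))) =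
        indicator {0<..} u * (u\<^sup>2 + 1) powr (- a)" for u :: real
    proof -
      have "1 / 2 + n / 2 = a" "2 * (1 / 2) - 1 = (0 :: real)" by (simp_all add: a_def field_simps)
      then show ?thesis by (simp only: add.commute[of 1]) (simp add: indicator_def)
    qed
    ultimately show ?thesis by (simp only:)
  qed
  \<comment> \<open>Beta integral with \<open>p = 1\<close> and \<open>q = (n - 1) / 2\<close>,
    where \<open>Beta 1 q = 1 / q\<close>.\<close>
  have int1: "has_bochner_integral lborel (\<lambda>u. indicator {0<..} u * h u) (1 / (n - 1))"
  proof -
    have "has_bochner_integral lborel
       (\<lambda>u. indicator {0<..} u * (u powr (2 * 1 - 1) * (1 + u\<^sup>2) powr (- (1 + (n - 1) / 2))))
       (Beta 1 ((n - 1) / 2) / 2)"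
      by (rule has_bochner_integral_of_has_integral_nonneg[OF _ _ _ Beta_integral_Ioi]) (use n in auto)
    moreover have "indicator {0<..} u * (u powr (2 * 1 - 1) * (1 + u\<^sup>2) powr (- (1 + (n - 1) / 2))) =
        indicator {0<..} u * h u" for u :: real
    proof -
      have "1 + (n - 1) / 2 = a" "2 * 1 - 1 = (1 :: real)" by (simp_all add: a_def field_simps)
      then show ?thesis by (simp only: h_eq add.commute[of 1]) (simp add: indicator_def)
    qed
    moreover have "Beta 1 ((n - 1) / 2) / 2 = 1 / (n - 1)"
    proof -
      have "Gamma (1 + (n - 1) / 2) = (n - 1) / 2 * Gamma ((n - 1) / 2)"
      proof -
        have "(n - 1) / 2 \<notin> \<int>\<^sub>\<le>\<^sub>0" using nonpos_Ints_nonpos[of "(n - 1) / 2"] n by force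
        from Gamma_plus1[OF this] show ?thesis by (simp only: add.commute)
      qed
      moreover have "Gamma ((n - 1) / 2) \<noteq> 0"
        using Gamma_real_pos[of "(n - 1) / 2"] n by (metis diff_gt_0_iff_gt half_gt_zero less_irrefl)
      ultimately show ?thesis using n by (simp add: Beta_def)
    qed
    ultimately show ?thesis by (simp only:)
  qed
  \<comment> \<open>The sign makes \<open>h w\<close> the integral of \<open>g\<close> over levels
    above \<open>w\<close>, since \<open>h\<close> vanishes at infinity.\<close>
  define g where "g u = - (indicator {0<..} u * h' u)" for u
  have g_meas [measurable]: "g \<in> borel_measurable borel" unfolding g_def by measurable
  have g_int: "integrable lborel g"
  proof (rule Bochner_Integration.integrable_bound[OF integrable_mult_right[OF int0, of n]])
    show "AE u in lborel. norm (g u) \<le> norm (n * (indicator {0<..} u * (u\<^sup>2 + 1) powr (- a)))"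
      using h'_le n by (intro AE_I2) (simp add: g_def indicator_def abs_mult)
  qed simp
  have g_bound: "\<bar>g u * u\<bar> \<le> n * (indicator {0<..} u * h u)" for u
    using h'_le[of u] by (auto simp: g_def indicator_def h_eq abs_mult intro: mult_right_mono)
  have gu_int: "integrable lborel (\<lambda>u. g u * u)"
  proof (rule Bochner_Integration.integrable_bound[OF integrable_mult_right[OF integrable.intros[OF int1], of n]])
    show "AE u in lborel. norm (g u * u) \<le> norm (n * (indicator {0<..} u * h u))"
      using g_bound by (intro AE_I2) (simp add: order_trans[OF _ abs_ge_self])
  qed simp
  have inner: "(\<integral>u. (if w < u / R then g u else 0) \<partial>lborel) = h (w * R)" if "0 < w" "0 < R" for w R
  proof -
    have eq: "(if w < u / R then g u else 0) = - (indicator {w * R<..} u * h' u)" for u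
      using that by (auto simp: g_def indicator_def field_simps) (meson less_le_trans mult_pos_pos less_trans not_less)
    have "integrable lborel (\<lambda>u. indicator {w * R<..} u * h' u)"
    proof (rule Bochner_Integration.integrable_bound[OF g_int])
      show "AE u in lborel. norm (indicator {w * R<..} u * h' u) \<le> norm (g u)"
        using eq by (intro AE_I2) (metis abs_minus_cancel norm_zero norm_ge_zero order_refl real_norm_def)
    qed simp
    then have "(\<integral>u. indicator {w * R<..} u * h' u \<partial>lborel) = 0 - h (w * R)"
      using n by (intro FTC_Ioi h_deriv h'_cont DERIV_isCont[OF h_deriv])
         (auto simp: h_def intro!: profile_1_at_top)
    then show ?thesis unfolding eq by simp
  qed
  \<comment> \<open>Homogeneity produces \<open>R powr n\<close>; the remaining factor
    \<open>R\<close> turns \<open>F (u / R)\<close> into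
    \<open>u * (F (u / R) / (u / R))\<close>.\<close>
  have expectation_eq: "R powr (1 - n) * (\<integral>w. profile n (inverse R) w \<partial>\<nu>) =
      (\<integral>u. (g u * u) * (measure \<nu> {..<u / R} / (u / R)) \<partial>lborel)" if R: "0 < R" for R
  proof -
    have "(\<integral>w. profile n (inverse R) w \<partial>\<nu>) = (\<integral>w. R powr n * (\<integral>u. (if w < u / R then g u else 0) \<partial>lborel) \<partial>\<nu>)"
    proof (rule integral_cong_AE)
      show "AE w in \<nu>. profile n (inverse R) w = R powr n * (\<integral>u. (if w < u / R then g u else 0) \<partial>lborel)"
        using pos
      proof eventually_elim
        case (elim w)
        have "inverse R powr (- n) = R powr n" using R by (simp add: powr_minus inverse_powr)
        then show ?case
          using profile_eq_unit[of "inverse R" n w] R inner[OF elim R] by (simp add: h_def divide_inverse)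
      qed
    qed measurable
    also have "\<dots> = R powr n * (\<integral>u. g u * measure \<nu> {..<u / R} \<partial>lborel)"
      using layer_cake[OF g_int, of "\<lambda>u. u / R"] by simp
    finally have "R powr (1 - n) * (\<integral>w. profile n (inverse R) w \<partial>\<nu>) =
        (R powr (1 - n) * R powr n) * (\<integral>u. g u * measure \<nu> {..<u / R} \<partial>lborel)" by simp
    also have "R powr (1 - n) * R powr n = R" using R by (simp add: powr_add[symmetric])
    also have "R * (\<integral>u. g u * measure \<nu> {..<u / R} \<partial>lborel) = (\<integral>u. R * (g u * measure \<nu> {..<u / R}) \<partial>lborel)"
      by simp
    also have "\<dots> = (\<integral>u. (g u * u) * (measure \<nu> {..<u / R} / (u / R)) \<partial>lborel)"
      using R by (intro Bochner_Integration.integral_cong refl) (auto simp: g_def indicator_def)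
    finally show ?thesis .
  qed
  have "((\<lambda>R. \<integral>u. (g u * u) * (measure \<nu> {..<u / R} / (u / R)) \<partial>lborel) \<longlongrightarrow>
      (\<integral>u. (g u * u) * f0 \<partial>lborel)) at_top"
  proof (rule integral_dominated_convergence_at_top)
    show "integrable lborel (\<lambda>u. C * (n * (indicator {0<..} u * h u)))"
      using integrable.intros[OF int1] by simp
    show "AE u in lborel. ((\<lambda>R. (g u * u) * (measure \<nu> {..<u / R} / (u / R))) \<longlongrightarrow> (g u * u) * f0) at_top"
    proof (rule AE_I2)
      fix u :: real
      show "((\<lambda>R. (g u * u) * (measure \<nu> {..<u / R} / (u / R))) \<longlongrightarrow> (g u * u) * f0) at_top"
      proof (cases "0 < u")
        case True
        then have "filterlim (\<lambda>R. u / R) (at_right 0) at_top" by real_asymp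
        from filterlim_compose[OF F_slope this] show ?thesis by (intro tendsto_intros)
      qed (simp add: g_def)
    qed
    show "\<forall>\<^sub>F R in at_top. AE u in lborel. norm ((g u * u) * (measure \<nu> {..<u / R} / (u / R)))
        \<le> C * (n * (indicator {0<..} u * h u))"
      using eventually_gt_at_top[of 0]
    proof (eventually_elim, intro AE_I2)
      fix R u :: real assume R: "0 < R"
      show "norm ((g u * u) * (measure \<nu> {..<u / R} / (u / R))) \<le> C * (n * (indicator {0<..} u * h u))"
      proof (cases "0 < u")
        case True
        then have y: "0 < u / R" using R by simp
        have "\<bar>measure \<nu> {..<u / R} / (u / R)\<bar> \<le> C"
        proof -
          have "measure \<nu> {..<u / R} / (u / R) \<le> C"
            using F_le[OF y] by (simp only: pos_divide_le_eq[OF y])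
          moreover have "0 \<le> measure \<nu> {..<u / R} / (u / R)"
            by (rule divide_nonneg_nonneg[OF measure_nonneg less_imp_le[OF y]])
          ultimately show ?thesis by linarith
        qed
        then have "\<bar>g u * u\<bar> * \<bar>measure \<nu> {..<u / R} / (u / R)\<bar> \<le> (n * (indicator {0<..} u * h u)) * C"
          using g_bound[of u] by (intro mult_mono) auto
        then show ?thesis by (metis real_norm_def abs_mult mult.commute)
      qed (simp add: g_def)
    qed
  qed measurable
  moreover have "\<forall>\<^sub>F R in at_top. (\<integral>u. (g u * u) * (measure \<nu> {..<u / R} / (u / R)) \<partial>lborel) =
      R powr (1 - n) * (\<integral>w. profile n (inverse R) w \<partial>\<nu>)"
    using eventually_gt_at_top[of 0] by eventually_elim (rule expectation_eq[symmetric])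
  moreover have "(\<integral>u. (g u * u) * f0 \<partial>lborel) = f0 / (n - 1)"
  proof -
    \<comment> \<open>\<open>h u + u * h' u\<close> is the derivative of \<open>u * h u\<close>,
      which vanishes at 0 and at infinity, so the integrals of \<open>g u * u\<close> and
      \<open>h\<close> agree.\<close>
    have int_sum: "integrable lborel (\<lambda>u. indicator {0<..} u * h u - g u * u)"
      using gu_int integrable.intros[OF int1] by simp
    have eq: "indicator {0<..} u * (h u + u * h' u) = indicator {0<..} u * h u - g u * u" for u
      by (simp add: g_def algebra_simps)
    have lim: "((\<lambda>u. u * h u) \<longlongrightarrow> 0) at_top"
    proof (rule tendsto_sandwich[of "\<lambda>_. 0" _ _ "\<lambda>u. (u\<^sup>2 + 1) powr ((1 - n) / 2)"])
      have "u * h u \<le> (u\<^sup>2 + 1) powr ((1 - n) / 2)" for u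
      proof -
        have "(1 - n) / 2 = 1 + (- a)" by (simp add: a_def field_simps)
        then have "(u\<^sup>2 + 1) powr ((1 - n) / 2) = (u\<^sup>2 + 1) * (u\<^sup>2 + 1) powr (- a)"
          using pos1[of u] by (simp only: powr_add powr_one less_imp_le)
        then show ?thesis by (simp add: h_eq power2_eq_square[symmetric] mult.assoc[symmetric] mult_right_mono)
      qed
      then show "\<forall>\<^sub>F u in at_top. u * h u \<le> (u\<^sup>2 + 1) powr ((1 - n) / 2)" by simp
      show "\<forall>\<^sub>F u in at_top. 0 \<le> u * h u"
        by (intro always_eventually) (simp add: h_eq mult.assoc[symmetric])
      have "filterlim (\<lambda>u::real. u\<^sup>2 + 1) at_top at_top" by real_asymp
      then show "((\<lambda>u::real. (u\<^sup>2 + 1) powr ((1 - n) / 2)) \<longlongrightarrow> 0) at_top"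
        by (rule tendsto_neg_powr[rotated]) (use n in simp)
    qed simp
    have "(\<integral>u. indicator {0<..} u * (h u + u * h' u) \<partial>lborel) = 0 - 0 * h 0"
    proof (rule FTC_Ioi[where F = "\<lambda>u. u * h u"])
      show "((\<lambda>u. u * h u) has_real_derivative h u + u * h' u) (at u)" for u
        by (auto intro!: derivative_eq_intros h_deriv)
      show "isCont (\<lambda>u. h u + u * h' u) u" for u
        by (intro continuous_intros h'_cont DERIV_isCont[OF h_deriv])
      show "isCont (\<lambda>u. u * h u) 0"
        by (intro continuous_intros DERIV_isCont[OF h_deriv])
      show "integrable lborel (\<lambda>u. indicator {0<..} u * (h u + u * h' u))"
        unfolding eq by (rule int_sum)
    qed (rule lim)
    then have "(\<integral>u. g u * u \<partial>lborel) = 1 / (n - 1)"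
      unfolding eq using gu_int int1 by (simp add: has_bochner_integral_iff)
    then show ?thesis by simp
  qed
  ultimately show ?thesis by (simp add: Lim_transform_eventually)
qed

text \<open>The substitution \<open>y = exp (L * t)\<close> in the layer-cake integral exhibits the logarithm: the
  rescaled integrand converges to \<open>f0\<close> on \<open>{-1<..<0}\<close> and to \<open>0\<close> elsewhere, the scales between
  \<open>exp (- L)\<close> and \<open>1\<close> contributing equally.\<close>

theorem profile_expectation_critical:
  "((\<lambda>L. (\<integral>w. profile 1 (exp (- L)) w \<partial>\<nu>) / L) \<longlongrightarrow> f0) at_top"
proof -
  \<comment> \<open>\<open>H \<sigma>\<close> is \<open>profile 1 1 (exp \<sigma>)\<close>, the
    kernel in the logarithmic variable. The factor \<open>exp \<sigma>\<close> in \<open>G\<close>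
    is the one that matches the division of the distribution function by its argument.\<close>
  define H where "H \<sigma> = 1 / (exp \<sigma> + exp (- \<sigma>))" for \<sigma> :: real
  define H' where "H' \<sigma> = - (exp \<sigma> - exp (- \<sigma>)) / (exp \<sigma> + exp (- \<sigma>))\<^sup>2" for \<sigma> :: real
  define G where "G \<sigma> = - H' \<sigma> * exp \<sigma>" for \<sigma> :: real
  have ne: "exp \<sigma> + exp (- \<sigma>) \<noteq> 0" for \<sigma> :: real
    using exp_gt_zero[of \<sigma>] exp_gt_zero[of "- \<sigma>"] by linarith
  have H_deriv: "(H has_real_derivative H' \<sigma>) (at \<sigma>)" for \<sigma>
    unfolding H_def[abs_def] H'_def
    by (rule derivative_eq_intros refl ne)+ (simp add: power2_eq_square)
  have H'_cont: "isCont H' \<sigma>" for \<sigma>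
    unfolding H'_def[abs_def] using ne by (intro continuous_intros) auto
  have H'_meas [measurable]: "H' \<in> borel_measurable borel" unfolding H'_def by measurable
  have H'_H: "\<bar>H' \<sigma>\<bar> \<le> H \<sigma>" for \<sigma>
  proof -
    let ?S = "exp \<sigma> + exp (- \<sigma>)"
    have S: "0 < ?S" by (simp add: add_pos_pos)
    have "\<bar>exp \<sigma> - exp (- \<sigma>)\<bar> \<le> ?S" by (simp add: abs_le_iff)
    then have "\<bar>exp \<sigma> - exp (- \<sigma>)\<bar> / ?S\<^sup>2 \<le> ?S / ?S\<^sup>2" by (rule divide_right_mono) simp
    also have "?S / ?S\<^sup>2 = H \<sigma>" using S by (simp add: H_def power2_eq_square)
    also have "\<bar>exp \<sigma> - exp (- \<sigma>)\<bar> / ?S\<^sup>2 = \<bar>H' \<sigma>\<bar>" by (simp add: H'_def abs_divide abs_minus_commute)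
    finally show ?thesis .
  qed
  have H_le: "H \<sigma> \<le> exp (- \<bar>\<sigma>\<bar>)" for \<sigma>
  proof -
    have "exp \<bar>\<sigma>\<bar> \<le> exp \<sigma> + exp (- \<sigma>)" by (auto simp: abs_if)
    then have "1 / (exp \<sigma> + exp (- \<sigma>)) \<le> 1 / exp \<bar>\<sigma>\<bar>"
      by (intro divide_left_mono) (auto intro!: mult_pos_pos add_pos_pos)
    then show ?thesis by (simp add: H_def exp_minus field_simps)
  qed
  have H'_le: "\<bar>H' \<sigma>\<bar> \<le> exp (- \<bar>\<sigma>\<bar>)" for \<sigma>
    using H'_H H_le by (rule order_trans)
  \<comment> \<open>The first bound serves the levels above the kernel scale, the second gives the
    exponential decay below it.\<close>
  have G_le: "\<bar>G \<sigma>\<bar> \<le> 1" "\<bar>G \<sigma>\<bar> \<le> exp (2 * \<sigma>)" for \<sigma>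
  proof -
    have "\<bar>G \<sigma>\<bar> = \<bar>H' \<sigma>\<bar> * exp \<sigma>" by (simp add: G_def abs_mult)
    also have "\<dots> \<le> exp (- \<bar>\<sigma>\<bar>) * exp \<sigma>" by (rule mult_right_mono[OF H'_le]) simp
    also have "\<dots> = exp (\<sigma> - \<bar>\<sigma>\<bar>)" by (simp add: exp_add[symmetric])
    finally have *: "\<bar>G \<sigma>\<bar> \<le> exp (\<sigma> - \<bar>\<sigma>\<bar>)" .
    show "\<bar>G \<sigma>\<bar> \<le> 1" by (rule order_trans[OF *]) simp
    show "\<bar>G \<sigma>\<bar> \<le> exp (2 * \<sigma>)" by (rule order_trans[OF *]) (simp add: abs_if)
  qed
  have H_top: "(H \<longlongrightarrow> 0) at_top" unfolding H_def[abs_def] by real_asymp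
  have G_top: "(G \<longlongrightarrow> 1) at_top" unfolding G_def[abs_def] H'_def by real_asymp
  have G_bot: "(G \<longlongrightarrow> 0) at_bot" unfolding G_def[abs_def] H'_def by real_asymp
  have g_int: "integrable lborel (\<lambda>t. - (L * H' (L + L * t)))" if L: "0 < L" for L
  proof -
    have "integrable lborel (\<lambda>t. exp (- \<bar>L + L * t\<bar>))"
      using L by (intro lborel_integrable_real_affine[OF integrable_exp_neg_abs]) simp
    then have "integrable lborel (\<lambda>t. H' (L + L * t))"
      by (rule Bochner_Integration.integrable_bound) (auto simp: H'_le)
    then show ?thesis by simp
  qed
  \<comment> \<open>The right side is \<open>H (L + ln w)\<close>. In the variable \<open>t\<close>
    the event \<open>w < exp (L * t)\<close> is the half line above \<open>ln w / L\<close>, and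
    \<open>- (L * H' (L + L * t))\<close> integrates to \<open>H\<close> at its left end.\<close>
  have inner: "(\<integral>t. (if w < exp (L * t) then - (L * H' (L + L * t)) else 0) \<partial>lborel) =
      exp (- L) * profile 1 (exp (- L)) w" if w: "0 < w" and L: "0 < L" for w L
  proof -
    have eq: "(if w < exp (L * t) then - (L * H' (L + L * t)) else 0) =
        - (indicator {ln w / L<..} t * (L * H' (L + L * t)))" for t
    proof -
      have "w < exp (L * t) \<longleftrightarrow> ln w / L < t"
      proof -
        have "w < exp (L * t) \<longleftrightarrow> exp (ln w) < exp (L * t)" using w by simp
        also have "\<dots> \<longleftrightarrow> ln w < t * L" by (simp only: exp_less_cancel_iff mult.commute)
        also have "\<dots> \<longleftrightarrow> ln w / L < t" by (rule pos_divide_less_eq[OF L, symmetric])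
        finally show ?thesis .
      qed
      then show ?thesis by (simp add: indicator_def)
    qed
    have "integrable lborel (\<lambda>t. indicator {ln w / L<..} t * (L * H' (L + L * t)))"
    proof (rule Bochner_Integration.integrable_bound[OF g_int[OF L]])
      show "AE t in lborel. norm (indicator {ln w / L<..} t * (L * H' (L + L * t))) \<le> norm (- (L * H' (L + L * t)))"
        by (intro AE_I2) (simp add: indicator_def)
    qed simp
    then have "(\<integral>t. indicator {ln w / L<..} t * (L * H' (L + L * t)) \<partial>lborel) = 0 - H (L + L * (ln w / L))"
    proof (intro FTC_Ioi[where F = "\<lambda>t. H (L + L * t)"])
      show "((\<lambda>t. H (L + L * t)) has_real_derivative L * H' (L + L * t)) (at t)" for t
        by (rule DERIV_cong[OF DERIV_chain2[OF H_deriv]]) (auto intro!: derivative_eq_intros)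
      show "isCont (\<lambda>t. L * H' (L + L * t)) t" for t
        by (rule isCont_mult[OF continuous_const isCont_o2[OF _ H'_cont]]) (intro continuous_intros)
      show "isCont (\<lambda>t. H (L + L * t)) (ln w / L)"
        by (rule isCont_o2[OF _ DERIV_isCont[OF H_deriv]]) (intro continuous_intros)
      have "filterlim (\<lambda>t. L + L * t) at_top at_top" using L by real_asymp
      then show "((\<lambda>t. H (L + L * t)) \<longlongrightarrow> 0) at_top" by (rule filterlim_compose[OF H_top])
    qed
    also have "L + L * (ln w / L) = L + ln w" using L by simp
    also have "H (L + ln w) = exp (- L) * profile 1 (exp (- L)) w"
    proof -
      have e: "exp (L + ln w) = exp L * w" "exp (- (L + ln w)) = 1 / (exp L * w)"
        using w by (simp_all only: exp_minus exp_add exp_ln inverse_eq_divide)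
      have "0 < w\<^sup>2 + (1 / exp L)\<^sup>2" using w by (simp add: add_pos_nonneg)
      then have "profile 1 (exp (- L)) w = w / (w\<^sup>2 + (1 / exp L)\<^sup>2)"
        by (simp add: profile_def exp_minus inverse_eq_divide)
      moreover have "1 / (E * w + 1 / (E * w)) = 1 / E * (w / (w\<^sup>2 + (1 / E)\<^sup>2))" if "0 < E" for E
      proof -
        have "E * w + 1 / (E * w) = E * (w\<^sup>2 + (1 / E)\<^sup>2) / w"
          using that w by (simp add: field_simps power2_eq_square)
        then show ?thesis by simp
      qed
      ultimately show ?thesis unfolding H_def e by (simp add: exp_minus inverse_eq_divide)
    qed
    finally show ?thesis unfolding eq by simp
  qed
  have expectation_eq: "(\<integral>w. profile 1 (exp (- L)) w \<partial>\<nu>) / L =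
      (\<integral>t. G (L + L * t) * (measure \<nu> {..<exp (L * t)} / exp (L * t)) \<partial>lborel)" if L: "0 < L" for L
  proof -
    have "(\<integral>w. exp (- L) * profile 1 (exp (- L)) w \<partial>\<nu>) =
        (\<integral>w. (\<integral>t. (if w < exp (L * t) then - (L * H' (L + L * t)) else 0) \<partial>lborel) \<partial>\<nu>)"
    proof (rule integral_cong_AE)
      show "AE w in \<nu>. exp (- L) * profile 1 (exp (- L)) w =
          (\<integral>t. (if w < exp (L * t) then - (L * H' (L + L * t)) else 0) \<partial>lborel)"
        using pos by eventually_elim (simp only: inner L)
    qed measurable
    also have "\<dots> = (\<integral>t. - (L * H' (L + L * t)) * measure \<nu> {..<exp (L * t)} \<partial>lborel)"
      by (rule layer_cake[OF g_int[OF L]]) measurable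
    finally have "exp (- L) * (\<integral>w. profile 1 (exp (- L)) w \<partial>\<nu>) =
        (\<integral>t. - (L * H' (L + L * t)) * measure \<nu> {..<exp (L * t)} \<partial>lborel)" by simp
    then have "(\<integral>w. profile 1 (exp (- L)) w \<partial>\<nu>) / L =
        exp L / L * (\<integral>t. - (L * H' (L + L * t)) * measure \<nu> {..<exp (L * t)} \<partial>lborel)"
      by (simp add: exp_minus field_simps)
    also have "\<dots> = (\<integral>t. exp L / L * (- (L * H' (L + L * t)) * measure \<nu> {..<exp (L * t)}) \<partial>lborel)"
      by (rule integral_mult_right_zero[symmetric])
    also have "\<dots> = (\<integral>t. G (L + L * t) * (measure \<nu> {..<exp (L * t)} / exp (L * t)) \<partial>lborel)"
      using L by (intro Bochner_Integration.integral_cong refl) (simp add: G_def exp_add)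
    finally show ?thesis .
  qed
  have "((\<lambda>L. \<integral>t. G (L + L * t) * (measure \<nu> {..<exp (L * t)} / exp (L * t)) \<partial>lborel) \<longlongrightarrow>
      (\<integral>t. f0 * indicator {-1<..<0::real} t \<partial>lborel)) at_top"
  proof (rule integral_dominated_convergence_at_top)
    show "integrable lborel (\<lambda>t::real. (1 + C * exp 1) * exp (- \<bar>t\<bar>))"
      by (intro integrable_mult_right integrable_exp_neg_abs)
    show "AE t in lborel. ((\<lambda>L. G (L + L * t) * (measure \<nu> {..<exp (L * t)} / exp (L * t))) \<longlongrightarrow>
        f0 * indicator {-1<..<0::real} t) at_top"
      using AE_lborel_singleton[of 0] AE_lborel_singleton[of "-1"]
    proof eventually_elim
      case (elim t)
      have bnd: "\<bar>measure \<nu> {..<exp (L * t)} / exp (L * t)\<bar> \<le> C" for L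
        using F_le[of "exp (L * t)"] by (simp add: pos_divide_le_eq)
      \<comment> \<open>For \<open>t < -1\<close> the level lies below the kernel scale and
        \<open>G\<close> tends to 0; in the middle \<open>G\<close> tends to 1 and the quotient to
        the slope \<open>f0\<close>; for \<open>t > 0\<close> the distribution function is at most 1
        and is divided by \<open>exp (L * t)\<close>.\<close>
      consider "t < -1" | "-1 < t" "t < 0" | "0 < t" using elim by linarith
      then show ?case
      proof cases
        case 1
        then have "filterlim (\<lambda>L. L + L * t) at_bot at_top"
        proof -
          have "filterlim (\<lambda>L. (1 + t) * L) at_bot at_top"
            by (rule filterlim_tendsto_neg_mult_at_bot[OF tendsto_const _ filterlim_ident]) (use 1 in simp)
          then show ?thesis by (simp add: algebra_simps)
        qed
        from filterlim_compose[OF G_bot this]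
        have "((\<lambda>L. G (L + L * t) * (measure \<nu> {..<exp (L * t)} / exp (L * t))) \<longlongrightarrow> 0) at_top"
          by (rule lim_null_mult_right_bounded[where B = C])
             (intro always_eventually allI, simp only: real_norm_def bnd)
        then show ?thesis using 1 by simp
      next
        case 2
        have "filterlim (\<lambda>L. L * (1 + t)) at_top at_top" using 2 by real_asymp
        then have "filterlim (\<lambda>L. L + L * t) at_top at_top" by (simp add: algebra_simps)
        from filterlim_compose[OF G_top this]
        have "((\<lambda>L. G (L + L * t)) \<longlongrightarrow> 1) at_top" .
        moreover have "filterlim (\<lambda>L. exp (L * t)) (at_right 0) at_top" using 2 by real_asymp
        from filterlim_compose[OF F_slope this]
        have "((\<lambda>L. measure \<nu> {..<exp (L * t)} / exp (L * t)) \<longlongrightarrow> f0) at_top" .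
        ultimately have "((\<lambda>L. G (L + L * t) * (measure \<nu> {..<exp (L * t)} / exp (L * t))) \<longlongrightarrow> 1 * f0) at_top"
          by (rule tendsto_mult)
        then show ?thesis using 2 by simp
      next
        case 3
        have "((\<lambda>L. exp (- (L * t))) \<longlongrightarrow> 0) at_top" using 3 by real_asymp
        moreover have "\<bar>G (L + L * t) * measure \<nu> {..<exp (L * t)}\<bar> \<le> 1" for L
          using G_le(1)[of "L + L * t"] by (simp add: abs_mult mult_le_one)
        ultimately have "((\<lambda>L. exp (- (L * t)) * (G (L + L * t) * measure \<nu> {..<exp (L * t)})) \<longlongrightarrow> 0) at_top"
          by (intro lim_null_mult_right_bounded[where B = 1]) simp_all
        then show ?thesis using 3 by (simp add: exp_minus field_simps)
      qed
    qed
    show "\<forall>\<^sub>F L in at_top. AE t in lborel. norm (G (L + L * t) * (measure \<nu> {..<exp (L * t)} / exp (L * t)))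
        \<le> (1 + C * exp 1) * exp (- \<bar>t\<bar>)"
      using eventually_ge_at_top[of 1]
    proof (eventually_elim, intro AE_I2)
      fix L t :: real assume L: "1 \<le> L"
      define k where "k = measure \<nu> {..<exp (L * t)} / exp (L * t)"
      \<comment> \<open>The bound by \<open>C\<close> is used for \<open>t \<le> 0\<close>, the one
        by \<open>exp (- (L * t))\<close> for \<open>t > 0\<close>. Below \<open>-1\<close> the
        decay of \<open>G\<close> gives \<open>exp (2 * (L + L * t)) \<le> exp (1 + t)\<close>
        because \<open>L \<ge> 1\<close>, and on \<open>-1 \<le> t\<close> the bound
        \<open>\<bar>G\<bar> \<le> 1\<close> is enough.\<close>
      have k: "0 \<le> k" "k \<le> C" "k \<le> exp (- (L * t))"
        using F_le[of "exp (L * t)"] by (simp_all add: k_def pos_divide_le_eq exp_minus field_simps)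
      have "\<bar>G (L + L * t)\<bar> * k \<le> (1 + C * exp 1) * exp (- \<bar>t\<bar>)"
      proof (cases "0 < t")
        case True
        have "\<bar>G (L + L * t)\<bar> * k \<le> 1 * exp (- (L * t))"
          using k G_le(1) by (intro mult_mono) auto
        also have "\<dots> \<le> exp (- \<bar>t\<bar>)" using True L by simp
        also have "\<dots> \<le> (1 + C * exp 1) * exp (- \<bar>t\<bar>)" using C_nonneg by (simp add: distrib_right)
        finally show ?thesis .
      next
        case False
        have "\<bar>G (L + L * t)\<bar> \<le> exp (1 + t)"
        proof (cases "t < -1")
          case True
          have "2 * (L + L * t) \<le> 1 + t"
          proof -
            have "(2 * L - 1) * (1 + t) \<le> 0" using True L by (intro mult_nonneg_nonpos) auto
            then show ?thesis by (simp add: algebra_simps)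
          qed
          then have "exp (2 * (L + L * t)) \<le> exp (1 + t)" by simp
          then show ?thesis using G_le(2) order_trans by blast
        next
          case False
          then have "1 \<le> exp (1 + t)" by simp
          then show ?thesis using G_le(1) order_trans by blast
        qed
        then have "\<bar>G (L + L * t)\<bar> * k \<le> exp (1 + t) * C" using k by (intro mult_mono) auto
        also have "\<dots> = C * exp 1 * exp (- \<bar>t\<bar>)" using False by (simp add: exp_add)
        also have "\<dots> \<le> (1 + C * exp 1) * exp (- \<bar>t\<bar>)" by (simp add: distrib_right)
        finally show ?thesis .
      qed
      then show "norm (G (L + L * t) * (measure \<nu> {..<exp (L * t)} / exp (L * t))) \<le> (1 + C * exp 1) * exp (- \<bar>t\<bar>)"
        using k(1) unfolding k_def by (simp add: abs_mult)
    qed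
    show "(\<lambda>t. G (L + L * t) * (measure \<nu> {..<exp (L * t)} / exp (L * t))) \<in> borel_measurable lborel" for L
      unfolding G_def by measurable
  qed simp
  moreover have "\<forall>\<^sub>F L in at_top. (\<integral>t. G (L + L * t) * (measure \<nu> {..<exp (L * t)} / exp (L * t)) \<partial>lborel) =
      (\<integral>w. profile 1 (exp (- L)) w \<partial>\<nu>) / L"
    using eventually_gt_at_top[of 0] by eventually_elim (rule expectation_eq[symmetric])
  ultimately have "((\<lambda>L. (\<integral>w. profile 1 (exp (- L)) w \<partial>\<nu>) / L) \<longlongrightarrow>
      (\<integral>t. f0 * indicator {-1<..<0::real} t \<partial>lborel)) at_top"
    by (rule Lim_transform_eventually)
  also have "(\<integral>t. f0 * indicator {-1<..<0::real} t \<partial>lborel) = f0"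
    by (subst integral_mult_right_zero) simp
  finally show ?thesis .
qed

end

text \<open>The scaled profile is \<open>w\<close> times a power of
  \<open>R\<^sup>2 / (w\<^sup>2 + R\<^sup>2)\<close>, a factor in the unit interval tending to 1.
  Thus \<open>w\<close> is at once limit and majorant, and a finite mean is enough.\<close>

theorem (in real_distribution) profile_expectation_large_scale:
  assumes n: "1 \<le> n" and pos: "AE w in M. 0 < w" and int: "integrable M (\<lambda>w. w)"
  shows "((\<lambda>R. R powr (n + 1) * (\<integral>w. profile n R w \<partial>M)) \<longlongrightarrow> (\<integral>w. w \<partial>M)) at_top"
proof -
  have eq: "R powr (n + 1) * profile n R w = w * (R\<^sup>2 / (w\<^sup>2 + R\<^sup>2)) powr ((n + 1) / 2)" if "0 < R" for R w
  proof -
    have "R\<^sup>2 = R powr 2" using that by (simp add: powr_numeral)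
    then have "R\<^sup>2 powr ((n + 1) / 2) = R powr (2 * ((n + 1) / 2))" by (simp only: powr_powr)
    also have "2 * ((n + 1) / 2) = n + 1" by (simp add: field_simps)
    finally have "R powr (n + 1) = R\<^sup>2 powr ((n + 1) / 2)" ..
    then show ?thesis by (simp only: profile_def powr_divide) simp
  qed
  have "((\<lambda>R. \<integral>w. R powr (n + 1) * profile n R w \<partial>M) \<longlongrightarrow> (\<integral>w. w \<partial>M)) at_top"
  proof (rule integral_dominated_convergence_at_top[OF _ _ int])
    show "AE w in M. ((\<lambda>R. R powr (n + 1) * profile n R w) \<longlongrightarrow> w) at_top"
    proof (rule AE_I2)
      fix w :: real
      have "((\<lambda>R::real. R\<^sup>2 / (w\<^sup>2 + R\<^sup>2)) \<longlongrightarrow> 1) at_top" by real_asymp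
      then have "((\<lambda>R. w * (R\<^sup>2 / (w\<^sup>2 + R\<^sup>2)) powr ((n + 1) / 2)) \<longlongrightarrow> w * 1 powr ((n + 1) / 2)) at_top"
        by (intro tendsto_intros) auto
      moreover have "\<forall>\<^sub>F R in at_top. w * (R\<^sup>2 / (w\<^sup>2 + R\<^sup>2)) powr ((n + 1) / 2) = R powr (n + 1) * profile n R w"
        using eventually_gt_at_top[of 0] by eventually_elim (rule eq[symmetric])
      ultimately show "((\<lambda>R. R powr (n + 1) * profile n R w) \<longlongrightarrow> w) at_top"
        using Lim_transform_eventually by force
    qed
    show "\<forall>\<^sub>F R in at_top. AE w in M. norm (R powr (n + 1) * profile n R w) \<le> w"
      using eventually_gt_at_top[of 0]
    proof eventually_elim
      case (elim R)
      show ?case using pos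
      proof eventually_elim
        case w: (elim w)
        have "R\<^sup>2 / (w\<^sup>2 + R\<^sup>2) \<le> 1" using elim by (simp add: divide_le_eq_1 add_nonneg_pos)
        then have "(R\<^sup>2 / (w\<^sup>2 + R\<^sup>2)) powr ((n + 1) / 2) \<le> 1" using n by (intro powr_le1) auto
        then have "w * (R\<^sup>2 / (w\<^sup>2 + R\<^sup>2)) powr ((n + 1) / 2) \<le> w" using w by (simp add: mult_left_le)
        moreover have "0 \<le> w * (R\<^sup>2 / (w\<^sup>2 + R\<^sup>2)) powr ((n + 1) / 2)" using w by simp
        ultimately show ?case unfolding eq[OF elim] by simp
      qed
    qed
  qed measurable
  then show ?thesis by simp
qed

section \<open>The inverse of a stable subordinator\<close>

context stable_law
begin

text \<open>The Mittag-Leffler law: the inverse subordinator at time 1 is distributed as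
  \<open>S 1\<close> to the power \<open>- b\<close>.\<close>

definition inverse_law :: "real measure" where
  "inverse_law = distr \<mu> borel (\<lambda>x. x powr (- b))"

lemma inverse_law_lessThan:
  assumes y: "0 < y"
  shows "measure inverse_law {..<y} = measure \<mu> {y powr (- 1 / b)<..}"
proof -
  have "measure inverse_law {..<y} = measure \<mu> {x \<in> space \<mu>. x powr (- b) < y}"
    unfolding inverse_law_def by (subst measure_distr) (auto intro!: arg_cong[where f = "measure \<mu>"])
  also have "\<dots> = measure \<mu> {y powr (- 1 / b)<..}"
  proof (rule measure_eq_AE)
    show "AE x in \<mu>. x \<in> {x \<in> space \<mu>. x powr (- b) < y} \<longleftrightarrow> x \<in> {y powr (- 1 / b)<..}"
      using pos
    proof eventually_elim
      case (elim x)
      have "(y powr (- 1 / b)) powr (- b) = y" using b y by (simp add: powr_powr)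
      then have "x powr (- b) < y \<longleftrightarrow> x powr (- b) < (y powr (- 1 / b)) powr (- b)" by simp
      also have "\<dots> \<longleftrightarrow> y powr (- 1 / b) < x"
        using b y elim powr_less_mono2_neg[of "- b" x "y powr (- 1 / b)"]
          powr_mono2'[of "- b" x "y powr (- 1 / b)"]
          powr_less_mono2_neg[of "- b" "y powr (- 1 / b)" x]
        by (cases x "y powr (- 1 / b)" rule: linorder_cases) auto
      finally show ?case by simp
    qed
  qed auto
  finally show ?thesis .
qed

text \<open>The correspondence \<open>R = y powr (- 1 / b)\<close>, for which
  \<open>R powr b = 1 / y\<close>, turns the tail bound and the tail asymptotics of
  \<open>\<mu>\<close> into the two hypotheses on the distribution function near 0.\<close>

lemma linear_at_0_inverse_law:
  "linear_at_0 inverse_law (1 / (1 - exp (- 1))) (1 / Gamma (1 - b))"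
proof -
  interpret I: real_distribution inverse_law
    unfolding inverse_law_def by (rule real_distribution_distr) simp
  show ?thesis
  proof
    show "AE w in inverse_law. 0 < w"
      unfolding inverse_law_def by (subst AE_distr_iff) (use pos in \<open>auto elim!: eventually_mono\<close>)
    show "measure inverse_law {..<y} \<le> 1 / (1 - exp (- 1)) * y" if y: "0 < y" for y
      using tail_le[of "y powr (- 1 / b)"] y b by (simp add: inverse_law_lessThan powr_powr)
    have "filterlim (\<lambda>y::real. y powr (- 1 / b)) at_top (at_right 0)"
      using b by real_asymp
    from filterlim_compose[OF tail_asymptotics this]
    have "((\<lambda>y. (y powr (- 1 / b)) powr b * measure \<mu> {y powr (- 1 / b)<..}) \<longlongrightarrow> 1 / Gamma (1 - b)) (at_right 0)" .
    moreover have "\<forall>\<^sub>F y in at_right 0. (y powr (- 1 / b)) powr b * measure \<mu> {y powr (- 1 / b)<..} =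
        measure inverse_law {..<y} / y"
      using eventually_at_right_less[of 0]
    proof eventually_elim
      case (elim y)
      have "(y powr (- 1 / b)) powr b = y powr (- 1)" using b by (simp add: powr_powr)
      also have "\<dots> = 1 / y" using elim by (simp add: powr_minus divide_inverse)
      finally show ?case using elim by (simp add: inverse_law_lessThan)
    qed
    ultimately show "((\<lambda>y. measure inverse_law {..<y} / y) \<longlongrightarrow> 1 / Gamma (1 - b)) (at_right 0)"
      by (rule Lim_transform_eventually)
  qed
qed

lemma inverse_law_mean: "has_bochner_integral inverse_law (\<lambda>w. w) (1 / (b * Gamma b))"
proof -
  have "has_bochner_integral \<mu> (\<lambda>x. x powr (- b)) (1 / (b * Gamma b))"
    using neg_moment[OF b(1)] b by simp
  then show ?thesis
    unfolding inverse_law_def by (intro has_bochner_integral_distr) auto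
qed

end

text \<open>Open half lines are compared with closed ones because an infimum over passage times is
  only controlled up to this difference; letting \<open>a\<close> decrease to the point removes it
  by right-continuity. Levels \<open>a > 0\<close> reach 0 in the same way, and the negative axis is
  null.\<close>

lemma cdf_eqI_nonneg:
  fixes K1 K2 :: "real measure"
  assumes K: "real_distribution K1" "real_distribution K2"
    and nonneg: "AE x in K1. 0 \<le> x" "AE x in K2. 0 \<le> x"
    and le: "\<And>a. 0 < a \<Longrightarrow> measure K1 {..<a} \<le> measure K2 {..a}"
      "\<And>a. 0 < a \<Longrightarrow> measure K2 {..<a} \<le> measure K1 {..a}"
  shows "K1 = K2"
proof (rule cdf_unique[OF K])
  have one_sided: "cdf L1 x \<le> cdf L2 x"
    if "real_distribution L1" "real_distribution L2" "AE x in L1. 0 \<le> x"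
      "\<And>a. 0 < a \<Longrightarrow> measure L1 {..<a} \<le> measure L2 {..a}" for L1 L2 x
  proof -
    interpret L1: real_distribution L1 by fact
    interpret L2: real_distribution L2 by fact
    show ?thesis
    proof (cases "0 \<le> x")
      case True
      have "(cdf L2 \<longlongrightarrow> cdf L2 x) (at_right x)"
        using L2.cdf_is_right_cont by (simp add: continuous_within)
      moreover have "\<forall>\<^sub>F a in at_right x. cdf L1 x \<le> cdf L2 a"
        using eventually_at_right_less[of x]
      proof eventually_elim
        case (elim a)
        have "cdf L1 x \<le> measure L1 {..<a}"
          unfolding cdf_def by (rule L1.finite_measure_mono) (use elim in auto)
        also have "\<dots> \<le> cdf L2 a" unfolding cdf_def using that(4)[of a] True elim by simp
        finally show ?case .
      qed
      ultimately show ?thesis by (rule tendsto_lowerbound) simp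
    next
      case False
      have "AE y in L1. y \<notin> {..x}" using that(3) by eventually_elim (use False in auto)
      then have "emeasure L1 {..x} = 0" by (subst (asm) AE_iff_measurable[of "{..x}"]) auto
      then have "cdf L1 x = 0" by (simp add: cdf_def measure_def)
      then show ?thesis by (simp add: L2.cdf_nonneg)
    qed
  qed
  show "cdf K1 = cdf K2"
  proof (rule ext, rule antisym)
    fix x
    show "cdf K1 x \<le> cdf K2 x" by (rule one_sided[OF K nonneg(1) le(1)])
    show "cdf K2 x \<le> cdf K1 x" by (rule one_sided[OF K(2,1) nonneg(2) le(2)])
  qed
qed

section \<open>Paths and self-similarity of the subordinator; the law of its inverse\<close>

context stable_subordinator
begin

lemma S_measurable: "0 \<le> t \<Longrightarrow> S t \<in> borel_measurable M"
  using random_variable by simp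

lemma AE_nonneg:
  assumes t: "0 \<le> t"
  shows "AE \<omega> in M. 0 \<le> S t \<omega>"
  using start nondecreasing
  by eventually_elim (metis t atLeast_iff mono_onD order_refl)

text \<open>The probability of \<open>S t = 0\<close> is at most the Laplace transform at every
  \<open>r > 0\<close>, which tends to 0 as \<open>r\<close> grows.\<close>

lemma AE_pos:
  assumes t: "0 < t"
  shows "AE \<omega> in M. 0 < S t \<omega>"
proof -
  note [measurable] = S_measurable[OF less_imp_le[OF t]]
  let ?Z = "{\<omega> \<in> space M. S t \<omega> = 0}"
  have Z: "?Z \<in> events" by measurable
  have bound: "prob ?Z \<le> exp (- t * r powr \<beta>)" if r: "0 < r" for r
  proof -
    have "prob ?Z = expectation (indicator ?Z)" using Z by simp
    also have "\<dots> \<le> expectation (\<lambda>\<omega>. exp (- r * S t \<omega>))"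
    proof (rule integral_mono_AE)
      show "integrable M (\<lambda>\<omega>. exp (- r * S t \<omega>))"
        by (rule integrable_const_bound[of _ 1])
           (use AE_nonneg[of t] t r in \<open>auto elim!: eventually_mono\<close>)
      show "integrable M (indicator ?Z :: _ \<Rightarrow> real)" using Z by (simp add: less_top[symmetric])
    qed (auto simp: indicator_def)
    finally show ?thesis using laplace[of t r] t r by simp
  qed
  have "((\<lambda>r. exp (- t * r powr \<beta>)) \<longlongrightarrow> 0) at_top" using t beta by real_asymp
  then have "prob ?Z \<le> 0"
    by (rule tendsto_lowerbound[OF _ eventually_mono[OF eventually_gt_at_top[of 0]]]) (use bound in auto)
  then have "prob ?Z = 0" by (simp add: measure_le_0_iff)
  then have "AE \<omega> in M. \<omega> \<notin> ?Z" using Z by (simp add: prob_eq_0)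
  with AE_nonneg[of t] t AE_space show ?thesis
    by (auto elim!: eventually_elim2 eventually_rev_mp)
qed

definition law1 :: "real measure" where "law1 = distr M borel (S 1)"

lemma stable_law_law1: "stable_law law1 \<beta>"
proof -
  note [measurable] = S_measurable[of 1, simplified]
  interpret L: real_distribution law1 unfolding law1_def by (rule real_distribution_distr) simp
  show ?thesis
  proof
    show "AE x in law1. 0 < x" unfolding law1_def using AE_pos[of 1] by (subst AE_distr_iff) auto
    show "(\<integral>x. exp (- (r * x)) \<partial>law1) = exp (- (r powr \<beta>))" if "0 < r" for r
      unfolding law1_def using laplace[of 1 r] that by (subst integral_distr) auto
  qed (use beta in auto)
qed

sublocale L: stable_law law1 \<beta> by (rule stable_law_law1)

text \<open>Self-similarity is read off the exponent,
  \<open>t * r powr \<beta> = (r * t powr (1 / \<beta>)) powr \<beta>\<close>, and uniqueness of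
  transforms.\<close>

lemma law_scaling:
  assumes t: "0 < t"
  shows "distr M borel (S t) = distr law1 borel (\<lambda>x. t powr (1 / \<beta>) * x)"
proof (rule real_distribution_eqI_laplace)
  note [measurable] = S_measurable[OF less_imp_le[OF t]]
  have c: "0 < t powr (1 / \<beta>)" using t by simp
  show "real_distribution (distr M borel (S t))" by (rule real_distribution_distr) simp
  show "real_distribution (distr law1 borel (\<lambda>x. t powr (1 / \<beta>) * x))"
    by (rule L.real_distribution_distr) simp
  show "AE x in distr M borel (S t). 0 < x" using AE_pos[OF t] by (subst AE_distr_iff) auto
  show "AE x in distr law1 borel (\<lambda>x. t powr (1 / \<beta>) * x). 0 < x"
    using L.pos c by (subst AE_distr_iff) (auto elim!: eventually_mono)
  fix r :: real assume r: "0 < r"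
  have "(\<integral>x. exp (- (r * x)) \<partial>distr M borel (S t)) = exp (- (t * r powr \<beta>))"
    using laplace[of t r] t r by (subst integral_distr) auto
  also have "t * r powr \<beta> = (r * t powr (1 / \<beta>)) powr \<beta>"
    using t r beta by (simp add: powr_mult powr_powr mult.commute)
  also have "exp (- ((r * t powr (1 / \<beta>)) powr \<beta>)) = (\<integral>x. exp (- ((r * t powr (1 / \<beta>)) * x)) \<partial>law1)"
    using L.laplace[of "r * t powr (1 / \<beta>)"] r c by simp
  also have "\<dots> = (\<integral>x. exp (- (r * x)) \<partial>distr law1 borel (\<lambda>x. t powr (1 / \<beta>) * x))"
    by (subst integral_distr) (auto simp: mult.assoc)
  finally show "(\<integral>x. exp (- (r * x)) \<partial>distr M borel (S t)) =
      (\<integral>x. exp (- (r * x)) \<partial>distr law1 borel (\<lambda>x. t powr (1 / \<beta>) * x))" .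
qed

text \<open>Markov's inequality for \<open>exp (- S m)\<close> at integer times: staying below
  \<open>t\<close> up to time \<open>m\<close> has probability at most \<open>exp (t - m)\<close>.
  It guarantees that the infimum defining the inverse is taken over a nonempty set.\<close>

lemma AE_unbounded: "AE \<omega> in M. \<exists>s\<ge>0. t < S s \<omega>"
proof -
  have [measurable]: "S (real m) \<in> borel_measurable M" for m by (rule S_measurable) simp
  let ?B = "{\<omega> \<in> space M. \<forall>m::nat. S (real m) \<omega> \<le> t}"
  have B: "?B \<in> events" by measurable
  have bound: "prob ?B \<le> exp (t - real m)" for m
  proof -
    have "exp (- t) * prob ?B = expectation (\<lambda>\<omega>. exp (- t) * indicator ?B \<omega>)" using B by simp
    also have "\<dots> \<le> expectation (\<lambda>\<omega>. exp (- 1 * S (real m) \<omega>))"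
    proof (rule integral_mono_AE)
      show "integrable M (\<lambda>\<omega>. exp (- 1 * S (real m) \<omega>))"
        by (rule integrable_const_bound[of _ 1])
           (use AE_nonneg[of "real m"] in \<open>auto elim!: eventually_mono\<close>)
      show "integrable M (\<lambda>\<omega>. exp (- t) * indicator ?B \<omega>)"
        using B by (intro integrable_mult_right integrable_real_indicator) (auto simp: less_top[symmetric])
    qed (auto simp: indicator_def)
    also have "\<dots> = exp (- real m)" using laplace[of "real m" 1] by simp
    finally show ?thesis by (simp add: exp_diff exp_minus field_simps)
  qed
  have "(\<lambda>m. exp (t - real m)) \<longlonglongrightarrow> 0" by real_asymp
  then have "prob ?B \<le> 0" by (rule tendsto_lowerbound[OF _ always_eventually]) (use bound in auto)
  then have "prob ?B = 0" by (simp add: measure_le_0_iff)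
  then have "AE \<omega> in M. \<omega> \<notin> ?B" using B by (simp add: prob_eq_0)
  with AE_space show ?thesis
  proof eventually_elim
    case (elim \<omega>)
    then obtain m :: nat where "t < S (real m) \<omega>" by (auto simp: not_le)
    then show ?case by (intro exI[of _ "real m"]) simp
  qed
qed

text \<open>By monotonicity the set of passage times is closed upwards, so it contains every point
  strictly above its infimum. The equivalence with rational times is what makes the sublevel sets
  countable unions.\<close>

lemma AE_inverse_process:
  "AE \<omega> in M. 0 \<le> inverse_process S t \<omega> \<and>
     (\<forall>a. 0 < a \<longrightarrow> inverse_process S t \<omega> < a \<longrightarrow> t < S a \<omega>) \<and>
     (\<forall>a. 0 < a \<longrightarrow> t < S a \<omega> \<longrightarrow> inverse_process S t \<omega> \<le> a) \<and>
     (\<forall>a. inverse_process S t \<omega> < a \<longleftrightarrow> (\<exists>q\<in>\<rat>. 0 \<le> q \<and> q < a \<and> t < S q \<omega>))"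
  using nondecreasing AE_unbounded[of t]
proof eventually_elim
  case (elim \<omega>)
  let ?A = "{s. 0 \<le> s \<and> t < S s \<omega>}"
  have mono: "S s \<omega> \<le> S s' \<omega>" if "0 \<le> s" "s \<le> s'" for s s'
    using mono_onD[OF elim(1), of s s'] that by simp
  have ne: "?A \<noteq> {}" using elim(2) by auto
  have bdd: "bdd_below ?A" by (rule bdd_belowI[of _ 0]) auto
  have less: "inverse_process S t \<omega> < a \<longleftrightarrow> (\<exists>s. 0 \<le> s \<and> s < a \<and> t < S s \<omega>)" for a
    unfolding inverse_process_def using cInf_less_iff[OF ne bdd, of a] by auto
  have "0 \<le> inverse_process S t \<omega>"
    unfolding inverse_process_def using ne by (intro cInf_greatest) auto
  moreover have "t < S a \<omega>" if "inverse_process S t \<omega> < a" for a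
    using that less[of a] mono by (meson less_imp_le less_le_trans)
  moreover have "inverse_process S t \<omega> \<le> a" if "0 < a" "t < S a \<omega>" for a
    unfolding inverse_process_def using that by (intro cInf_lower bdd) auto
  moreover have "(\<exists>s. 0 \<le> s \<and> s < a \<and> t < S s \<omega>) \<longleftrightarrow> (\<exists>q\<in>\<rat>. 0 \<le> q \<and> q < a \<and> t < S q \<omega>)" for a
  proof
    assume "\<exists>s. 0 \<le> s \<and> s < a \<and> t < S s \<omega>"
    then obtain s where s: "0 \<le> s" "s < a" "t < S s \<omega>" by auto
    obtain q where q: "q \<in> \<rat>" "s < q" "q < a" using Rats_dense_in_real[OF s(2)] by auto
    then show "\<exists>q\<in>\<rat>. 0 \<le> q \<and> q < a \<and> t < S q \<omega>"
      using s mono[of s q] by (intro bexI[of _ q]) auto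
  qed auto
  ultimately show ?case using less by simp
qed

text \<open>The sublevel set agrees with an event of \<open>M\<close> only off a null set that need
  not be measurable itself, hence the completion.\<close>

lemma inverse_process_measurable: "inverse_process S t \<in> borel_measurable (completion M)"
  unfolding borel_measurable_iff_less
proof
  fix a
  define B where "B = (\<Union>q\<in>{q \<in> \<rat>. 0 \<le> q \<and> q < a}. {\<omega> \<in> space M. t < S q \<omega>})"
  have "B \<in> sets M"
    unfolding B_def
  proof (rule sets.countable_UN'')
    show "countable {q \<in> \<rat>. 0 \<le> q \<and> q < a}"
      by (rule countable_subset[OF _ countable_rat]) auto
    show "{\<omega> \<in> space M. t < S q \<omega>} \<in> sets M" if "q \<in> {q \<in> \<rat>. 0 \<le> q \<and> q < a}" for q
    proof -
      have [measurable]: "S q \<in> borel_measurable M" using that by (intro S_measurable) simp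
      show ?thesis by measurable
    qed
  qed
  then have "B \<in> sets (completion M)" by (rule sets_completionI_sets)
  moreover have "AE \<omega> in M. \<omega> \<in> B \<longleftrightarrow> \<omega> \<in> {\<omega> \<in> space (completion M). inverse_process S t \<omega> < a}"
    using AE_inverse_process[of t] AE_space by eventually_elim (auto simp: B_def)
  ultimately show "{\<omega> \<in> space (completion M). inverse_process S t \<omega> < a} \<in> sets (completion M)"
    using completion.in_sets_AE[OF AE_completion] by blast
qed

text \<open>The event \<open>t < S a\<close> contains, almost surely,
  \<open>inverse_process S t < a\<close> and is contained in
  \<open>inverse_process S t \<le> a\<close>. Its probability is therefore squeezed exactly as the
  comparison lemma for nonnegative laws asks.\<close>

lemma inverse_process_law:
  assumes t: "0 < t"
  shows "distr (completion M) borel (inverse_process S t) = distr L.inverse_law borel (\<lambda>w. t powr \<beta> * w)"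
proof (rule cdf_eqI_nonneg)
  note [measurable] = inverse_process_measurable
  interpret C: prob_space "completion M" by (rule prob_space_completion)
  interpret I: linear_at_0 L.inverse_law "1 / (1 - exp (- 1))" "1 / Gamma (1 - \<beta>)"
    by (rule L.linear_at_0_inverse_law)
  let ?K1 = "distr (completion M) borel (inverse_process S t)"
  let ?K2 = "distr L.inverse_law borel (\<lambda>w. t powr \<beta> * w)"
  have c: "0 < t powr \<beta>" using t by simp
  show K: "real_distribution ?K1" "real_distribution ?K2"
    by (rule C.real_distribution_distr I.real_distribution_distr, measurable)+
  interpret K2: real_distribution ?K2 by (rule K)
  show "AE x in ?K1. 0 \<le> x"
    using AE_completion[OF AE_inverse_process[of t]] by (subst AE_distr_iff) (auto elim: eventually_mono)
  show "AE x in ?K2. 0 \<le> x"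
    using I.pos c by (subst AE_distr_iff) (auto elim!: eventually_mono)
  \<comment> \<open>By self-similarity \<open>t < S a\<close> has the probability of
    \<open>t < a powr (1 / \<beta>) * S 1\<close>, that is, of
    \<open>t powr \<beta> * S 1 powr (- \<beta>) < a\<close>.\<close>
  have K2_less: "measure ?K2 {..<a} = prob {\<omega> \<in> space M. t < S a \<omega>}" if a: "0 < a" for a
  proof -
    note [measurable] = S_measurable[OF less_imp_le[OF a]]
    have q: "a powr (1 / \<beta>) > 0" "0 < a / t powr \<beta>" using a c by simp_all
    have e: "(a / t powr \<beta>) powr (- 1 / \<beta>) = t / a powr (1 / \<beta>)"
    proof -
      have "(a / t powr \<beta>) powr (- 1 / \<beta>) = a powr (- (1 / \<beta>)) / (t powr \<beta>) powr (- (1 / \<beta>))"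
        by (simp add: powr_divide)
      also have "(t powr \<beta>) powr (- (1 / \<beta>)) = inverse t"
      proof -
        have "(t powr \<beta>) powr (- (1 / \<beta>)) = t powr (- 1)" using beta by (simp add: powr_powr)
        also have "\<dots> = inverse t" using t by (simp add: powr_minus)
        finally show ?thesis .
      qed
      finally show ?thesis by (simp add: powr_minus divide_inverse mult.commute)
    qed
    have "measure ?K2 {..<a} = measure L.inverse_law {..<a / t powr \<beta>}"
      using c by (subst measure_distr) (auto simp: field_simps intro!: arg_cong[where f = "measure L.inverse_law"])
    also have "\<dots> = measure law1 {t / a powr (1 / \<beta>)<..}"
      by (simp only: L.inverse_law_lessThan[OF q(2)] e)
    also have "\<dots> = measure (distr law1 borel (\<lambda>x. a powr (1 / \<beta>) * x)) {t<..}"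
      using q(1) by (subst measure_distr) (auto simp: field_simps intro!: arg_cong[where f = "measure law1"])
    also have "\<dots> = measure (distr M borel (S a)) {t<..}" by (simp only: law_scaling[OF a])
    also have "\<dots> = prob {\<omega> \<in> space M. t < S a \<omega>}"
      by (subst measure_distr) (auto intro!: arg_cong[where f = prob])
    finally show ?thesis .
  qed
  have K1: "measure ?K1 A = C.prob {\<omega> \<in> space M. inverse_process S t \<omega> \<in> A}" if "A \<in> sets borel" for A
    using that by (subst measure_distr) (auto intro!: arg_cong[where f = C.prob])
  have ev: "{\<omega> \<in> space M. inverse_process S t \<omega> \<in> A} \<in> C.events" if "A \<in> sets borel" for A
    using measurable_sets[OF inverse_process_measurable that, of t] by (simp add: vimage_def Int_def conj_commute)
  have evS: "{\<omega> \<in> space M. t < S a \<omega>} \<in> events" if "0 < a" for a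
  proof -
    note [measurable] = S_measurable[OF less_imp_le[OF that]]
    show ?thesis by measurable
  qed
  fix a :: real assume a: "0 < a"
  have Sa: "C.prob {\<omega> \<in> space M. t < S a \<omega>} = prob {\<omega> \<in> space M. t < S a \<omega>}"
    using evS[OF a] by (simp add: measure_completion)
  have "measure ?K1 {..<a} = C.prob {\<omega> \<in> space M. inverse_process S t \<omega> \<in> {..<a}}"
    by (rule K1) simp
  also have "\<dots> \<le> C.prob {\<omega> \<in> space M. t < S a \<omega>}"
  proof (rule C.finite_measure_mono_AE)
    show "AE \<omega> in completion M. \<omega> \<in> {\<omega> \<in> space M. inverse_process S t \<omega> \<in> {..<a}} \<longrightarrow>
        \<omega> \<in> {\<omega> \<in> space M. t < S a \<omega>}"
      using AE_completion[OF AE_inverse_process[of t]] by eventually_elim (use a in auto)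
  qed (rule sets_completionI_sets[OF evS[OF a]])
  also have "\<dots> = measure ?K2 {..<a}" by (simp only: Sa K2_less[OF a])
  also have "\<dots> \<le> measure ?K2 {..a}" by (rule K2.finite_measure_mono) auto
  finally show "measure ?K1 {..<a} \<le> measure ?K2 {..a}" .
  have "measure ?K2 {..<a} = C.prob {\<omega> \<in> space M. t < S a \<omega>}" by (simp only: Sa K2_less[OF a])
  also have "\<dots> \<le> C.prob {\<omega> \<in> space M. inverse_process S t \<omega> \<in> {..a}}"
  proof (rule C.finite_measure_mono_AE)
    show "AE \<omega> in completion M. \<omega> \<in> {\<omega> \<in> space M. t < S a \<omega>} \<longrightarrow>
        \<omega> \<in> {\<omega> \<in> space M. inverse_process S t \<omega> \<in> {..a}}"
      using AE_completion[OF AE_inverse_process[of t]] by eventually_elim (use a in auto)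
  qed (rule ev, simp)
  also have "\<dots> = measure ?K1 {..a}" by (rule K1[symmetric]) simp
  finally show "measure ?K2 {..<a} \<le> measure ?K1 {..a}" .
qed

end

section \<open>Asymptotics of the subordinate densities\<close>

definition cauchy_const :: "real \<Rightarrow> real" where
  "cauchy_const n = pi powr (- (n + 1) / 2) * Gamma ((n + 1) / 2)"

lemma cauchy_kernel_eq_profile:
  fixes x y :: "real ^ 'n"
  shows "cauchy_kernel s x y = cauchy_const (real CARD('n)) * profile (real CARD('n)) (norm (x - y)) s"
  by (simp add: cauchy_kernel_def cauchy_const_def profile_def)

text \<open>Homogeneity of the kernel moves the scale \<open>c\<close> of the random time into a
  prefactor and into the distance. It is used with \<open>c = t powr (1 / \<beta>)\<close> for the
  subordinator and \<open>c = t powr \<beta>\<close> for its inverse.\<close>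

lemma integral_cauchy_kernel_scaled:
  fixes x y :: "real ^ 'n" and N :: "real measure"
  assumes c: "0 < c" and N: "sets N = sets borel" and pos: "AE s in N. 0 < s"
  shows "(LINT s:{0<..}|distr N borel (\<lambda>s. c * s). cauchy_kernel s x y) =
    c powr (- real CARD('n)) * (cauchy_const (real CARD('n)) *
      (\<integral>s. profile (real CARD('n)) (norm (x - y) / c) s \<partial>N))"
proof -
  note [measurable_cong] = N
  let ?n = "real CARD('n)"
  let ?C = "cauchy_const ?n"
  have "(LINT s:{0<..}|distr N borel (\<lambda>s. c * s). cauchy_kernel s x y) =
      (\<integral>s. indicator {0<..} (c * s) * (?C * profile ?n (norm (x - y)) (c * s)) \<partial>N)"
    unfolding set_lebesgue_integral_def cauchy_kernel_eq_profile
    by (subst integral_distr) auto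
  also have "\<dots> = (\<integral>s. c powr (- ?n) * (?C * profile ?n (norm (x - y) / c) s) \<partial>N)"
  proof (rule integral_cong_AE)
    show "AE s in N. indicator {0<..} (c * s) * (?C * profile ?n (norm (x - y)) (c * s)) =
        c powr (- ?n) * (?C * profile ?n (norm (x - y) / c) s)"
      using pos
    proof eventually_elim
      case (elim s)
      have "profile ?n (norm (x - y)) (c * s) = c powr (- ?n) * profile ?n (norm (x - y) / c) s"
        using profile_scale[OF c, of ?n "norm (x - y) / c" s] c by simp
      then show ?case using c elim by simp
    qed
  qed measurable
  finally show ?thesis by simp
qed

text \<open>The common factor \<open>c t\<close> cancels, so the ratio is a function of
  \<open>A\<close> alone and a limit in one real variable suffices. \<open>E\<close> records which
  values \<open>A\<close> takes on \<open>D\<close>, so that a one-sided limit can be used.\<close>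

lemma asymp_equiv_along:
  fixes f g :: "real \<Rightarrow> 'b \<Rightarrow> 'b \<Rightarrow> real" and c \<phi> \<gamma> :: "real \<Rightarrow> real"
  assumes lim: "((\<lambda>a. \<phi> a / \<gamma> a) \<longlongrightarrow> 1) (inf F (principal E))"
    and E: "\<And>t x y. (t, x, y) \<in> D \<Longrightarrow> A t x y \<in> E"
    and c: "\<And>t x y. (t, x, y) \<in> D \<Longrightarrow> c t \<noteq> 0"
    and f: "\<And>t x y. (t, x, y) \<in> D \<Longrightarrow> f t x y = c t * \<phi> (A t x y)"
    and g: "\<And>t x y. (t, x, y) \<in> D \<Longrightarrow> g t x y = c t * \<gamma> (A t x y)"
  shows "(\<lambda>(t, x, y). f t x y) \<sim>[along A F D] (\<lambda>(t, x, y). g t x y)"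
proof (rule asymp_equivI')
  have ev: "\<forall>\<^sub>F (t, x, y) in along A F D. (t, x, y) \<in> D"
    unfolding along_def eventually_inf_principal by (rule always_eventually) auto
  have "filterlim (\<lambda>(t, x, y). A t x y) F (along A F D)"
    unfolding along_def by (rule filterlim_mono[OF filterlim_filtercomap order_refl inf_le1])
  moreover have "filterlim (\<lambda>(t, x, y). A t x y) (principal E) (along A F D)"
    unfolding filterlim_principal using ev by eventually_elim (use E in auto)
  ultimately have "filterlim (\<lambda>(t, x, y). A t x y) (inf F (principal E)) (along A F D)"
    by (simp add: filterlim_inf)
  from filterlim_compose[OF lim this]
  have "((\<lambda>(t, x, y). \<phi> (A t x y) / \<gamma> (A t x y)) \<longlongrightarrow> 1) (along A F D)"
    by (simp add: case_prod_unfold)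
  moreover have "\<forall>\<^sub>F p in along A F D. (case p of (t, x, y) \<Rightarrow> \<phi> (A t x y) / \<gamma> (A t x y)) =
      (case p of (t, x, y) \<Rightarrow> f t x y) / (case p of (t, x, y) \<Rightarrow> g t x y)"
    using ev
  proof eventually_elim
    case (elim p)
    obtain t x y where p: "p = (t, x, y)" by (cases p)
    show ?case using c[of t x y] f[of t x y] g[of t x y] elim by (auto simp: p)
  qed
  ultimately show "((\<lambda>p. (case p of (t, x, y) \<Rightarrow> f t x y) / (case p of (t, x, y) \<Rightarrow> g t x y)) \<longlongrightarrow> 1) (along A F D)"
    by (rule Lim_transform_eventually)
qed

section \<open>Gamma function identities and the constant of (a)\<close>

lemma mult_divide_inverse_swap:
  fixes u p e k :: real
  shows "u * (p * e) / k = u * e / (k * inverse p)"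
  by (simp add: divide_inverse)

lemma Gamma_real_nonzero: "0 < x \<Longrightarrow> Gamma (x :: real) \<noteq> 0"
  by (metis Gamma_real_pos less_irrefl)

lemma Gamma_legendre_duplication_real:
  fixes z :: real
  assumes z: "0 < z"
  shows "Gamma z * Gamma (z + 1 / 2) = 2 powr (1 - 2 * z) * sqrt pi * Gamma (2 * z)"
proof -
  have "complex_of_real z \<notin> \<int>\<^sub>\<le>\<^sub>0" "complex_of_real z + 1 / 2 \<notin> \<int>\<^sub>\<le>\<^sub>0"
    using z by (auto elim!: nonpos_Ints_cases simp: complex_eq_iff)
  from Gamma_legendre_duplication[OF this]
  have "complex_of_real (Gamma z * Gamma (z + 1 / 2)) =
      complex_of_real (exp ((1 - 2 * z) * ln 2) * sqrt pi * Gamma (2 * z))"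
    by (simp add: Gamma_complex_of_real[symmetric] exp_of_real[symmetric])
  then have "Gamma z * Gamma (z + 1 / 2) = exp ((1 - 2 * z) * ln 2) * sqrt pi * Gamma (2 * z)"
    by (simp only: of_real_eq_iff)
  then show ?thesis by (simp add: powr_def)
qed

text \<open>Legendre duplication at \<open>(1 - b) / 2\<close> exchanges
  \<open>Gamma ((1 - b) / 2) / Gamma (1 - b)\<close> for
  \<open>2 powr b * sqrt pi / Gamma (1 - b / 2)\<close>. The denominator
  \<open>Gamma ((n + 1) / 2)\<close> of the Beta function cancels against the Cauchy
  constant.\<close>

lemma stable_tail_constant:
  assumes b: "0 < b" "b < 1" and n: "1 \<le> n"
  shows "cauchy_const n * (b / Gamma (1 - b) * (Beta ((1 - b) / 2) ((n + b) / 2) / 2)) =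
    b * 2 powr (b - 1) * Gamma ((n + b) / 2) / (pi powr (n / 2) * Gamma (1 - b / 2))"
proof -
  have pos: "Gamma (1 - b) > 0" "Gamma (1 - b / 2) > 0" "Gamma ((n + 1) / 2) > 0" using b n by simp_all
  have z: "(1 - b) / 2 + 1 / 2 = 1 - b / 2" "1 - 2 * ((1 - b) / 2) = b" "2 * ((1 - b) / 2) = 1 - b"
    by (simp_all add: field_simps)
  have D: "Gamma ((1 - b) / 2) * Gamma (1 - b / 2) = 2 powr b * sqrt pi * Gamma (1 - b)"
    using Gamma_legendre_duplication_real[of "(1 - b) / 2"] b unfolding z by simp
  then have G: "Gamma ((1 - b) / 2) = 2 powr b * sqrt pi * Gamma (1 - b) / Gamma (1 - b / 2)"
    using pos by (simp add: field_simps)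
  have "pi powr (- (n + 1) / 2) = pi powr (- (n / 2) + - (1 / 2))" by (simp add: field_simps)
  also have "\<dots> = 1 / (pi powr (n / 2) * sqrt pi)"
  proof -
    have "pi powr (1 / 2) = sqrt pi" by (simp add: powr_half_sqrt)
    then have "pi powr (- (n / 2) + - (1 / 2)) = inverse (pi powr (n / 2)) * inverse (sqrt pi)"
      by (simp only: powr_add powr_minus)
    then show ?thesis by (simp only: inverse_eq_divide times_divide_times_eq mult_1)
  qed
  finally have P: "pi powr (- (n + 1) / 2) = 1 / (pi powr (n / 2) * sqrt pi)" .
  have s: "(1 - b) / 2 + (n + b) / 2 = (n + 1) / 2" by (simp add: field_simps)
  have t: "2 powr (b - 1) = 2 powr b / 2" by (simp add: powr_diff)
  have alg: "1 / (p * q) * g1 * (b / g2 * (u * q * g2 / g3 * h / g1 / 2)) = b * (u / 2) * h / (p * g3)"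
    if "q \<noteq> 0" "g1 \<noteq> 0" "g2 \<noteq> 0" for p q g1 g2 g3 u h :: real
    using that by (simp add: field_simps)
  show ?thesis
    unfolding cauchy_const_def Beta_def P G s t by (rule alg) (use pos in auto)
qed

section \<open>Densities and ratio limits in the single scaling variable\<close>

context stable_subordinator
begin

lemma density_S:
  fixes x y :: "real ^ 'n"
  assumes t: "0 < t"
  shows "subordinate_density M S t x y = t powr (- real CARD('n) / \<beta>) *
    (cauchy_const (real CARD('n)) * (\<integral>s. profile (real CARD('n)) (norm (x - y) * t powr (- 1 / \<beta>)) s \<partial>law1))"
proof -
  have c: "0 < t powr (1 / \<beta>)" using t by simp
  have "distr (completion M) borel (S t) = distr law1 borel (\<lambda>s. t powr (1 / \<beta>) * s)"
    using S_measurable[of t] law_scaling[OF t] t by (simp add: distr_completion)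
  moreover have "norm (x - y) / t powr (1 / \<beta>) = norm (x - y) * t powr (- 1 / \<beta>)"
    by (simp add: powr_minus divide_inverse)
  moreover have "(t powr (1 / \<beta>)) powr (- real CARD('n)) = t powr (- real CARD('n) / \<beta>)"
    by (simp add: powr_powr)
  ultimately show ?thesis
    unfolding subordinate_density_def
    using integral_cauchy_kernel_scaled[OF c _ L.pos, of x y] by simp
qed

lemma density_inverse:
  fixes x y :: "real ^ 'n"
  assumes t: "0 < t"
  shows "subordinate_density M (inverse_process S) t x y = t powr (- real CARD('n) * \<beta>) *
    (cauchy_const (real CARD('n)) * (\<integral>s. profile (real CARD('n)) (norm (x - y) * t powr (- \<beta>)) s \<partial>L.inverse_law))"
proof -
  interpret I: linear_at_0 L.inverse_law "1 / (1 - exp (- 1))" "1 / Gamma (1 - \<beta>)"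
    by (rule L.linear_at_0_inverse_law)
  have c: "0 < t powr \<beta>" using t by simp
  have "norm (x - y) / t powr \<beta> = norm (x - y) * t powr (- \<beta>)"
    by (simp add: powr_minus divide_inverse)
  moreover have "(t powr \<beta>) powr (- real CARD('n)) = t powr (- real CARD('n) * \<beta>)"
    by (simp add: powr_powr mult.commute)
  ultimately show ?thesis
    unfolding subordinate_density_def inverse_process_law[OF t]
    using integral_cauchy_kernel_scaled[OF c _ I.pos, of x y] by simp
qed

lemma ratio_a:
  assumes n: "1 \<le> n"
  shows "((\<lambda>a. cauchy_const n * (\<integral>s. profile n a s \<partial>law1) /
    (\<beta> * 2 powr (\<beta> - 1) * Gamma ((n + \<beta>) / 2) / (pi powr (n / 2) * Gamma (1 - \<beta> / 2)) * a powr (- n - \<beta>)))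
    \<longlongrightarrow> 1) at_top"
proof -
  define K where "K = \<beta> * 2 powr (\<beta> - 1) * Gamma ((n + \<beta>) / 2) / (pi powr (n / 2) * Gamma (1 - \<beta> / 2))"
  have K: "K \<noteq> 0"
    using beta n by (simp add: K_def Gamma_real_nonzero)
  have "((\<lambda>a. cauchy_const n * (a powr (n + \<beta>) * (\<integral>s. profile n a s \<partial>law1)) / K) \<longlongrightarrow> K / K) at_top"
    using tendsto_mult_left[OF L.profile_expectation_at_top[OF n], of "cauchy_const n"]
    unfolding stable_tail_constant[OF beta n] K_def[symmetric] by (rule tendsto_divide[OF _ tendsto_const K])
  moreover have "cauchy_const n * (a powr (n + \<beta>) * E) / K = cauchy_const n * E / (K * a powr (- n - \<beta>))" for a E
  proof -
    have "- n - \<beta> = - (n + \<beta>)" by simp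
    then show ?thesis by (simp only: powr_minus mult_divide_inverse_swap)
  qed
  ultimately show ?thesis using K by (simp add: K_def)
qed

lemma ratio_b:
  assumes n: "1 \<le> n"
  shows "((\<lambda>a. cauchy_const n * (\<integral>s. profile n a s \<partial>law1) /
    (Gamma ((n + 1) / 2) * Gamma (n / \<beta>) / (\<beta> * pi powr ((n + 1) / 2) * Gamma n))) \<longlongrightarrow> 1) (nhds 0)"
proof -
  define K where "K = Gamma ((n + 1) / 2) * Gamma (n / \<beta>) / (\<beta> * pi powr ((n + 1) / 2) * Gamma n)"
  have K: "K \<noteq> 0"
    using beta n by (simp add: K_def Gamma_real_nonzero)
  have e: "- (n + 1) / 2 = - ((n + 1) / 2)" by (rule minus_divide_left[symmetric])
  have "cauchy_const n * (Gamma (n / \<beta>) / (\<beta> * Gamma n)) = K"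
  proof -
    have "inverse p * u * (v / (k * w)) = u * v / (k * p * w)" for p u v k w :: real
      by (simp add: divide_inverse)
    then show ?thesis unfolding K_def cauchy_const_def e powr_minus .
  qed
  with tendsto_mult_left[OF L.profile_expectation_at_0[OF n], of "cauchy_const n"]
  have "((\<lambda>a. cauchy_const n * (\<integral>s. profile n a s \<partial>law1)) \<longlongrightarrow> K) (nhds 0)" by simp
  from tendsto_divide[OF this tendsto_const K] show ?thesis using K by (simp add: K_def)
qed

text \<open>Here \<open>a\<close> stands for \<open>norm (x - y) powr (- 1 / \<beta>) * t\<close>,
  while the profile sees the distance
  \<open>norm (x - y) * t powr (- \<beta>) = a powr (- \<beta>)\<close>; the scale of the limit
  theorem is \<open>R = a powr \<beta>\<close>.\<close>

lemma ratio_c: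
  assumes n: "1 < n"
  shows "((\<lambda>a. cauchy_const n * (\<integral>s. profile n (a powr (- \<beta>)) s \<partial>L.inverse_law) /
    (Gamma ((n - 1) / 2) / (2 * pi powr ((n + 1) / 2) * Gamma (1 - \<beta>)) * (a powr (- \<beta>)) powr (1 - n))) \<longlongrightarrow> 1) at_top"
proof -
  interpret I: linear_at_0 L.inverse_law "1 / (1 - exp (- 1))" "1 / Gamma (1 - \<beta>)"
    by (rule L.linear_at_0_inverse_law)
  define K where "K = Gamma ((n - 1) / 2) / (2 * pi powr ((n + 1) / 2) * Gamma (1 - \<beta>))"
  have K: "K \<noteq> 0"
    using beta n by (simp add: K_def Gamma_real_nonzero)
  have e: "- (n + 1) / 2 = - ((n + 1) / 2)" by (rule minus_divide_left[symmetric])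
  \<comment> \<open>The factor \<open>n - 1\<close> cancels the value \<open>1 / (n - 1)\<close> of
    the kernel integral and leaves the 2 in the denominator.\<close>
  have G: "Gamma ((n + 1) / 2) = (n - 1) / 2 * Gamma ((n - 1) / 2)"
  proof -
    have "(n - 1) / 2 \<notin> \<int>\<^sub>\<le>\<^sub>0" using nonpos_Ints_nonpos[of "(n - 1) / 2"] n by force
    moreover have E: "(n - 1) / 2 + 1 = (n + 1) / 2" by (simp add: field_simps)
    ultimately show ?thesis using Gamma_plus1[of "(n - 1) / 2"] unfolding E by blast
  qed
  have alg: "inverse p * (m / 2 * g) * (1 / h / m) = g / (2 * p * h)"
    if "p \<noteq> 0" "m \<noteq> 0" "h \<noteq> 0" for p m g h :: real
    using that by (simp add: field_simps)
  have C: "cauchy_const n * (1 / Gamma (1 - \<beta>) / (n - 1)) = K"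
    unfolding K_def cauchy_const_def e powr_minus G
    by (rule alg) (use n beta in \<open>simp_all add: Gamma_real_nonzero\<close>)
  have "filterlim (\<lambda>a::real. a powr \<beta>) at_top at_top" using beta by real_asymp
  from tendsto_mult_left[OF filterlim_compose[OF I.profile_expectation_small_scale[OF n] this], of "cauchy_const n"]
  have "((\<lambda>a. cauchy_const n * ((a powr \<beta>) powr (1 - n) *
      (\<integral>w. profile n (inverse (a powr \<beta>)) w \<partial>L.inverse_law))) \<longlongrightarrow> K) at_top"
    by (simp only: C)
  from tendsto_divide[OF this tendsto_const K]
  have "((\<lambda>a. cauchy_const n * ((a powr \<beta>) powr (1 - n) *
      (\<integral>w. profile n (inverse (a powr \<beta>)) w \<partial>L.inverse_law)) / K) \<longlongrightarrow> 1) at_top"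
    using K by simp
  moreover have "cauchy_const n * ((a powr \<beta>) powr (1 - n) * E) / K =
      cauchy_const n * E / (K * (a powr (- \<beta>)) powr (1 - n))" for a E
  proof -
    have "(a powr (- \<beta>)) powr (1 - n) = inverse ((a powr \<beta>) powr (1 - n))"
    proof -
      have "- \<beta> * (1 - n) = - (\<beta> * (1 - n))" by simp
      then show ?thesis by (simp only: powr_powr powr_minus[of a "\<beta> * (1 - n)"])
    qed
    then show ?thesis by (simp only: mult_divide_inverse_swap)
  qed
  ultimately show ?thesis unfolding K_def[symmetric] powr_minus[of _ \<beta>] by simp
qed

text \<open>The critical limit is taken along \<open>L = \<beta> * ln a\<close>, so that
  \<open>exp (- L) = a powr (- \<beta>)\<close>; this is where the factor \<beta> in front of the
  logarithm comes from.\<close>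

lemma ratio_c_1:
  "((\<lambda>a. cauchy_const 1 * (\<integral>s. profile 1 (a powr (- \<beta>)) s \<partial>L.inverse_law) /
    (\<beta> / (pi * Gamma (1 - \<beta>)) * ln a)) \<longlongrightarrow> 1) at_top"
proof -
  interpret I: linear_at_0 L.inverse_law "1 / (1 - exp (- 1))" "1 / Gamma (1 - \<beta>)"
    by (rule L.linear_at_0_inverse_law)
  have G: "Gamma (1 - \<beta>) \<noteq> 0" using beta by (simp add: Gamma_real_nonzero)
  have C: "cauchy_const 1 = 1 / pi"
  proof -
    have "- (1 + 1) / 2 = (- 1 :: real)" "(1 + 1) / 2 = (1 :: real)" by simp_all
    moreover have "pi powr (- 1) = 1 / pi" by (simp add: powr_minus_divide)
    ultimately show ?thesis by (simp only: cauchy_const_def Gamma_1 mult_1_right)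
  qed
  have "filterlim (\<lambda>a::real. \<beta> * ln a) at_top at_top" using beta by real_asymp
  from tendsto_mult_left[OF filterlim_compose[OF I.profile_expectation_critical this], of "Gamma (1 - \<beta>)"]
  have "((\<lambda>a. Gamma (1 - \<beta>) * ((\<integral>w. profile 1 (exp (- (\<beta> * ln a))) w \<partial>L.inverse_law) / (\<beta> * ln a))) \<longlongrightarrow> 1) at_top"
    using G by simp
  moreover have "\<forall>\<^sub>F a in at_top. Gamma (1 - \<beta>) *
      ((\<integral>w. profile 1 (exp (- (\<beta> * ln a))) w \<partial>L.inverse_law) / (\<beta> * ln a)) =
      cauchy_const 1 * (\<integral>s. profile 1 (a powr (- \<beta>)) s \<partial>L.inverse_law) / (\<beta> / (pi * Gamma (1 - \<beta>)) * ln a)"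
    using eventually_gt_at_top[of 0]
  proof eventually_elim
    case (elim a)
    then have "exp (- (\<beta> * ln a)) = a powr (- \<beta>)" by (simp add: powr_def)
    moreover have "g * (E / (k * l)) = 1 / p * E / (k / (p * g) * l)"
      if "p \<noteq> 0" "g \<noteq> 0" "k \<noteq> 0" for p g E k l :: real
      using that by (cases "l = 0") (simp_all add: field_simps)
    ultimately show ?case using G beta unfolding C by simp
  qed
  ultimately show ?thesis by (rule Lim_transform_eventually)
qed

lemma ratio_d:
  assumes n: "1 \<le> n"
  shows "((\<lambda>a. cauchy_const n * (\<integral>s. profile n (a powr (- \<beta>)) s \<partial>L.inverse_law) /
    (Gamma ((n + 1) / 2) / (pi powr ((n + 1) / 2) * \<beta> * Gamma \<beta>) * (a powr (- \<beta>)) powr (- n - 1))) \<longlongrightarrow> 1) (at_right 0)"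
proof -
  interpret I: linear_at_0 L.inverse_law "1 / (1 - exp (- 1))" "1 / Gamma (1 - \<beta>)"
    by (rule L.linear_at_0_inverse_law)
  define K where "K = Gamma ((n + 1) / 2) / (pi powr ((n + 1) / 2) * \<beta> * Gamma \<beta>)"
  have K: "K \<noteq> 0"
    using beta n by (simp add: K_def Gamma_real_nonzero)
  have e: "- (n + 1) / 2 = - ((n + 1) / 2)" by (rule minus_divide_left[symmetric])
  have C: "cauchy_const n * (1 / (\<beta> * Gamma \<beta>)) = K"
  proof -
    have "inverse p * u * (1 / (k * w)) = u / (p * k * w)" for p u k w :: real
      by (simp add: divide_inverse)
    then show ?thesis unfolding K_def cauchy_const_def e powr_minus .
  qed
  have mean: "integrable L.inverse_law (\<lambda>w. w)" "(\<integral>w. w \<partial>L.inverse_law) = 1 / (\<beta> * Gamma \<beta>)"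
    using L.inverse_law_mean by (auto simp: has_bochner_integral_iff)
  have "filterlim (\<lambda>a::real. a powr (- \<beta>)) at_top (at_right 0)" using beta by real_asymp
  from tendsto_mult_left[OF filterlim_compose[OF I.profile_expectation_large_scale[OF n I.pos mean(1)] this],
      of "cauchy_const n"]
  have "((\<lambda>a. cauchy_const n * ((a powr (- \<beta>)) powr (n + 1) *
      (\<integral>w. profile n (a powr (- \<beta>)) w \<partial>L.inverse_law))) \<longlongrightarrow> K) (at_right 0)"
    by (simp only: mean(2) C)
  from tendsto_divide[OF this tendsto_const K]
  have "((\<lambda>a. cauchy_const n * ((a powr (- \<beta>)) powr (n + 1) *
      (\<integral>w. profile n (a powr (- \<beta>)) w \<partial>L.inverse_law)) / K) \<longlongrightarrow> 1) (at_right 0)"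
    using K by simp
  moreover have "cauchy_const n * (r powr (n + 1) * E) / K = cauchy_const n * E / (K * r powr (- n - 1))" for r E
  proof -
    have "- n - 1 = - (n + 1)" by simp
    then show ?thesis by (simp only: powr_minus mult_divide_inverse_swap)
  qed
  ultimately show ?thesis unfolding K_def[symmetric] by simp
qed

end

section \<open>Transfer of the four limits to the densities\<close>

theorem corollary2p5:
  fixes M :: "'a measure" and S :: "real \<Rightarrow> 'a \<Rightarrow> real" and \<beta> :: real
    and n :: real
    and pS pI :: "real \<Rightarrow> real ^ 'n \<Rightarrow> real ^ 'n \<Rightarrow> real"
    and D D' :: "(real \<times> (real ^ 'n) \<times> (real ^ 'n)) set"
  assumes "stable_subordinator M S \<beta>"
  defines "n \<equiv> real CARD('n)"
    and "pS \<equiv> subordinate_density M S"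
    and "pI \<equiv> subordinate_density M (inverse_process S)"
    and "D \<equiv> {(t, x, y). t > 0}"
    and "D' \<equiv> {(t, x, y). t > 0 \<and> x \<noteq> y}"
  shows
    "(\<lambda>(t, x, y). pS t x y)
       \<sim>[along (\<lambda>t x y. norm (x - y) * t powr (- 1 / \<beta>)) at_top D']
     (\<lambda>(t, x, y). \<beta> * 2 powr (\<beta> - 1) * Gamma ((n + \<beta>) / 2) / (pi powr (n / 2) * Gamma (1 - \<beta> / 2))
        * norm (x - y) powr (- n - \<beta>) * t) \<and>
     (\<lambda>(t, x, y). pS t x y)
       \<sim>[along (\<lambda>t x y. norm (x - y) * t powr (- 1 / \<beta>)) (nhds 0) D]
     (\<lambda>(t, x, y). Gamma ((n + 1) / 2) * Gamma (n / \<beta>) / (\<beta> * pi powr ((n + 1) / 2) * Gamma n)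
        * t powr (- n / \<beta>)) \<and>
     (\<lambda>(t, x, y). pI t x y)
       \<sim>[along (\<lambda>t x y. norm (x - y) powr (- 1 / \<beta>) * t) at_top D']
     (\<lambda>(t, x, y). if CARD('n) = 1
        then \<beta> / (pi * Gamma (1 - \<beta>)) * t powr (- \<beta>) * ln (norm (x - y) powr (- 1 / \<beta>) * t)
        else Gamma ((n - 1) / 2) / (2 * pi powr ((n + 1) / 2) * Gamma (1 - \<beta>))
               * norm (x - y) powr (1 - n) * t powr (- \<beta>)) \<and>
     (\<lambda>(t, x, y). pI t x y)
       \<sim>[along (\<lambda>t x y. norm (x - y) powr (- 1 / \<beta>) * t) (nhds 0) D']
     (\<lambda>(t, x, y). Gamma ((n + 1) / 2) / (pi powr ((n + 1) / 2) * \<beta> * Gamma \<beta>)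
        * norm (x - y) powr (- n - 1) * t powr \<beta>)"
proof -
  interpret stable_subordinator M S \<beta> by fact
  have n: "1 \<le> n" unfolding n_def by (simp add: Suc_leI)
  have pS_eq: "pS t x y = t powr (- n / \<beta>) * (cauchy_const n *
      (\<integral>s. profile n (norm (x - y) * t powr (- 1 / \<beta>)) s \<partial>law1))" if "0 < t" for t x y
    unfolding pS_def n_def by (rule density_S[OF that])
  have scale: "norm (x - y) * t powr (- \<beta>) = (norm (x - y) powr (- 1 / \<beta>) * t) powr (- \<beta>)"
    if "0 < t" "x \<noteq> y" for t and x y :: "real ^ 'n"
    using that beta by (simp add: powr_mult powr_powr)
  have pI_eq: "pI t x y = t powr (- n * \<beta>) * (cauchy_const n *
      (\<integral>s. profile n ((norm (x - y) powr (- 1 / \<beta>) * t) powr (- \<beta>)) s \<partial>L.inverse_law))"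
    if "0 < t" "x \<noteq> y" for t x y
    unfolding pI_def n_def scale[OF that, symmetric] by (rule density_inverse[OF that(1)])
  \<comment> \<open>Used with \<open>p = 1 - n\<close>, leaving \<open>t powr (- \<beta>)\<close>,
    and with \<open>p = - n - 1\<close>, leaving \<open>t powr \<beta>\<close>.\<close>
  have pow: "t powr (- n * \<beta>) * ((norm (x - y) powr (- 1 / \<beta>) * t) powr (- \<beta>)) powr p =
      norm (x - y) powr p * t powr (- (n + p) * \<beta>)"
    if "0 < t" "x \<noteq> y" for t p and x y :: "real ^ 'n"
  proof -
    have "((norm (x - y) powr (- 1 / \<beta>) * t) powr (- \<beta>)) powr p = norm (x - y) powr p * t powr (- \<beta> * p)"
      unfolding scale[OF that, symmetric] by (simp add: powr_mult powr_powr)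
    moreover have "t powr (- n * \<beta>) * t powr (- \<beta> * p) = t powr (- (n + p) * \<beta>)"
      by (simp only: powr_add[symmetric]) (simp add: algebra_simps)
    ultimately show ?thesis by simp
  qed
  show ?thesis
  proof (intro conjI)
    show "(\<lambda>(t, x, y). pS t x y)
       \<sim>[along (\<lambda>t x y. norm (x - y) * t powr (- 1 / \<beta>)) at_top D']
     (\<lambda>(t, x, y). \<beta> * 2 powr (\<beta> - 1) * Gamma ((n + \<beta>) / 2) / (pi powr (n / 2) * Gamma (1 - \<beta> / 2))
        * norm (x - y) powr (- n - \<beta>) * t)"
    proof (rule asymp_equiv_along[where E = UNIV and c = "\<lambda>t. t powr (- n / \<beta>)",
          OF tendsto_mono[OF inf_le1 ratio_a[OF n]]])
      fix t x y assume "(t, x, y) \<in> D'"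
      then have t: "0 < t" by (simp add: D'_def)
      show "t powr (- n / \<beta>) \<noteq> 0" using t by simp
      show "pS t x y = t powr (- n / \<beta>) * (cauchy_const n *
          (\<integral>s. profile n (norm (x - y) * t powr (- 1 / \<beta>)) s \<partial>law1))"
        by (rule pS_eq[OF t])
      have "- 1 / \<beta> * (- n - \<beta>) = n / \<beta> + 1" using beta by (simp add: field_simps)
      then have "(norm (x - y) * t powr (- 1 / \<beta>)) powr (- n - \<beta>) =
          norm (x - y) powr (- n - \<beta>) * t powr (n / \<beta> + 1)"
        by (simp only: powr_mult powr_powr)
      moreover have "t powr (- n / \<beta>) * t powr (n / \<beta> + 1) = t"
        using t by (simp add: powr_add[symmetric])
      ultimately have eq: "norm (x - y) powr (- n - \<beta>) * t =
          t powr (- n / \<beta>) * (norm (x - y) * t powr (- 1 / \<beta>)) powr (- n - \<beta>)"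
        by (simp only: mult.left_commute[of "t powr (- n / \<beta>)"])
      show "\<beta> * 2 powr (\<beta> - 1) * Gamma ((n + \<beta>) / 2) / (pi powr (n / 2) * Gamma (1 - \<beta> / 2))
            * norm (x - y) powr (- n - \<beta>) * t =
          t powr (- n / \<beta>) * (\<beta> * 2 powr (\<beta> - 1) * Gamma ((n + \<beta>) / 2) / (pi powr (n / 2) * Gamma (1 - \<beta> / 2))
            * (norm (x - y) * t powr (- 1 / \<beta>)) powr (- n - \<beta>))"
        unfolding mult.assoc[of _ "norm (x - y) powr (- n - \<beta>)" t] eq by (rule mult.left_commute)
    qed simp
    show "(\<lambda>(t, x, y). pS t x y)
       \<sim>[along (\<lambda>t x y. norm (x - y) * t powr (- 1 / \<beta>)) (nhds 0) D]
     (\<lambda>(t, x, y). Gamma ((n + 1) / 2) * Gamma (n / \<beta>) / (\<beta> * pi powr ((n + 1) / 2) * Gamma n)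
        * t powr (- n / \<beta>))"
    proof (rule asymp_equiv_along[where E = UNIV and c = "\<lambda>t. t powr (- n / \<beta>)",
          OF tendsto_mono[OF inf_le1 ratio_b[OF n]]])
      fix t x y assume "(t, x, y) \<in> D"
      then have t: "0 < t" by (simp add: D_def)
      show "t powr (- n / \<beta>) \<noteq> 0" using t by simp
      show "pS t x y = t powr (- n / \<beta>) * (cauchy_const n *
          (\<integral>s. profile n (norm (x - y) * t powr (- 1 / \<beta>)) s \<partial>law1))"
        by (rule pS_eq[OF t])
    qed (simp, rule mult.commute)
    show "(\<lambda>(t, x, y). pI t x y)
       \<sim>[along (\<lambda>t x y. norm (x - y) powr (- 1 / \<beta>) * t) at_top D']
     (\<lambda>(t, x, y). if CARD('n) = 1
        then \<beta> / (pi * Gamma (1 - \<beta>)) * t powr (- \<beta>) * ln (norm (x - y) powr (- 1 / \<beta>) * t)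
        else Gamma ((n - 1) / 2) / (2 * pi powr ((n + 1) / 2) * Gamma (1 - \<beta>))
               * norm (x - y) powr (1 - n) * t powr (- \<beta>))"
    proof (cases "CARD('n) = 1")
      case True
      then have n1: "n = 1" by (simp add: n_def)
      have "(\<lambda>(t, x, y). pI t x y)
         \<sim>[along (\<lambda>t x y. norm (x - y) powr (- 1 / \<beta>) * t) at_top D']
       (\<lambda>(t, x, y). \<beta> / (pi * Gamma (1 - \<beta>)) * t powr (- \<beta>) * ln (norm (x - y) powr (- 1 / \<beta>) * t))"
      proof (rule asymp_equiv_along[where E = UNIV and c = "\<lambda>t. t powr (- 1 * \<beta>)",
            OF tendsto_mono[OF inf_le1 ratio_c_1]])
        fix t x y assume "(t, x, y) \<in> D'"
        then have txy: "0 < t" "x \<noteq> y" by (auto simp: D'_def)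
        show "t powr (- 1 * \<beta>) \<noteq> 0" using txy by simp
        show "pI t x y = t powr (- 1 * \<beta>) * (cauchy_const 1 *
            (\<integral>s. profile 1 ((norm (x - y) powr (- 1 / \<beta>) * t) powr (- \<beta>)) s \<partial>L.inverse_law))"
          by (rule pI_eq[OF txy, unfolded n1])
        have "k * u * l = u * (k * l)" for k u l :: real by (simp only: mult_ac)
        then show "\<beta> / (pi * Gamma (1 - \<beta>)) * t powr (- \<beta>) * ln (norm (x - y) powr (- 1 / \<beta>) * t) =
            t powr (- 1 * \<beta>) * (\<beta> / (pi * Gamma (1 - \<beta>)) * ln (norm (x - y) powr (- 1 / \<beta>) * t))"
          by simp
      qed simp
      with True show ?thesis by simp
    next
      case False
      moreover have "0 < CARD('n)" by simp
      ultimately have "1 < CARD('n)" by linarith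
      then have n1: "1 < n" by (simp add: n_def)
      have "(\<lambda>(t, x, y). pI t x y)
         \<sim>[along (\<lambda>t x y. norm (x - y) powr (- 1 / \<beta>) * t) at_top D']
       (\<lambda>(t, x, y). Gamma ((n - 1) / 2) / (2 * pi powr ((n + 1) / 2) * Gamma (1 - \<beta>))
               * norm (x - y) powr (1 - n) * t powr (- \<beta>))"
      proof (rule asymp_equiv_along[where E = UNIV and c = "\<lambda>t. t powr (- n * \<beta>)",
            OF tendsto_mono[OF inf_le1 ratio_c[OF n1]]])
        fix t x y assume "(t, x, y) \<in> D'"
        then have txy: "0 < t" "x \<noteq> y" by (auto simp: D'_def)
        show "t powr (- n * \<beta>) \<noteq> 0" using txy by simp
        show "pI t x y = t powr (- n * \<beta>) * (cauchy_const n *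
            (\<integral>s. profile n ((norm (x - y) powr (- 1 / \<beta>) * t) powr (- \<beta>)) s \<partial>L.inverse_law))"
          by (rule pI_eq[OF txy])
        have "- (n + (1 - n)) * \<beta> = - \<beta>" by simp
        then have eq: "norm (x - y) powr (1 - n) * t powr (- \<beta>) =
            t powr (- n * \<beta>) * ((norm (x - y) powr (- 1 / \<beta>) * t) powr (- \<beta>)) powr (1 - n)"
          by (simp only: pow[OF txy])
        show "Gamma ((n - 1) / 2) / (2 * pi powr ((n + 1) / 2) * Gamma (1 - \<beta>))
               * norm (x - y) powr (1 - n) * t powr (- \<beta>) =
            t powr (- n * \<beta>) * (Gamma ((n - 1) / 2) / (2 * pi powr ((n + 1) / 2) * Gamma (1 - \<beta>)) *
              ((norm (x - y) powr (- 1 / \<beta>) * t) powr (- \<beta>)) powr (1 - n))"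
          unfolding mult.assoc[of _ "norm (x - y) powr (1 - n)" "t powr (- \<beta>)"] eq by (rule mult.left_commute)
      qed simp
      with False show ?thesis by simp
    qed
    show "(\<lambda>(t, x, y). pI t x y)
       \<sim>[along (\<lambda>t x y. norm (x - y) powr (- 1 / \<beta>) * t) (nhds 0) D']
     (\<lambda>(t, x, y). Gamma ((n + 1) / 2) / (pi powr ((n + 1) / 2) * \<beta> * Gamma \<beta>)
        * norm (x - y) powr (- n - 1) * t powr \<beta>)"
    \<comment> \<open>The scaling variable is positive on \<open>D'\<close>, so the neighbourhoods
      of 0 reduce to right neighbourhoods, on which \<open>ratio_d\<close> is available.\<close>
    proof (rule asymp_equiv_along[where E = "{0<..}" and c = "\<lambda>t. t powr (- n * \<beta>)"])
      have "inf (nhds 0) (principal {0<..}) = at_right (0::real)" by (simp add: at_within_def)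
      then show "((\<lambda>a. cauchy_const n * (\<integral>s. profile n (a powr (- \<beta>)) s \<partial>L.inverse_law) /
          (Gamma ((n + 1) / 2) / (pi powr ((n + 1) / 2) * \<beta> * Gamma \<beta>) * (a powr (- \<beta>)) powr (- n - 1)))
          \<longlongrightarrow> 1) (inf (nhds 0) (principal {0<..}))"
        using ratio_d[OF n] by (simp only:)
      fix t x y assume "(t, x, y) \<in> D'"
      then have txy: "0 < t" "x \<noteq> y" by (auto simp: D'_def)
      show "norm (x - y) powr (- 1 / \<beta>) * t \<in> {0<..}" using txy by simp
      show "t powr (- n * \<beta>) \<noteq> 0" using txy by simp
      show "pI t x y = t powr (- n * \<beta>) * (cauchy_const n *
          (\<integral>s. profile n ((norm (x - y) powr (- 1 / \<beta>) * t) powr (- \<beta>)) s \<partial>L.inverse_law))"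
        by (rule pI_eq[OF txy])
      have "- (n + (- n - 1)) * \<beta> = \<beta>" by simp
      then have eq: "norm (x - y) powr (- n - 1) * t powr \<beta> =
          t powr (- n * \<beta>) * ((norm (x - y) powr (- 1 / \<beta>) * t) powr (- \<beta>)) powr (- n - 1)"
        by (simp only: pow[OF txy])
      show "Gamma ((n + 1) / 2) / (pi powr ((n + 1) / 2) * \<beta> * Gamma \<beta>) * norm (x - y) powr (- n - 1) * t powr \<beta> =
          t powr (- n * \<beta>) * (Gamma ((n + 1) / 2) / (pi powr ((n + 1) / 2) * \<beta> * Gamma \<beta>) *
            ((norm (x - y) powr (- 1 / \<beta>) * t) powr (- \<beta>)) powr (- n - 1))"
        unfolding mult.assoc[of _ "norm (x - y) powr (- n - 1)" "t powr \<beta>"] eq by (rule mult.left_commute)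
    qed
  qed
qed

end
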